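(* Let $f$ be a probability density on $\mathbb{R}$ such that $\int_{\mathbb{R}}x^2f(x)\,dx=1$ and $I(f\mid\gamma)<\infty$. Then $\hat f^N$ is Fisher information chaotic to $f$.
   Context: $\gamma(x)=\frac1{\sqrt{2\pi}}e^{-x^2/2}$. Kac's sphere is $S^{N-1}=\{x\in\mathbb{R}^N:\sum_i x_i^2=N\}$, with uniform probability measure $\sigma^N$. For $x\in\mathbb{R}^N\setminus\{0\}$ put $\hat x=\frac{\sqrt N}{|x|}x\in S^{N-1}$. $\hat f^N$ is the push-forward of $f^{\otimes N}$ under $x\mapsto\hat x$ (a probability measure on $S^{N-1}$). Relative Fisher information: for probability measures $F,G$ on $\mathbb{R}^N$, $I(F\mid G)=\int_{\mathbb{R}^N}\frac{|\nabla h|^2}{h}\,dG$ with $h=dF/dG$, and $I(F\mid G)=+\infty$ when $F$ does not have a density with respect to $G$ with continuous first derivatives. For probability measures $F,G$ on $S^{N-1}$ it is defined similarly, with $\nabla$ replaced by the spherical gradient $\nabla_S$: for $h\in C^1(S^{N-1})$ and $y\in S^{N-1}$, $\nabla_Sh(y)=\nabla\tilde h(y)-\frac1N(\nabla\tilde h(y)\cdot y)\,y$, where $\tilde h$ is any $C^1$ extension of $h$ to a neighbourhood of $y$ in $\mathbb{R}^N$. Kac chaos: a sequence $(F^N)_N$ of permutation-invariant probability measures on $\mathbb{R}^N$ is Kac chaotic to $f$ if for every $k\in\mathbb{N}$ the marginal of $F^N$ on its first $k$ coordinates converges weakly to $f^{\otimes k}$ as $N\to\infty$. Fisher information chaos: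 a sequence $(F^N)_N$ of permutation-invariant probability measures on $S^{N-1}$ is Fisher information chaotic to $f$ (with $I(f\mid\gamma)<\infty$) if it is Kac chaotic to $f$ and $\lim_{N\to\infty}\frac1NI(F^N\mid\sigma^N)=I(f\mid\gamma)$.
   Formalization: Fisher information on the sphere uses densities whose spherical gradient is an L¹(σ^N)-limit of gradients of C¹ functions, instead of C¹ densities only; with C¹ densities only the claim fails, e.g. for f(x)=c(1+x²/a²)^(-2). For C¹ densities the value is the same. *)

theory Defs
  imports "HOL-Probability.Probability"
begin

(* Vectors of R^N, with N varying, are functions in "extensional {..<N}", i.e. points of
   the space of "PiM {..<N} (\<lambda>_. borel)". The topology is the one of the function type
   (pointwise convergence), which on this set is the Euclidean one; the Euclidean norm is
   "L2_set x {..<N}". *)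

definition Rn :: "nat \<Rightarrow> (nat \<Rightarrow> real) measure" where
  "Rn N = PiM {..<N} (\<lambda>_. borel)"

definition prob_on_Rn :: "nat \<Rightarrow> (nat \<Rightarrow> real) measure \<Rightarrow> bool" where
  "prob_on_Rn N F \<longleftrightarrow> prob_space F \<and> sets F = sets (Rn N)"

definition perm_invariant :: "nat \<Rightarrow> (nat \<Rightarrow> real) measure \<Rightarrow> bool" where
  "perm_invariant N F \<longleftrightarrow>
     (\<forall>p. p permutes {..<N} \<longrightarrow> distr F (Rn N) (\<lambda>x. \<lambda>i\<in>{..<N}. x (p i)) = F)"

definition tensor_power :: "real measure \<Rightarrow> nat \<Rightarrow> (nat \<Rightarrow> real) measure" where
  "tensor_power \<mu> N = PiM {..<N} (\<lambda>_. \<mu>)"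

definition kac_sphere :: "nat \<Rightarrow> (nat \<Rightarrow> real) set" where
  "kac_sphere N = {x \<in> extensional {..<N}. (\<Sum>i<N. (x i)\<^sup>2) = real N}"

(* At x = 0, where the map is not defined mathematically, the value is 0. Only measures
   without mass at 0 are pushed forward. *)
definition to_sphere :: "nat \<Rightarrow> (nat \<Rightarrow> real) \<Rightarrow> nat \<Rightarrow> real" where
  "to_sphere N x = (\<lambda>i\<in>{..<N}. sqrt (real N) / L2_set x {..<N} * x i)"

(* Probability measures on the sphere are represented as probability measures on R^N that
   are concentrated on the sphere. *)
definition rescaled_tensor :: "real measure \<Rightarrow> nat \<Rightarrow> (nat \<Rightarrow> real) measure" where
  "rescaled_tensor \<mu> N = distr (tensor_power \<mu> N) (Rn N) (to_sphere N)"

(* The normalized surface measure of a Euclidean sphere is its cone measure: the image of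
   the uniform distribution on the unit ball under radial projection. *)
definition uniform_sphere :: "nat \<Rightarrow> (nat \<Rightarrow> real) measure" where
  "uniform_sphere N =
     distr (uniform_measure (PiM {..<N} (\<lambda>_. lborel))
             {x \<in> extensional {..<N}. L2_set x {..<N} \<le> 1})
       (Rn N) (to_sphere N)"

definition gauss :: "real measure" where
  "gauss = density lborel (\<lambda>x. ennreal (std_normal_density x))"


(* Here and below the infimum is over all versions h of the density dF/dG; the version is
   unique when G has full support, and Inf {} = \<infinity> is the value when there is none.
   Where h vanishes so does its gradient, and 0 / 0 = 0. *)
definition relative_fisher :: "'a::euclidean_space measure \<Rightarrow> 'a measure \<Rightarrow> ennreal" where
  "relative_fisher F G =
     Inf {(\<integral>\<^sup>+x. ennreal ((norm (g x))\<^sup>2 / h x) \<partial>G) | h g.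
            (\<forall>x. 0 \<le> h x) \<and> (\<forall>x. GDERIV h x :> g x) \<and> continuous_on UNIV g \<and>
            F = density G (\<lambda>x. ennreal (h x))}"


(* k is C^1 on the (relatively open) set U of R^N, with partial derivatives "dk i". *)
definition C1_partials ::
    "nat \<Rightarrow> (nat \<Rightarrow> real) set \<Rightarrow> ((nat \<Rightarrow> real) \<Rightarrow> real) \<Rightarrow> (nat \<Rightarrow> (nat \<Rightarrow> real) \<Rightarrow> real) \<Rightarrow> bool"
  where
  "C1_partials N U k dk \<longleftrightarrow>
     (\<forall>i<N. (\<forall>x\<in>U. ((\<lambda>t. k (x(i := t))) has_real_derivative dk i x) (at (x i))) \<and>
            continuous_on U (dk i))"

(* G is the spherical gradient of h at y, computed from some C^1 extension k of h to a
   neighbourhood of y in R^N. *)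
definition has_sphere_grad ::
    "nat \<Rightarrow> ((nat \<Rightarrow> real) \<Rightarrow> real) \<Rightarrow> (nat \<Rightarrow> real) \<Rightarrow> (nat \<Rightarrow> real) \<Rightarrow> bool" where
  "has_sphere_grad N h y G \<longleftrightarrow>
     (\<exists>U k dk. openin (top_of_set (extensional {..<N})) U \<and> y \<in> U \<and> C1_partials N U k dk \<and>
        (\<forall>x \<in> U \<inter> kac_sphere N. k x = h x) \<and>
        G = (\<lambda>i\<in>{..<N}. dk i y - (1 / real N) * (\<Sum>j<N. dk j y * y j) * y i))"

definition sphere_C1 :: "nat \<Rightarrow> ((nat \<Rightarrow> real) \<Rightarrow> real) \<Rightarrow> bool" where
  "sphere_C1 N h \<longleftrightarrow> (\<forall>y \<in> kac_sphere N. \<exists>G. has_sphere_grad N h y G)"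

definition sphere_grad ::
    "nat \<Rightarrow> ((nat \<Rightarrow> real) \<Rightarrow> real) \<Rightarrow> (nat \<Rightarrow> real) \<Rightarrow> nat \<Rightarrow> real" where
  "sphere_grad N h y = (SOME G. has_sphere_grad N h y G)"

(* Closure of the spherical gradient on C^1 functions in L^1 of the uniform measure. For h of
   class C^1 this is the classical gradient, see has_weak_sphere_grad_C1.

   C^1 densities alone do not suffice on the sphere: the density of the rescaled tensor
   product with respect to the uniform measure need not have a continuous version, however
   smooth f is. If f(x) decays like |x|^(-4) and f(0) > 0, it is infinite at sqrt N * e_1 and
   lower semicontinuous, hence essentially unbounded, for every N >= 4. *)
definition has_weak_sphere_grad ::
    "nat \<Rightarrow> ((nat \<Rightarrow> real) \<Rightarrow> real) \<Rightarrow> ((nat \<Rightarrow> real) \<Rightarrow> nat \<Rightarrow> real) \<Rightarrow> bool" where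
  "has_weak_sphere_grad N h g \<longleftrightarrow>
     (\<forall>i<N. (\<lambda>y. g y i) \<in> borel_measurable (Rn N)) \<and>
     (\<exists>H. (\<forall>n. sphere_C1 N (H n)) \<and>
        (\<lambda>n. \<integral>\<^sup>+y. ennreal \<bar>H n y - h y\<bar> \<partial>uniform_sphere N) \<longlonglongrightarrow> 0 \<and>
        (\<lambda>n. \<integral>\<^sup>+y. ennreal (L2_set (\<lambda>i. sphere_grad N (H n) y i - g y i) {..<N})
                \<partial>uniform_sphere N) \<longlonglongrightarrow> 0)"

lemma has_weak_sphere_grad_C1:
  assumes "sphere_C1 N h"
    and "\<And>i. i < N \<Longrightarrow> (\<lambda>y. g y i) \<in> borel_measurable (Rn N)"
    and "AE y in uniform_sphere N. \<forall>i<N. g y i = sphere_grad N h y i"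
  shows "has_weak_sphere_grad N h g"
proof -
  have "(\<integral>\<^sup>+y. ennreal (L2_set (\<lambda>i. sphere_grad N h y i - g y i) {..<N}) \<partial>uniform_sphere N)
      = (\<integral>\<^sup>+y. 0 \<partial>uniform_sphere N)"
    using assms(3) by (intro nn_integral_cong_AE) (auto simp: L2_set_def elim!: eventually_mono)
  with assms(1,2) show ?thesis
    unfolding has_weak_sphere_grad_def by (intro conjI exI[of _ "\<lambda>_. h"]) auto
qed

(* The weak gradient is unique almost everywhere and vanishes almost everywhere on {h = 0}. *)
definition sphere_fisher :: "nat \<Rightarrow> (nat \<Rightarrow> real) measure \<Rightarrow> ennreal" where
  "sphere_fisher N F =
     Inf {(\<integral>\<^sup>+y. ennreal ((L2_set (g y) {..<N})\<^sup>2 / h y) \<partial>uniform_sphere N) | h g.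
            h \<in> borel_measurable (Rn N) \<and> (\<forall>y. 0 \<le> h y) \<and> has_weak_sphere_grad N h g \<and>
            F = density (uniform_sphere N) (\<lambda>y. ennreal (h y))}"


(* For N < k the restriction is meaningless, but the notion is only used in the limit. *)
definition marginal :: "nat \<Rightarrow> (nat \<Rightarrow> real) measure \<Rightarrow> (nat \<Rightarrow> real) measure" where
  "marginal k F = distr F (Rn k) (\<lambda>x. restrict x {..<k})"

definition weakly_converges ::
    "nat \<Rightarrow> (nat \<Rightarrow> (nat \<Rightarrow> real) measure) \<Rightarrow> (nat \<Rightarrow> real) measure \<Rightarrow> bool" where
  "weakly_converges k \<mu> \<nu> \<longleftrightarrow>
     (\<forall>\<phi>::(nat \<Rightarrow> real) \<Rightarrow> real.
        continuous_on (extensional {..<k}) \<phi> \<longrightarrow> bounded (\<phi> ` extensional {..<k}) \<longrightarrow>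
        (\<lambda>N. \<integral>x. \<phi> x \<partial>\<mu> N) \<longlonglongrightarrow> (\<integral>x. \<phi> x \<partial>\<nu>))"

definition kac_chaotic :: "(nat \<Rightarrow> (nat \<Rightarrow> real) measure) \<Rightarrow> real measure \<Rightarrow> bool" where
  "kac_chaotic F \<mu> \<longleftrightarrow>
     (\<forall>N\<ge>1. prob_on_Rn N (F N) \<and> perm_invariant N (F N)) \<and>
     (\<forall>k. weakly_converges k (\<lambda>N. marginal k (F N)) (tensor_power \<mu> k))"

definition fisher_chaotic :: "(nat \<Rightarrow> (nat \<Rightarrow> real) measure) \<Rightarrow> real measure \<Rightarrow> bool" where
  "fisher_chaotic F \<mu> \<longleftrightarrow>
     (\<forall>N\<ge>1. AE y in F N. y \<in> kac_sphere N) \<and>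
     kac_chaotic F \<mu> \<and>
     relative_fisher \<mu> gauss < \<infinity> \<and>
     (\<lambda>N. sphere_fisher N (F N) / of_nat N) \<longlonglongrightarrow> relative_fisher \<mu> gauss"

end

theory Submission
  imports Defs
begin

text \<open>
  Write \<open>f = h \<gamma>\<close>, \<open>I = I(f | \<gamma>)\<close> and \<open>F\<^sup>N\<close> for the rescaled tensor product. Everything on the
  sphere is expressed by the rotation fields \<open>L\<^bsub>ij\<^esub> = y\<^sub>i \<partial>\<^sub>j - y\<^sub>j \<partial>\<^sub>i\<close>: by Lagrange's identity
  \<open>\<bar>\<nabla>\<^sub>S H\<bar>\<^sup>2 = 1/(2N) \<Sum>\<^bsub>i,j\<^esub> (L\<^bsub>ij\<^esub> H)\<^sup>2\<close>, and rotation invariance of \<open>\<sigma>\<^sup>N\<close> gives integration by parts.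

  Upper bound. Under \<open>\<gamma>\<^sup>\<otimes>\<^sup>N\<close> radius and direction are independent, so the density of \<open>F\<^sup>N\<close> is the
  conditional expectation of \<open>h\<^sup>\<otimes>\<^sup>N\<close> given the direction, and its \<open>L\<^bsub>ij\<^esub>\<close> derivatives are the conditional
  expectations of those of \<open>h\<^sup>\<otimes>\<^sup>N\<close>. Jensen's inequality bounds \<open>I(F\<^sup>N | \<sigma>\<^sup>N)\<close> by
  \<open>1/(2N) \<Sum>\<^bsub>i \<noteq> j\<^esub> E (x\<^sub>i u(x\<^sub>j) - x\<^sub>j u(x\<^sub>i))\<^sup>2 \<le> (N - 1) I\<close> with \<open>u = h'/h\<close>, because \<open>E x\<^sup>2 = 1\<close> and \<open>E u\<^sup>2 = I\<close>.

  Lower bound. Testing with the tangential part of the field \<open>(\<phi>(y\<^sub>1), ..., \<phi>(y\<^sub>N))\<close> bounds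
  \<open>I(F\<^sup>N | \<sigma>\<^sup>N) / N\<close> from below by an integral against the first marginal of \<open>F\<^sup>N\<close>. By Kac chaos it
  converges to \<open>\<integral> (2 \<phi> h' - \<phi>\<^sup>2 h) d\<gamma>\<close>, whose supremum over \<open>\<phi>\<close> is \<open>I\<close>.

  Kac chaos follows from the law of large numbers for \<open>\<bar>x\<bar>\<^sup>2 / N\<close>.
\<close>

subsection \<open>Rotations and scalings of Lebesgue measure\<close>

text \<open>The infimum in \<open>sphere_fisher\<close> runs over all pairs of a density and a weak
  gradient, and a weak gradient is only an L^1 limit. Hence the two bounds differ in shape: above,
  one pair is exhibited; below, an arbitrary pair has to be eliminated. Two obstacles arise below.
  Since x / 0 = 0, a gradient living on {h = 0} would cost nothing, so its contribution must be
  excluded; and products of \<open>\<psi>' (H n)\<close> with derivatives of \<open>H n\<close> need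
  almost everywhere convergence, available only along subsequences. Above, rotation fields are
  better than the Euclidean gradient weighted by the radius: for i \<noteq> j they only pair x_i
  with u(x_j), so independence factors the means, whereas x_i^2 u(x_i)^2 may have infinite mean. The
  factors h and h' may be unbounded, so C^1 functions on the sphere are reached by cutting h off and
  the density is recovered in L^1. The uniform measure is given as a cone measure, so its invariance
  and the polar formula both come from changes of variables in Lebesgue measure.\<close>

lemma space_Rn [simp]: "space (Rn N) = extensional {..<N}"
  by (auto simp: Rn_def space_PiM PiE_def)

lemma sets_PiM_lborel_Rn [measurable_cong]: "sets (PiM {..<N} (\<lambda>_. lborel)) = sets (Rn N)"
  unfolding Rn_def by (rule sets_PiM_cong) auto

lemma space_PiM_lborel_Rn [simp]: "space (PiM {..<N} (\<lambda>_. lborel)) = extensional {..<N}"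
  by (auto simp: space_PiM PiE_def)

lemma measurable_Rn_component [measurable]: "i < N \<Longrightarrow> (\<lambda>x. x i) \<in> borel_measurable (Rn N)"
  unfolding Rn_def by measurable

lemma measurable_to_Rn:
  assumes "\<And>x. x \<in> space M \<Longrightarrow> g x \<in> extensional {..<N}"
    and "\<And>i. i < N \<Longrightarrow> (\<lambda>x. g x i) \<in> borel_measurable M"
  shows "g \<in> measurable M (Rn N)"
  unfolding Rn_def using assms by (intro measurable_PiM_single') (auto simp: PiE_def)

lemma measurable_restrict_Rn:
  assumes "\<And>i. i < N \<Longrightarrow> (\<lambda>x. g x i) \<in> borel_measurable M"
  shows "(\<lambda>x. \<lambda>i\<in>{..<N}. g x i) \<in> measurable M (Rn N)"
  using assms by (intro measurable_to_Rn) auto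

lemma measurable_L2_set_Rn [measurable]: "(\<lambda>x. L2_set x {..<N}) \<in> borel_measurable (Rn N)"
  unfolding L2_set_def by measurable

lemma measurable_to_sphere [measurable]: "to_sphere N \<in> measurable (Rn N) (Rn N)"
  unfolding to_sphere_def[abs_def] by (intro measurable_restrict_Rn) measurable

lemma sets_kac_sphere [measurable]: "kac_sphere N \<in> sets (Rn N)"
proof -
  have "kac_sphere N = {x \<in> space (Rn N). (\<Sum>i<N. (x i)\<^sup>2) = real N}"
    by (auto simp: kac_sphere_def)
  also have "\<dots> \<in> sets (Rn N)" by measurable
  finally show ?thesis .
qed

lemma L2_set_sq: "(L2_set x {..<N})\<^sup>2 = (\<Sum>i<N. (x i)\<^sup>2)"
  unfolding L2_set_def by (simp add: sum_nonneg)

lemma to_sphere_in_kac_sphere: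
  assumes "L2_set x {..<N} \<noteq> 0"
  shows "to_sphere N x \<in> kac_sphere N"
proof -
  have "(\<Sum>i<N. (to_sphere N x i)\<^sup>2) = (\<Sum>i<N. real N / (L2_set x {..<N})\<^sup>2 * (x i)\<^sup>2)"
    by (intro sum.cong) (auto simp: to_sphere_def power_mult_distrib power_divide)
  also have "\<dots> = real N / (L2_set x {..<N})\<^sup>2 * (L2_set x {..<N})\<^sup>2"
    by (simp add: sum_distrib_left L2_set_sq)
  also have "\<dots> = real N" using assms by simp
  finally show ?thesis by (simp add: kac_sphere_def to_sphere_def)
qed

text \<open>Tonelli isolates coordinate i, where the affine substitution on the line applies.
  Because the shift \<open>b\<close> ignores coordinate i, one statement covers shears
  (\<open>a = 1\<close>) and scalings (\<open>b = 0\<close>), of which rotations and dilations are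
  composed.\<close>

lemma nn_integral_PiM_lborel_coord:
  fixes a :: real and b :: "(nat \<Rightarrow> real) \<Rightarrow> real"
  assumes i: "i < N" and a: "a \<noteq> 0"
    and F [measurable]: "F \<in> borel_measurable (Rn N)"
    and b [measurable]: "b \<in> borel_measurable (Rn N)" and bi: "\<And>x t. b (x(i := t)) = b x"
  shows "(\<integral>\<^sup>+x. F x \<partial>PiM {..<N} (\<lambda>_. lborel)) =
     ennreal \<bar>a\<bar> * (\<integral>\<^sup>+x. F (x(i := b x + a * x i)) \<partial>PiM {..<N} (\<lambda>_. lborel))"
proof -
  interpret product_sigma_finite "\<lambda>_::nat. lborel :: real measure" by standard
  define J where "J = {..<N} - {i}"
  have J: "{..<N} = insert i J" "finite J" "i \<notin> J" using i by (auto simp: J_def)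
  have upd: "(\<lambda>x. x(i := b x + a * x i)) \<in> measurable (Rn N) (Rn N)"
  proof (rule measurable_to_Rn)
    show "(\<lambda>x. (x(i := b x + a * x i)) k) \<in> borel_measurable (Rn N)" if "k < N" for k
      using i that by (cases "k = i") auto
  qed (use i in \<open>auto simp: extensional_def\<close>)
  have F': "F \<in> borel_measurable (PiM (insert i J) (\<lambda>_. lborel))"
    unfolding J(1)[symmetric] by measurable
  have Fu: "(\<lambda>x. F (x(i := b x + a * x i))) \<in> borel_measurable (PiM (insert i J) (\<lambda>_. lborel))"
    unfolding J(1)[symmetric] using measurable_compose[OF upd F] by measurable
  have "(\<integral>\<^sup>+x. F x \<partial>PiM {..<N} (\<lambda>_. lborel)) =
      (\<integral>\<^sup>+x. \<integral>\<^sup>+t. F (x(i := t)) \<partial>lborel \<partial>PiM J (\<lambda>_. lborel))"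
    unfolding J(1) using J F' by (intro product_nn_integral_insert) auto
  also have "\<dots> = (\<integral>\<^sup>+x. ennreal \<bar>a\<bar> * \<integral>\<^sup>+t. F (x(i := b x + a * t)) \<partial>lborel \<partial>PiM J (\<lambda>_. lborel))"
  proof (rule nn_integral_cong)
    fix x assume x: "x \<in> space (PiM J (\<lambda>_. lborel :: real measure))"
    have "(\<lambda>t. x(i := t)) \<in> measurable borel (Rn N)"
    proof (rule measurable_to_Rn)
      show "(\<lambda>t. (x(i := t)) k) \<in> borel_measurable borel" for k
        by (cases "k = i") auto
    qed (use x i J in \<open>auto simp: extensional_def space_PiM PiE_def\<close>)
    then have "(\<lambda>t. F (x(i := t))) \<in> borel_measurable borel"
      using F by (rule measurable_compose)
    then show "(\<integral>\<^sup>+t. F (x(i := t)) \<partial>lborel) =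
        ennreal \<bar>a\<bar> * (\<integral>\<^sup>+t. F (x(i := b x + a * t)) \<partial>lborel)"
      using a by (subst nn_integral_real_affine[where c = a and t = "b x"]) auto
  qed
  also have "\<dots> = ennreal \<bar>a\<bar> * (\<integral>\<^sup>+x. \<integral>\<^sup>+t. F (x(i := b x + a * t)) \<partial>lborel \<partial>PiM J (\<lambda>_. lborel))"
  proof (rule nn_integral_cmult)
      have m: "(\<lambda>p. (fst p)(i := snd p)) \<in> measurable (PiM J (\<lambda>_. lborel) \<Otimes>\<^sub>M lborel) (PiM (insert i J) (\<lambda>_. lborel))"
      using measurable_add_dim[of i J "\<lambda>_. lborel :: real measure"] by (simp add: case_prod_beta')
    have "(\<lambda>p. F (((fst p)(i := snd p))(i := b ((fst p)(i := snd p)) + a * ((fst p)(i := snd p)) i)))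
      \<in> borel_measurable (PiM J (\<lambda>_. lborel) \<Otimes>\<^sub>M lborel)"
      using measurable_compose[OF m Fu] .
    then show "(\<lambda>x. \<integral>\<^sup>+t. F (x(i := b x + a * t)) \<partial>lborel) \<in> borel_measurable (PiM J (\<lambda>_. lborel))"
      by (intro lborel.borel_measurable_nn_integral) (simp add: bi case_prod_beta')
  qed
  also have "(\<integral>\<^sup>+x. \<integral>\<^sup>+t. F (x(i := b x + a * t)) \<partial>lborel \<partial>PiM J (\<lambda>_. lborel)) =
     (\<integral>\<^sup>+x. F (x(i := b x + a * x i)) \<partial>PiM {..<N} (\<lambda>_. lborel))"
    unfolding J(1) using J Fu by (subst product_nn_integral_insert) (auto simp: bi)
  finally show ?thesis .
qed

lemma nn_integral_PiM_lborel_scale: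
  fixes c :: real
  assumes c: "c > 0" and F [measurable]: "F \<in> borel_measurable (Rn N)"
  shows "(\<integral>\<^sup>+x. F x \<partial>PiM {..<N} (\<lambda>_. lborel)) =
     ennreal (c ^ N) * (\<integral>\<^sup>+x. F (\<lambda>k\<in>{..<N}. c * x k) \<partial>PiM {..<N} (\<lambda>_. lborel))"
proof -
  \<comment> \<open>\<open>S m\<close> scales the first m coordinates only; passing from m to m + 1
    is one application of the coordinate substitution.\<close>
  define S where "S m x = (\<lambda>k\<in>{..<N}. if k < m then c * x k else x k)" for m and x :: "nat \<Rightarrow> real"
  have S [measurable]: "S m \<in> measurable (Rn N) (Rn N)" for m
    unfolding S_def by (rule measurable_restrict_Rn) (auto split: if_splits)
  have "m \<le> N \<Longrightarrow> (\<integral>\<^sup>+x. F x \<partial>PiM {..<N} (\<lambda>_. lborel)) =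
     ennreal (c ^ m) * (\<integral>\<^sup>+x. F (S m x) \<partial>PiM {..<N} (\<lambda>_. lborel))" for m
  proof (induction m)
    case 0
    show ?case
      by (auto simp: S_def intro!: nn_integral_cong arg_cong[of _ _ F] simp: extensional_def restrict_def)
  next
    case (Suc m)
    have "(\<integral>\<^sup>+x. F (S m x) \<partial>PiM {..<N} (\<lambda>_. lborel)) =
       ennreal \<bar>c\<bar> * (\<integral>\<^sup>+x. F (S m (x(m := 0 + c * x m))) \<partial>PiM {..<N} (\<lambda>_. lborel))"
      using Suc.prems c
      by (intro nn_integral_PiM_lborel_coord[where b = "\<lambda>_. 0"]) auto
    also have "(\<lambda>x. S m (x(m := 0 + c * x m))) = S (Suc m)"
      by (auto simp: S_def fun_eq_iff restrict_def less_Suc_eq)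
    finally show ?case using Suc c by (simp add: ennreal_mult mult_ac)
  qed
  from this[of N] show ?thesis by (simp add: S_def cong: restrict_cong)
qed

text \<open>The flow of the field L_ij. For i = j the second update would overwrite the first, so
  the group law is only claimed for i \<noteq> j.\<close>

definition plane_rot :: "nat \<Rightarrow> nat \<Rightarrow> real \<Rightarrow> (nat \<Rightarrow> real) \<Rightarrow> nat \<Rightarrow> real" where
  "plane_rot i j t x = x(i := cos t * x i - sin t * x j, j := sin t * x i + cos t * x j)"

lemma plane_rot_0 [simp]: "plane_rot i j 0 x = x"
  by (simp add: plane_rot_def)

lemma plane_rot_add:
  "i \<noteq> j \<Longrightarrow> plane_rot i j s (plane_rot i j t x) = plane_rot i j (s + t) x"
  by (auto simp: plane_rot_def fun_eq_iff sin_add cos_add algebra_simps)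

lemma plane_rot_eval:
  assumes "i \<noteq> j"
  shows "plane_rot i j t x i = cos t * x i - sin t * x j"
    "plane_rot i j t x j = sin t * x i + cos t * x j"
    "k \<noteq> i \<Longrightarrow> k \<noteq> j \<Longrightarrow> plane_rot i j t x k = x k"
  using assms by (auto simp: plane_rot_def)

lemma plane_rot_extensional:
  "i < N \<Longrightarrow> j < N \<Longrightarrow> x \<in> extensional {..<N} \<Longrightarrow> plane_rot i j t x \<in> extensional {..<N}"
  by (auto simp: plane_rot_def extensional_def)

lemma measurable_plane_rot [measurable]:
  assumes "i < N" "j < N"
  shows "plane_rot i j t \<in> measurable (Rn N) (Rn N)"
proof (rule measurable_to_Rn)
  show "(\<lambda>x. plane_rot i j t x k) \<in> borel_measurable (Rn N)" if "k < N" for k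
    using assms that by (cases "k = j"; cases "k = i") (auto simp: plane_rot_def)
qed (use assms in \<open>auto simp: plane_rot_extensional\<close>)

lemma sum_split_two:
  fixes g :: "nat \<Rightarrow> 'a::comm_monoid_add"
  assumes "i < N" "j < N" "i \<noteq> j"
  shows "(\<Sum>k<N. g k) = g i + (g j + (\<Sum>k\<in>{..<N}-{i}-{j}. g k))"
  using assms by (subst sum.remove[of _ i]; simp) (subst sum.remove[of _ j]; simp)

lemma sum_sq_plane_rot:
  assumes "i < N" "j < N" "i \<noteq> j"
  shows "(\<Sum>k<N. (plane_rot i j t x k)\<^sup>2) = (\<Sum>k<N. (x k)\<^sup>2)"
proof -
  have "(cos t * x i - sin t * x j)\<^sup>2 + (sin t * x i + cos t * x j)\<^sup>2 =
    ((sin t)\<^sup>2 + (cos t)\<^sup>2) * ((x i)\<^sup>2 + (x j)\<^sup>2)"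
    by (simp only: power2_eq_square) algebra
  moreover have "(\<Sum>k\<in>{..<N}-{i}-{j}. (plane_rot i j t x k)\<^sup>2) = (\<Sum>k\<in>{..<N}-{i}-{j}. (x k)\<^sup>2)"
    using assms by (intro sum.cong) (auto simp: plane_rot_eval)
  ultimately show ?thesis
    using assms by (simp add: sum_split_two[OF assms] plane_rot_eval add.assoc[symmetric])
qed

lemma L2_set_plane_rot:
  "i < N \<Longrightarrow> j < N \<Longrightarrow> i \<noteq> j \<Longrightarrow> L2_set (plane_rot i j t x) {..<N} = L2_set x {..<N}"
  by (simp add: L2_set_def sum_sq_plane_rot)

lemma plane_rot_kac_sphere:
  "i < N \<Longrightarrow> j < N \<Longrightarrow> i \<noteq> j \<Longrightarrow> x \<in> kac_sphere N \<Longrightarrow> plane_rot i j t x \<in> kac_sphere N"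
  by (simp add: kac_sphere_def plane_rot_extensional sum_sq_plane_rot)

lemma to_sphere_plane_rot:
  "i < N \<Longrightarrow> j < N \<Longrightarrow> i \<noteq> j \<Longrightarrow> to_sphere N (plane_rot i j t x) = plane_rot i j t (to_sphere N x)"
  unfolding to_sphere_def L2_set_plane_rot by (auto simp: fun_eq_iff plane_rot_def field_simps add_divide_distrib diff_divide_distrib)

text \<open>A rotation is a product of three shears.\<close>
lemma nn_integral_PiM_lborel_rot:
  assumes ij: "i < N" "j < N" "i \<noteq> j" and t: "cos (t / 2) \<noteq> 0"
    and F [measurable]: "F \<in> borel_measurable (Rn N)"
  shows "(\<integral>\<^sup>+x. F (plane_rot i j t x) \<partial>PiM {..<N} (\<lambda>_. lborel)) = (\<integral>\<^sup>+x. F x \<partial>PiM {..<N} (\<lambda>_. lborel))"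
proof -
  \<comment> \<open>The shear factors are \<open>- tan (t / 2)\<close>, \<open>sin t\<close>,
    \<open>- tan (t / 2)\<close>. The assumption on \<open>cos (t / 2)\<close> keeps the tangent
    finite; it holds for all small angles, and differentiation at 0 requires no others.\<close>
  define T where "T = tan (t / 2)"
  define A where "A x = x(i := - T * x j + 1 * x i)" for x :: "nat \<Rightarrow> real"
  define B where "B x = x(j := sin t * x i + 1 * x j)" for x :: "nat \<Rightarrow> real"
  have A [measurable]: "A \<in> measurable (Rn N) (Rn N)"
  proof (rule measurable_to_Rn)
    show "(\<lambda>x. A x k) \<in> borel_measurable (Rn N)" if "k < N" for k
      using ij that by (cases "k = i") (auto simp: A_def)
  qed (use ij in \<open>auto simp: A_def extensional_def\<close>)
  have B [measurable]: "B \<in> measurable (Rn N) (Rn N)"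
  proof (rule measurable_to_Rn)
    show "(\<lambda>x. B x k) \<in> borel_measurable (Rn N)" if "k < N" for k
      using ij that by (cases "k = j") (auto simp: B_def)
  qed (use ij in \<open>auto simp: B_def extensional_def\<close>)
  have iA: "(\<integral>\<^sup>+x. G (A x) \<partial>PiM {..<N} (\<lambda>_. lborel)) = (\<integral>\<^sup>+x. G x \<partial>PiM {..<N} (\<lambda>_. lborel))"
    if [measurable]: "G \<in> borel_measurable (Rn N)" for G :: "(nat \<Rightarrow> real) \<Rightarrow> ennreal"
    using nn_integral_PiM_lborel_coord[of i N 1 G "\<lambda>x. - T * x j"] ij by (simp add: A_def)
  have iB: "(\<integral>\<^sup>+x. G (B x) \<partial>PiM {..<N} (\<lambda>_. lborel)) = (\<integral>\<^sup>+x. G x \<partial>PiM {..<N} (\<lambda>_. lborel))"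
    if [measurable]: "G \<in> borel_measurable (Rn N)" for G :: "(nat \<Rightarrow> real) \<Rightarrow> ennreal"
    using nn_integral_PiM_lborel_coord[of j N 1 G "\<lambda>x. sin t * x i"] ij by (simp add: B_def)
  have s: "sin t * T = 1 - cos t"
  proof -
    have "sin t = 2 * sin (t/2) * cos (t/2)" using sin_double[of "t/2"] by simp
    moreover have "cos t = 1 - 2 * (sin (t/2))\<^sup>2" using cos_double_sin[of "t/2"] by simp
    ultimately show ?thesis using t by (simp add: T_def tan_def power2_eq_square)
  qed
  have c: "T * (1 + cos t) = sin t"
  proof -
    have "sin t = 2 * sin (t/2) * cos (t/2)" using sin_double[of "t/2"] by simp
    moreover have "cos t = 2 * (cos (t/2))\<^sup>2 - 1" using cos_double_cos[of "t/2"] by simp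
    ultimately show ?thesis using t by (simp add: T_def tan_def power2_eq_square)
  qed
  have rot: "plane_rot i j t x = A (B (A x))" for x
  proof -
    have 1: "sin t * x i + cos t * x j = sin t * (- T * x j + x i) + x j"
      using s by algebra
    have 2: "cos t * x i - sin t * x j = - T * (sin t * x i + cos t * x j) + (- T * x j + x i)"
    proof -
      have "- T * (sin t * x i + cos t * x j) + (- T * x j + x i) =
        x i * (1 - sin t * T) - (T * (1 + cos t)) * x j" by (simp add: algebra_simps)
      then show ?thesis by (simp add: s c)
    qed
    show ?thesis
      using ij 1 2 by (auto simp: plane_rot_def A_def B_def fun_eq_iff)
  qed
  show ?thesis
    unfolding rot using iA[of "\<lambda>x. F (A (B x))"] iB[of "\<lambda>x. F (A x)"] iA[of F] by simp
qed

section \<open>The uniform measure on Kac's sphere\<close>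

abbreviation unit_ball :: "nat \<Rightarrow> (nat \<Rightarrow> real) set" where
  "unit_ball N \<equiv> {x \<in> extensional {..<N}. L2_set x {..<N} \<le> 1}"

lemma sets_unit_ball [measurable]: "unit_ball N \<in> sets (Rn N)"
proof -
  have "unit_ball N = {x \<in> space (Rn N). L2_set x {..<N} \<le> 1}" by auto
  also have "\<dots> \<in> sets (Rn N)" by measurable
  finally show ?thesis .
qed

lemma emeasure_unit_ball:
  "emeasure (PiM {..<N} (\<lambda>_. lborel)) (unit_ball N) = ennreal (unit_ball_vol (real N))"
proof -
  have "unit_ball N = {f. sqrt (\<Sum>i<N. (f i)\<^sup>2) \<le> 1} \<inter> space (PiM {..<N} (\<lambda>_. lborel :: real measure))"
    by (auto simp: L2_set_def)
  then show ?thesis using emeasure_cball_aux[of "{..<N}" 1] by simp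
qed

lemma sets_uniform_sphere [simp, measurable_cong]: "sets (uniform_sphere N) = sets (Rn N)"
  by (simp add: uniform_sphere_def)

lemma space_uniform_sphere [simp]: "space (uniform_sphere N) = extensional {..<N}"
  by (simp add: uniform_sphere_def)

lemma nn_integral_uniform_sphere:
  assumes [measurable]: "F \<in> borel_measurable (Rn N)"
  shows "(\<integral>\<^sup>+y. F y \<partial>uniform_sphere N) =
    (\<integral>\<^sup>+x. F (to_sphere N x) * indicator (unit_ball N) x \<partial>PiM {..<N} (\<lambda>_. lborel)) / ennreal (unit_ball_vol (real N))"
proof -
  have "unit_ball N \<in> sets (PiM {..<N} (\<lambda>_. lborel))"
    unfolding sets_PiM_lborel_Rn by (rule sets_unit_ball)
  then show ?thesis
    unfolding uniform_sphere_def
    by (subst nn_integral_distr; simp) (subst nn_integral_uniform_measure; simp add: emeasure_unit_ball)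
qed

lemma prob_space_uniform_sphere: "prob_space (uniform_sphere N)"
proof
  have "emeasure (uniform_sphere N) (space (uniform_sphere N)) = (\<integral>\<^sup>+y. 1 \<partial>uniform_sphere N)"
    by (simp del: space_uniform_sphere)
  also have "\<dots> = (\<integral>\<^sup>+x. indicator (unit_ball N) x \<partial>PiM {..<N} (\<lambda>_. lborel)) / ennreal (unit_ball_vol (real N))"
    by (subst nn_integral_uniform_sphere) auto
  also have "(\<integral>\<^sup>+x. indicator (unit_ball N) x \<partial>PiM {..<N} (\<lambda>_. lborel)) = ennreal (unit_ball_vol (real N))"
    by (subst nn_integral_indicator) (simp_all add: sets_PiM_lborel_Rn sets_unit_ball emeasure_unit_ball)
  finally show "emeasure (uniform_sphere N) (space (uniform_sphere N)) = 1"
    using unit_ball_vol_pos[of "real N"] by (simp add: divide_ennreal del: unit_ball_vol_pos)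
qed

text \<open>Radial projection commutes with rotations and the unit ball is invariant, so the
  invariance descends from Lebesgue measure on the ball.\<close>

lemma nn_integral_uniform_sphere_rot:
  assumes ij: "i < N" "j < N" "i \<noteq> j" and t: "cos (t / 2) \<noteq> 0"
    and F [measurable]: "F \<in> borel_measurable (Rn N)"
  shows "(\<integral>\<^sup>+y. F (plane_rot i j t y) \<partial>uniform_sphere N) = (\<integral>\<^sup>+y. F y \<partial>uniform_sphere N)"
proof -
  note [measurable] = measurable_plane_rot[OF ij(1,2)]
  have "(\<integral>\<^sup>+x. F (plane_rot i j t (to_sphere N x)) * indicator (unit_ball N) x \<partial>PiM {..<N} (\<lambda>_. lborel)) =
     (\<integral>\<^sup>+x. F (to_sphere N (plane_rot i j t x)) * indicator (unit_ball N) (plane_rot i j t x) \<partial>PiM {..<N} (\<lambda>_. lborel))"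
    using ij by (intro nn_integral_cong)
      (auto simp: to_sphere_plane_rot L2_set_plane_rot plane_rot_extensional indicator_def)
  also have "\<dots> = (\<integral>\<^sup>+x. F (to_sphere N x) * indicator (unit_ball N) x \<partial>PiM {..<N} (\<lambda>_. lborel))"
    using ij t by (intro nn_integral_PiM_lborel_rot[of i N j t "\<lambda>x. F (to_sphere N x) * indicator (unit_ball N) x"]) auto
  finally show ?thesis
    by (simp add: nn_integral_uniform_sphere)
qed

lemma distr_uniform_sphere_rot:
  assumes ij: "i < N" "j < N" "i \<noteq> j" and t: "cos (t / 2) \<noteq> 0"
  shows "distr (uniform_sphere N) (Rn N) (plane_rot i j t) = uniform_sphere N"
proof (rule measure_eqI)
  fix A assume "A \<in> sets (distr (uniform_sphere N) (Rn N) (plane_rot i j t))"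
  then have [measurable]: "A \<in> sets (Rn N)" by simp
  have "emeasure (distr (uniform_sphere N) (Rn N) (plane_rot i j t)) A =
      (\<integral>\<^sup>+y. indicator A y \<partial>distr (uniform_sphere N) (Rn N) (plane_rot i j t))"
    by simp
  also have "\<dots> = (\<integral>\<^sup>+y. indicator A (plane_rot i j t y) \<partial>uniform_sphere N)"
    using ij by (subst nn_integral_distr) auto
  also have "\<dots> = (\<integral>\<^sup>+y. indicator A y \<partial>uniform_sphere N)"
    using ij t by (intro nn_integral_uniform_sphere_rot) auto
  finally show "emeasure (distr (uniform_sphere N) (Rn N) (plane_rot i j t)) A = emeasure (uniform_sphere N) A"
    by simp
qed simp

lemma AE_PiM_lborel_L2_set:
  fixes N :: nat
  assumes N: "N \<ge> 1"
  shows "AE x in PiM {..<N} (\<lambda>_. lborel). L2_set x {..<N} \<noteq> 0"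
proof -
  interpret product_sigma_finite "\<lambda>_::nat. lborel :: real measure" by standard
  have "{x \<in> space (PiM {..<N} (\<lambda>_. lborel)). \<not> L2_set x {..<N} \<noteq> 0} = PiE {..<N} (\<lambda>_. {0::real})"
    unfolding L2_set_eq_0_iff[OF finite_lessThan] by (auto simp: PiE_def extensional_def fun_eq_iff)
  moreover have "emeasure (PiM {..<N} (\<lambda>_. lborel)) (PiE {..<N} (\<lambda>_. {0::real})) = (\<Prod>i<N. emeasure lborel {0::real})"
    using emeasure_PiM[of "{..<N}" "\<lambda>_. {0::real}"] by simp
  moreover have "\<dots> = 0" using N by simp
  moreover have "PiE {..<N} (\<lambda>_. {0::real}) \<in> sets (PiM {..<N} (\<lambda>_. lborel))"
    by (intro sets_PiM_I_finite) auto
  ultimately show ?thesis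
    by (intro AE_I[of _ _ "PiE {..<N} (\<lambda>_. {0::real})"]) auto
qed

text \<open>Projection misses the sphere only at the origin, which is a null set for N \<ge>
  1.\<close>

lemma AE_uniform_sphere_kac_sphere:
  assumes "N \<ge> 1"
  shows "AE y in uniform_sphere N. y \<in> kac_sphere N"
proof -
  have "unit_ball N \<in> sets (PiM {..<N} (\<lambda>_. lborel))"
    unfolding sets_PiM_lborel_Rn by (rule sets_unit_ball)
  then have "AE x in uniform_measure (PiM {..<N} (\<lambda>_. lborel)) (unit_ball N). to_sphere N x \<in> kac_sphere N"
    using AE_PiM_lborel_L2_set[OF assms]
    by (intro AE_uniform_measureI) (auto elim!: eventually_mono intro: to_sphere_in_kac_sphere)
  then show ?thesis
    unfolding uniform_sphere_def using sets_kac_sphere[of N]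
    by (subst AE_distr_iff) (auto simp: kac_sphere_def conj_commute)
qed

subsection \<open>Polar coordinates\<close>

lemma nn_integral_lborel_pos_scale:
  fixes c :: real
  assumes c: "c > 0" and [measurable]: "q \<in> borel_measurable borel"
  shows "(\<integral>\<^sup>+s. indicator {0<..} s * q s \<partial>lborel) =
    ennreal c * (\<integral>\<^sup>+s. indicator {0<..} s * q (c * s) \<partial>lborel)"
proof -
  have "(\<integral>\<^sup>+s. indicator {0<..} s * q s \<partial>lborel) =
    ennreal \<bar>c\<bar> * (\<integral>\<^sup>+s. indicator {0<..} (0 + c * s) * q (0 + c * s) \<partial>lborel)"
    using c by (intro nn_integral_real_affine) auto
  also have "(\<lambda>s. indicator {0<..} (0 + c * s) * q (0 + c * s)) = (\<lambda>s. indicator {0<..} s * q (c * s))"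
    using c by (auto simp: fun_eq_iff indicator_def zero_less_mult_iff)
  finally show ?thesis using c by simp
qed

text \<open>This improper integral removes the auxiliary variable t at the end of the polar formula,
  where \<open>1 / a ^ N\<close> cancels a power of the radius.\<close>

lemma nn_integral_inverse_power:
  assumes a: "a > 0" and N: "N \<ge> 1"
  shows "(\<integral>\<^sup>+s. ennreal (real N / s ^ Suc N) * indicator {a..} s \<partial>lborel) = ennreal (1 / a ^ N)"
proof -
  have "(\<integral>\<^sup>+s. ennreal (real N / s ^ Suc N) * indicator {a..} s \<partial>lborel) = ennreal (0 - (- (1 / a ^ N)))"
  proof (rule nn_integral_FTC_atLeast)
    fix x assume "a \<le> x"
    then have x: "x > 0" using a by simp
    have Nsuc: "N = Suc (N - 1)" using N by simp
    have "((\<lambda>s. - inverse (s ^ N)) has_real_derivative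
        - (- (inverse (x ^ N) * (real N * x ^ (N - 1)) * inverse (x ^ N)))) (at x)"
      using x by (intro DERIV_minus DERIV_inverse' DERIV_pow) auto
    moreover have "- (- (inverse (x ^ N) * (real N * x ^ (N - 1)) * inverse (x ^ N))) = real N / x ^ Suc N"
      using x by (subst (2 4) Nsuc) (simp add: field_simps del: of_nat_Suc)
    ultimately show "((\<lambda>s. - (1 / s ^ N)) has_real_derivative real N / x ^ Suc N) (at x)"
      by (simp add: inverse_eq_divide)
    show "0 \<le> real N / x ^ Suc N" using x by simp
  next
    show "((\<lambda>s::real. - (1 / s ^ N)) \<longlongrightarrow> 0) at_top"
    proof -
      have "((\<lambda>s::real. inverse (s ^ N)) \<longlongrightarrow> 0) at_top"
        using N by (intro tendsto_inverse_0_at_top filterlim_pow_at_top filterlim_ident) auto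
      from tendsto_minus[OF this] show ?thesis by (simp add: inverse_eq_divide)
    qed
  qed measurable
  then show ?thesis by simp
qed

lemma measurable_scale_pair [measurable]:
  "(\<lambda>p. \<lambda>i\<in>{..<N}. snd p * fst p i) \<in> measurable (Rn N \<Otimes>\<^sub>M borel) (Rn N)"
  by (intro measurable_restrict_Rn) measurable

lemma measurable_scale_snd [measurable]:
  "(\<lambda>t. \<lambda>i\<in>{..<N}. t * x i) \<in> measurable borel (Rn N)"
  by (intro measurable_restrict_Rn) measurable

lemma L2_set_scale: "t \<ge> 0 \<Longrightarrow> L2_set (\<lambda>i\<in>{..<N}. t * x i) {..<N} = t * L2_set x {..<N}"
  by (subst L2_set_cong[OF refl, of _ _ "\<lambda>i. t * x i"])
     (auto simp: L2_set_right_distrib[symmetric])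

lemma borel_measurable_scale_pair:
  fixes G :: "(nat \<Rightarrow> real) \<Rightarrow> 'b::topological_space"
  assumes "G \<in> borel_measurable (Rn N)"
  shows "(\<lambda>p. G (\<lambda>i\<in>{..<N}. snd p * fst p i)) \<in> borel_measurable (Rn N \<Otimes>\<^sub>M borel)"
  by (rule measurable_compose[OF measurable_scale_pair assms])

text \<open>After the substitution \<open>s = t \<bar>x\<bar> / sqrt N\<close> and the scaling
  \<open>x \<mapsto> x / t\<close> the unit ball turns into the region \<open>\<bar>x\<bar> \<le> t\<close>, and \<open>t\<close> is integrated out.\<close>
lemma nn_integral_PiM_lborel_polar:
  assumes N: "N \<ge> 1" and G [measurable]: "G \<in> borel_measurable (Rn N)"
  shows "(\<integral>\<^sup>+x. G x \<partial>PiM {..<N} (\<lambda>_. lborel)) =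
    ennreal (unit_ball_vol (real N) * real N * sqrt (real N) ^ N) *
    (\<integral>\<^sup>+y. \<integral>\<^sup>+s. indicator {0<..} s * (ennreal (s ^ (N - 1)) * G (\<lambda>i\<in>{..<N}. s * y i)) \<partial>lborel \<partial>uniform_sphere N)"
proof -
  let ?L = "PiM {..<N} (\<lambda>_. lborel :: real measure)"
  interpret P: product_sigma_finite "\<lambda>_::nat. lborel :: real measure" by standard
  interpret L: sigma_finite_measure ?L
    by (rule P.sigma_finite) simp
  interpret pair_sigma_finite ?L "lborel :: real measure" ..
  define r where "r x = L2_set x {..<N}" for x
  have [measurable]: "r \<in> borel_measurable (Rn N)" unfolding r_def by measurable
  have r0: "r x \<ge> 0" for x by (simp add: r_def L2_set_nonneg)
  define Q where "Q y = (\<integral>\<^sup>+s. indicator {0<..} s * (ennreal (s ^ (N - 1)) * G (\<lambda>i\<in>{..<N}. s * y i)) \<partial>lborel)" for y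
  note G2 [measurable] = borel_measurable_scale_pair[OF G]
  have Q [measurable]: "Q \<in> borel_measurable (Rn N)"
    unfolding Q_def
    by (rule lborel.borel_measurable_nn_integral) (auto simp: case_prod_beta' intro!: borel_measurable_times G2 borel_measurable_indicator borel_measurable_indicator' simp: measurable_cong_sets[OF sets_pair_measure_cong[OF refl sets_lborel] refl])
  have GL [measurable]: "G \<in> borel_measurable ?L" and rL [measurable]: "r \<in> borel_measurable ?L"
    by measurable
  have ind [measurable]: "(\<lambda>x. indicator {..snd x} (r (fst x)) :: ennreal) \<in> borel_measurable (?L \<Otimes>\<^sub>M lborel)"
    unfolding indicator_def of_bool_def atMost_iff by measurable
  \<comment> \<open>With s = t |x| / sqrt N one has s^(N-1) ds = (|x| / sqrt N)^N t^(N-1) dt. The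
    factor \<open>sqrt (real N) ^ N\<close> cancels the denominator, and \<open>real N\<close>
    normalizes the tail integral of t^(-N-1) that comes last.\<close>
  define c where "c = real N * sqrt (real N) ^ N"
  have c0: "c \<ge> 0" by (simp add: c_def)
  have Nsuc: "N = Suc (N - 1)" using N by simp
  have Qx: "ennreal c * Q (to_sphere N x) = (\<integral>\<^sup>+t. indicator {0<..} t *
      (ennreal (real N * t ^ (N - 1) * r x ^ N) * G (\<lambda>i\<in>{..<N}. t * x i)) \<partial>lborel)"
    if "r x \<noteq> 0" for x
  proof -
    have rx: "r x > 0" using r0[of x] that by simp
    define d where "d = r x / sqrt (real N)"
    have d: "d > 0" using rx N by (simp add: d_def)
    have dt: "(\<lambda>i\<in>{..<N}. (d * t) * to_sphere N x i) = (\<lambda>i\<in>{..<N}. t * x i)" for t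
      using rx N by (auto simp: fun_eq_iff to_sphere_def d_def r_def[symmetric])
    have cd: "c * d ^ N = real N * r x ^ N"
      using N by (simp add: c_def d_def power_divide)
    have "Q (to_sphere N x) = ennreal d * (\<integral>\<^sup>+t. indicator {0<..} t *
        (ennreal ((d * t) ^ (N - 1)) * G (\<lambda>i\<in>{..<N}. (d * t) * to_sphere N x i)) \<partial>lborel)"
      unfolding Q_def using d by (intro nn_integral_lborel_pos_scale) measurable
    then have "ennreal c * Q (to_sphere N x) = (\<integral>\<^sup>+t. ennreal (c * d) * (indicator {0<..} t *
        (ennreal ((d * t) ^ (N - 1)) * G (\<lambda>i\<in>{..<N}. t * x i))) \<partial>lborel)"
      unfolding dt using c0 d by (subst nn_integral_cmult) (auto simp: ennreal_mult mult.assoc)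
    also have "\<dots> = (\<integral>\<^sup>+t. indicator {0<..} t *
      (ennreal (real N * t ^ (N - 1) * r x ^ N) * G (\<lambda>i\<in>{..<N}. t * x i)) \<partial>lborel)"
    proof (rule nn_integral_cong)
      fix t :: real
      have "c * d * (d * t) ^ (N - 1) = (c * d ^ N) * t ^ (N - 1)"
        by (subst (2) Nsuc) (simp add: power_mult_distrib)
      also have "\<dots> = real N * t ^ (N - 1) * r x ^ N"
        by (simp add: cd)
      finally have "ennreal (c * d) * ennreal ((d * t) ^ (N - 1)) = ennreal (real N * t ^ (N - 1) * r x ^ N)" if "t > 0"
        using that c0 d by (simp add: ennreal_mult[symmetric])
      then show "ennreal (c * d) * (indicator {0<..} t * (ennreal ((d * t) ^ (N - 1)) * G (\<lambda>i\<in>{..<N}. t * x i))) =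
        indicator {0<..} t * (ennreal (real N * t ^ (N - 1) * r x ^ N) * G (\<lambda>i\<in>{..<N}. t * x i))"
        by (cases "t > 0") (auto simp: mult.assoc[symmetric])
    qed
    finally show ?thesis .
  qed
  define V where "V = ennreal (unit_ball_vol (real N))"
  have V: "V \<noteq> 0" "V \<noteq> \<top>"
    using unit_ball_vol_pos[of "real N"] by (auto simp: V_def simp del: unit_ball_vol_pos)
  have "V * (ennreal c * (\<integral>\<^sup>+y. Q y \<partial>uniform_sphere N)) =
      (\<integral>\<^sup>+x. ennreal c * (Q (to_sphere N x) * indicator (unit_ball N) x) \<partial>?L)"
    using V by (subst nn_integral_uniform_sphere) (auto simp: V_def[symmetric] nn_integral_cmult
       ennreal_times_divide ennreal_mult_divide_eq mult.commute[of V])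
  also have "\<dots> = (\<integral>\<^sup>+x. \<integral>\<^sup>+t. indicator {0<..} t *
      (ennreal (real N * t ^ (N - 1) * r x ^ N) * indicator (unit_ball N) x * G (\<lambda>i\<in>{..<N}. t * x i)) \<partial>lborel \<partial>?L)"
    using AE_PiM_lborel_L2_set[OF N] unfolding r_def[symmetric]
    by (intro nn_integral_cong_AE, elim eventually_mono, subst mult.assoc[symmetric], subst Qx)
       (auto simp: indicator_def)
  \<comment> \<open>Scaling acts on x at fixed t, so t becomes the outer variable; the order is
    restored once the scaling is done.\<close>
  also have "\<dots> = (\<integral>\<^sup>+t. \<integral>\<^sup>+x. indicator {0<..} t *
      (ennreal (real N * t ^ (N - 1) * r x ^ N) * indicator (unit_ball N) x * G (\<lambda>i\<in>{..<N}. t * x i)) \<partial>?L \<partial>lborel)"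
    by (rule Fubini'[symmetric], unfold case_prod_beta') measurable
  also have "\<dots> = (\<integral>\<^sup>+t. \<integral>\<^sup>+x. indicator {0<..} t *
      (ennreal (real N / t ^ Suc N * r x ^ N) * indicator {..t} (r x) * G x) \<partial>?L \<partial>lborel)"
  proof (rule nn_integral_cong)
    fix t :: real
    have [measurable]: "(\<lambda>x. indicator {..t} (r x) :: ennreal) \<in> borel_measurable (Rn N)"
      by (rule measurable_compose[OF _ borel_measurable_indicator]) measurable
    show "(\<integral>\<^sup>+x. indicator {0<..} t *
      (ennreal (real N * t ^ (N - 1) * r x ^ N) * indicator (unit_ball N) x * G (\<lambda>i\<in>{..<N}. t * x i)) \<partial>?L) =
      (\<integral>\<^sup>+x. indicator {0<..} t *
      (ennreal (real N / t ^ Suc N * r x ^ N) * indicator {..t} (r x) * G x) \<partial>?L)"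
    proof (cases "t > 0")
      case True
      have "(\<integral>\<^sup>+x. indicator {0<..} t * (ennreal (real N / t ^ Suc N * r x ^ N) * indicator {..t} (r x) * G x) \<partial>?L) =
        ennreal (t ^ N) * (\<integral>\<^sup>+x. indicator {0<..} t * (ennreal (real N / t ^ Suc N * r (\<lambda>k\<in>{..<N}. t * x k) ^ N) *
          indicator {..t} (r (\<lambda>k\<in>{..<N}. t * x k)) * G (\<lambda>k\<in>{..<N}. t * x k)) \<partial>?L)"
        using True by (intro nn_integral_PiM_lborel_scale) measurable
      also have "\<dots> = (\<integral>\<^sup>+x. ennreal (t ^ N) * (indicator {0<..} t * (ennreal (real N / t ^ Suc N * r (\<lambda>k\<in>{..<N}. t * x k) ^ N) *
          indicator {..t} (r (\<lambda>k\<in>{..<N}. t * x k)) * G (\<lambda>k\<in>{..<N}. t * x k))) \<partial>?L)"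
        by (intro nn_integral_cmult[symmetric]) measurable
      also have "\<dots> = (\<integral>\<^sup>+x. indicator {0<..} t *
      (ennreal (real N * t ^ (N - 1) * r x ^ N) * indicator (unit_ball N) x * G (\<lambda>i\<in>{..<N}. t * x i)) \<partial>?L)"
      proof (rule nn_integral_cong)
        fix x assume "x \<in> space ?L"
        then have x: "x \<in> extensional {..<N}" by simp
        have rs: "r (\<lambda>k\<in>{..<N}. t * x k) = t * r x"
          using True unfolding r_def by (intro L2_set_scale) simp
        have "t ^ N * (real N / t ^ Suc N * (t * r x) ^ N) = real N * t ^ (N - 1) * r x ^ N"
          using True by (subst (2 5) Nsuc) (simp add: power_mult_distrib field_simps del: of_nat_Suc)
        then have "ennreal (t ^ N) * ennreal (real N / t ^ Suc N * (t * r x) ^ N) =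
            ennreal (real N * t ^ (N - 1) * r x ^ N)"
          using True r0[of x] by (simp add: ennreal_mult[symmetric])
        moreover have "indicator {..t} (t * r x) = (indicator (unit_ball N) x :: ennreal)"
          using True x by (auto simp: indicator_def r_def)
        ultimately show "ennreal (t ^ N) * (indicator {0<..} t * (ennreal (real N / t ^ Suc N * r (\<lambda>k\<in>{..<N}. t * x k) ^ N) *
          indicator {..t} (r (\<lambda>k\<in>{..<N}. t * x k)) * G (\<lambda>k\<in>{..<N}. t * x k))) =
          indicator {0<..} t *
      (ennreal (real N * t ^ (N - 1) * r x ^ N) * indicator (unit_ball N) x * G (\<lambda>i\<in>{..<N}. t * x i))"
          using True unfolding rs by (simp add: mult.assoc[symmetric])
      qed
      finally show ?thesis by simp
    qed simp
  qed
  also have "\<dots> = (\<integral>\<^sup>+x. \<integral>\<^sup>+t. indicator {0<..} t *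
      (ennreal (real N / t ^ Suc N * r x ^ N) * indicator {..t} (r x) * G x) \<partial>lborel \<partial>?L)"
    by (rule Fubini', unfold case_prod_beta') measurable
  also have "\<dots> = (\<integral>\<^sup>+x. G x \<partial>?L)"
  proof (rule nn_integral_cong_AE)
    show "AE x in ?L. (\<integral>\<^sup>+t. indicator {0<..} t *
      (ennreal (real N / t ^ Suc N * r x ^ N) * indicator {..t} (r x) * G x) \<partial>lborel) = G x"
      using AE_PiM_lborel_L2_set[OF N]
    proof eventually_elim
      case (elim x)
      then have rx: "r x > 0" using r0[of x] unfolding r_def less_le by auto
      have "(\<integral>\<^sup>+t. indicator {0<..} t *
      (ennreal (real N / t ^ Suc N * r x ^ N) * indicator {..t} (r x) * G x) \<partial>lborel) =
        (\<integral>\<^sup>+t. (ennreal (real N / t ^ Suc N) * indicator {r x..} t) * (ennreal (r x ^ N) * G x) \<partial>lborel)"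
        using rx by (intro nn_integral_cong) (auto simp: indicator_def ennreal_mult mult_ac divide_simps ennreal_mult'[symmetric])
      also have "\<dots> = ennreal (1 / r x ^ N) * (ennreal (r x ^ N) * G x)"
        using rx N by (subst nn_integral_multc) (auto simp: nn_integral_inverse_power[OF _ N] simp del: power_Suc)
      also have "\<dots> = G x"
        using rx by (simp add: mult.assoc[symmetric] ennreal_mult[symmetric])
      finally show ?case .
    qed
  qed
  finally show ?thesis
    using c0 by (simp add: Q_def c_def V_def ennreal_mult mult.assoc)
qed

section \<open>Product densities and the Gaussian in polar form\<close>

lemma PiM_density_const:
  fixes M :: "'a measure" and I :: "'i set"
  assumes M: "sigma_finite_measure M" and Mf: "sigma_finite_measure (density M f)"
    and f [measurable]: "f \<in> borel_measurable M" and I: "finite I"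
  shows "PiM I (\<lambda>_. density M f) = density (PiM I (\<lambda>_. M)) (\<lambda>x. \<Prod>i\<in>I. f (x i))"
proof -
  interpret D: product_sigma_finite "\<lambda>_::'i. density M f" using Mf by (simp add: product_sigma_finite_def)
  interpret P: product_sigma_finite "\<lambda>_::'i. M" using M by (simp add: product_sigma_finite_def)
  have meas [measurable]: "(\<lambda>x. \<Prod>i\<in>I. f (x i)) \<in> borel_measurable (PiM I (\<lambda>_. M))"
    by (intro borel_measurable_prod_ennreal) measurable
  show ?thesis
  proof (rule D.PiM_eqI[symmetric, OF I])
    show "sets (density (PiM I (\<lambda>_. M)) (\<lambda>x. \<Prod>i\<in>I. f (x i))) = sets (PiM I (\<lambda>_. density M f))"
      by (auto intro!: sets_PiM_cong)
    fix A assume A: "\<And>i. i \<in> I \<Longrightarrow> A i \<in> sets (density M f)"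
    then have A': "\<And>i. i \<in> I \<Longrightarrow> A i \<in> sets M" by simp
    have "emeasure (density (PiM I (\<lambda>_. M)) (\<lambda>x. \<Prod>i\<in>I. f (x i))) (PiE I A) =
      (\<integral>\<^sup>+x. (\<Prod>i\<in>I. f (x i)) * indicator (PiE I A) x \<partial>PiM I (\<lambda>_. M))"
      using A' I by (intro emeasure_density) (auto intro!: sets_PiM_I_finite)
    also have "\<dots> = (\<integral>\<^sup>+x. (\<Prod>i\<in>I. f (x i) * indicator (A i) (x i)) \<partial>PiM I (\<lambda>_. M))"
    proof (rule nn_integral_cong)
      fix x assume x: "x \<in> space (PiM I (\<lambda>_. M))"
      show "(\<Prod>i\<in>I. f (x i)) * indicator (PiE I A) x = (\<Prod>i\<in>I. f (x i) * indicator (A i) (x i))"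
      proof (cases "x \<in> PiE I A")
        case False
        then obtain i where "i \<in> I" "x i \<notin> A i" using x by (auto simp: space_PiM PiE_def Pi_def)
        then show ?thesis using False I by (auto simp: prod_zero_iff intro!: bexI[of _ i])
      qed (auto simp: PiE_def Pi_def intro!: prod.cong)
    qed
    also have "\<dots> = (\<Prod>i\<in>I. \<integral>\<^sup>+x. f x * indicator (A i) x \<partial>M)"
      using I A' by (intro P.product_nn_integral_prod) auto
    also have "\<dots> = (\<Prod>i\<in>I. emeasure (density M f) (A i))"
      using A' by (intro prod.cong) (auto simp: emeasure_density)
    finally show "emeasure (density (PiM I (\<lambda>_. M)) (\<lambda>x. \<Prod>i\<in>I. f (x i))) (PiE I A) =
      (\<Prod>i\<in>I. emeasure (density M f) (A i))" .
  qed
qed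

lemma sets_gauss [simp, measurable_cong]: "sets gauss = sets borel"
  by (simp add: gauss_def)

lemma space_gauss [simp]: "space gauss = UNIV"
  by (simp add: gauss_def)

lemma measurable_gauss1 [simp]: "measurable gauss M = measurable borel M"
  by (rule measurable_cong_sets) simp_all

lemma prob_space_gauss: "prob_space gauss"
  unfolding gauss_def by (rule prob_space_normal_density) simp

lemma sets_tensor_power [simp, measurable_cong]:
  assumes "sets \<mu> = sets borel"
  shows "sets (tensor_power \<mu> N) = sets (Rn N)"
  unfolding tensor_power_def Rn_def using assms by (intro sets_PiM_cong) auto

lemma prob_space_tensor_power: "prob_space \<mu> \<Longrightarrow> prob_space (tensor_power \<mu> N)"
  unfolding tensor_power_def by (intro prob_space_PiM)

lemma distr_tensor_power_component:
  assumes "prob_space \<mu>" "i < N"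
  shows "distr (tensor_power \<mu> N) \<mu> (\<lambda>x. x i) = \<mu>"
  unfolding tensor_power_def using assms distr_PiM_component[of "{..<N}" "\<lambda>_. \<mu>" i] by simp

lemma nn_integral_tensor_power_component:
  assumes "prob_space \<mu>" "i < N" and q: "q \<in> borel_measurable \<mu>"
  shows "(\<integral>\<^sup>+x. q (x i) \<partial>tensor_power \<mu> N) = (\<integral>\<^sup>+x. q x \<partial>\<mu>)"
proof -
  have [measurable]: "(\<lambda>x. x i) \<in> measurable (tensor_power \<mu> N) \<mu>"
    unfolding tensor_power_def using assms by (intro measurable_component_singleton) auto
  have "(\<integral>\<^sup>+x. q x \<partial>\<mu>) = (\<integral>\<^sup>+x. q x \<partial>distr (tensor_power \<mu> N) \<mu> (\<lambda>x. x i))"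
    using distr_tensor_power_component[OF assms(1,2)] by simp
  also have "\<dots> = (\<integral>\<^sup>+x. q (x i) \<partial>tensor_power \<mu> N)"
    using q by (intro nn_integral_distr) auto
  finally show ?thesis ..
qed

lemma nn_integral_gauss_sq: "(\<integral>\<^sup>+x. ennreal (x\<^sup>2) \<partial>gauss) = 1"
proof -
  have "has_bochner_integral lborel (\<lambda>x. std_normal_density x * x ^ (2 * 1)) (fact (2 * 1) / (2 ^ 1 * fact 1))"
    by (rule std_normal_moment_even)
  then have *: "has_bochner_integral lborel (\<lambda>x. std_normal_density x * x\<^sup>2) 1"
    by simp
  have "(\<integral>\<^sup>+x. ennreal (x\<^sup>2) \<partial>gauss) = (\<integral>\<^sup>+x. ennreal (std_normal_density x * x\<^sup>2) \<partial>lborel)"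
    unfolding gauss_def by (subst nn_integral_density) (auto simp: ennreal_mult)
  also have "\<dots> = ennreal 1"
    using * by (subst nn_integral_eq_integral) (auto simp: has_bochner_integral_iff)
  finally show ?thesis by simp
qed

lemma tensor_power_gauss:
  "tensor_power gauss N = density (PiM {..<N} (\<lambda>_. lborel))
     (\<lambda>x. ennreal (exp (- (\<Sum>i<N. (x i)\<^sup>2) / 2) / sqrt (2 * pi) ^ N))"
proof -
  interpret G: prob_space gauss by (rule prob_space_gauss)
  have "tensor_power gauss N = density (PiM {..<N} (\<lambda>_. lborel)) (\<lambda>x. \<Prod>i<N. ennreal (std_normal_density (x i)))"
    unfolding tensor_power_def gauss_def
    using G.sigma_finite_measure_axioms by (intro PiM_density_const) (auto simp: gauss_def sigma_finite_lborel)
  also have "(\<lambda>x. \<Prod>i<N. ennreal (std_normal_density (x i))) =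
    (\<lambda>x. ennreal (exp (- (\<Sum>i<N. (x i)\<^sup>2) / 2) / sqrt (2 * pi) ^ N))"
    by (auto simp: fun_eq_iff prod_ennreal std_normal_density_def prod_dividef exp_sum[symmetric]
        sum_negf sum_divide_distrib prod.distrib)
  finally show ?thesis .
qed

text \<open>Under the Gaussian measure, radius and direction are independent; \<open>K\<close> is the law of the
  radius, divided by \<open>sqrt N\<close>.\<close>
lemma gauss_polar:
  assumes N: "N \<ge> 1"
  obtains K :: "real measure" where "prob_space K" "sets K = sets borel" "AE s in K. s > 0"
    "(\<integral>\<^sup>+s. ennreal (s\<^sup>2) \<partial>K) = 1"
    "\<And>G. G \<in> borel_measurable (Rn N) \<Longrightarrow> (\<integral>\<^sup>+x. G x \<partial>tensor_power gauss N) =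
       (\<integral>\<^sup>+y. \<integral>\<^sup>+s. G (\<lambda>i\<in>{..<N}. s * y i) \<partial>K \<partial>uniform_sphere N)"
proof -
  let ?L = "PiM {..<N} (\<lambda>_. lborel :: real measure)"
  interpret U: prob_space "uniform_sphere N" by (rule prob_space_uniform_sphere)
  interpret TG: prob_space "tensor_power gauss N"
    by (rule prob_space_tensor_power[OF prob_space_gauss])
  define c where "c = unit_ball_vol (real N) * real N * sqrt (real N) ^ N"
  have c: "c \<ge> 0" unfolding c_def by simp
  \<comment> \<open>On the sphere |s y|^2 = N s^2, so the Gaussian density at s y depends on s
    alone; \<open>k\<close> is that density times the weight of the polar formula.\<close>
  define k where "k s = indicator {0<..} s * (c * s ^ (N - 1) * (exp (- (real N * s\<^sup>2) / 2) / sqrt (2 * pi) ^ N))" for s :: real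
  define K where "K = density lborel (\<lambda>s. ennreal (k s))"
  have [measurable]: "k \<in> borel_measurable borel" unfolding k_def[abs_def] by measurable
  have setsK [simp, measurable_cong]: "sets K = sets borel" by (simp add: K_def)
  have mK [simp]: "borel_measurable K = (borel_measurable borel :: (real \<Rightarrow> ennreal) set)"
    by (rule measurable_cong_sets) simp_all
  have polar: "(\<integral>\<^sup>+x. G x \<partial>tensor_power gauss N) =
       (\<integral>\<^sup>+y. \<integral>\<^sup>+s. G (\<lambda>i\<in>{..<N}. s * y i) \<partial>K \<partial>uniform_sphere N)"
    if G [measurable]: "G \<in> borel_measurable (Rn N)" for G
  proof -
    define e where "e x = exp (- (\<Sum>i<N. (x i)\<^sup>2) / 2) / sqrt (2 * pi) ^ N" for x :: "nat \<Rightarrow> real"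
    have [measurable]: "e \<in> borel_measurable (Rn N)" unfolding e_def[abs_def] by measurable
    have eG [measurable]: "(\<lambda>x. ennreal (e x) * G x) \<in> borel_measurable (Rn N)" by measurable
    have [measurable]: "(\<lambda>s. G (\<lambda>i\<in>{..<N}. s * y i)) \<in> borel_measurable borel"
      "(\<lambda>s. e (\<lambda>i\<in>{..<N}. s * y i)) \<in> borel_measurable borel" for y
      by (rule measurable_compose[OF measurable_scale_snd], measurable)+
    have meas_s: "(\<lambda>s. indicator {0<..} s * (ennreal (s ^ (N - 1)) *
        (ennreal (e (\<lambda>i\<in>{..<N}. s * y i)) * G (\<lambda>i\<in>{..<N}. s * y i)))) \<in> borel_measurable borel" for y
      by (intro borel_measurable_times_ennreal borel_measurable_indicator measurable_compose[OF _ measurable_ennreal]) measurable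
    have "(\<integral>\<^sup>+x. G x \<partial>tensor_power gauss N) = (\<integral>\<^sup>+x. ennreal (e x) * G x \<partial>?L)"
      unfolding tensor_power_gauss e_def[symmetric] by (subst nn_integral_density) auto
    also have "\<dots> = ennreal c * (\<integral>\<^sup>+y. \<integral>\<^sup>+s. indicator {0<..} s * (ennreal (s ^ (N - 1)) *
        (ennreal (e (\<lambda>i\<in>{..<N}. s * y i)) * G (\<lambda>i\<in>{..<N}. s * y i))) \<partial>lborel \<partial>uniform_sphere N)"
      unfolding c_def by (rule nn_integral_PiM_lborel_polar[OF N eG])
    also have "\<dots> = (\<integral>\<^sup>+y. \<integral>\<^sup>+s. ennreal c * (indicator {0<..} s * (ennreal (s ^ (N - 1)) *
        (ennreal (e (\<lambda>i\<in>{..<N}. s * y i)) * G (\<lambda>i\<in>{..<N}. s * y i)))) \<partial>lborel \<partial>uniform_sphere N)"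
    proof (subst nn_integral_cmult[symmetric])
      note borel_measurable_scale_pair[OF eG, measurable]
      have "(\<lambda>p. indicator {0<..} (snd p) * (ennreal (snd p ^ (N - 1)) *
        (ennreal (e (\<lambda>i\<in>{..<N}. snd p * fst p i)) * G (\<lambda>i\<in>{..<N}. snd p * fst p i))))
        \<in> borel_measurable (uniform_sphere N \<Otimes>\<^sub>M lborel)"
        by measurable
      then show "(\<lambda>y. \<integral>\<^sup>+s. indicator {0<..} s * (ennreal (s ^ (N - 1)) *
        (ennreal (e (\<lambda>i\<in>{..<N}. s * y i)) * G (\<lambda>i\<in>{..<N}. s * y i))) \<partial>lborel) \<in> borel_measurable (uniform_sphere N)"
        by (intro lborel.borel_measurable_nn_integral) (simp add: case_prod_beta')
      show "(\<integral>\<^sup>+y. ennreal c * \<integral>\<^sup>+s. indicator {0<..} s * (ennreal (s ^ (N - 1)) *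
        (ennreal (e (\<lambda>i\<in>{..<N}. s * y i)) * G (\<lambda>i\<in>{..<N}. s * y i))) \<partial>lborel \<partial>uniform_sphere N) =
        (\<integral>\<^sup>+y. \<integral>\<^sup>+s. ennreal c * (indicator {0<..} s * (ennreal (s ^ (N - 1)) *
        (ennreal (e (\<lambda>i\<in>{..<N}. s * y i)) * G (\<lambda>i\<in>{..<N}. s * y i)))) \<partial>lborel \<partial>uniform_sphere N)"
        using meas_s by (intro nn_integral_cong nn_integral_cmult[symmetric]) simp
    qed
    also have "\<dots> = (\<integral>\<^sup>+y. \<integral>\<^sup>+s. ennreal (k s) * G (\<lambda>i\<in>{..<N}. s * y i) \<partial>lborel \<partial>uniform_sphere N)"
      using AE_uniform_sphere_kac_sphere[OF N]
    proof (intro nn_integral_cong_AE, eventually_elim)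
      fix y assume y: "y \<in> kac_sphere N"
      have "(\<Sum>i<N. ((\<lambda>i\<in>{..<N}. s * y i) i)\<^sup>2) = real N * s\<^sup>2" for s
      proof -
        have "(\<Sum>i<N. ((\<lambda>i\<in>{..<N}. s * y i) i)\<^sup>2) = (\<Sum>i<N. s\<^sup>2 * (y i)\<^sup>2)"
          by (intro sum.cong) (auto simp: power_mult_distrib)
        also have "\<dots> = s\<^sup>2 * real N" using y by (simp add: sum_distrib_left[symmetric] kac_sphere_def)
        finally show ?thesis by simp
      qed
      then have "e (\<lambda>i\<in>{..<N}. s * y i) = exp (- (real N * s\<^sup>2) / 2) / sqrt (2 * pi) ^ N" for s
        unfolding e_def by simp
      then show "(\<integral>\<^sup>+s. ennreal c * (indicator {0<..} s * (ennreal (s ^ (N - 1)) *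
        (ennreal (e (\<lambda>i\<in>{..<N}. s * y i)) * G (\<lambda>i\<in>{..<N}. s * y i)))) \<partial>lborel) =
        (\<integral>\<^sup>+s. ennreal (k s) * G (\<lambda>i\<in>{..<N}. s * y i) \<partial>lborel)"
        using c by (intro nn_integral_cong) (auto simp: k_def indicator_def ennreal_mult[symmetric] mult.assoc[symmetric])
    qed
    also have "\<dots> = (\<integral>\<^sup>+y. \<integral>\<^sup>+s. G (\<lambda>i\<in>{..<N}. s * y i) \<partial>K \<partial>uniform_sphere N)"
      unfolding K_def by (intro nn_integral_cong nn_integral_density[symmetric]) simp_all
    finally show ?thesis .
  qed
  \<comment> \<open>The formula itself yields the moments of K: tested with 1 it gives the mass, and
    tested with |x|^2, which equals N s^2 along the ray, it gives the second moment.\<close>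
  have mass: "(\<integral>\<^sup>+s. 1 \<partial>K) = 1"
    using polar[of "\<lambda>_. 1"] TG.emeasure_space_1 U.emeasure_space_1 by simp
  have comp: "(\<integral>\<^sup>+x. ennreal ((x i)\<^sup>2) \<partial>tensor_power gauss N) = 1" if "i < N" for i
  proof -
    have "(\<lambda>x::real. ennreal (x\<^sup>2)) \<in> borel_measurable gauss" by simp
    from nn_integral_tensor_power_component[OF prob_space_gauss that this] show ?thesis
      by (simp add: nn_integral_gauss_sq)
  qed
  have "(\<integral>\<^sup>+x. (\<Sum>i<N. ennreal ((x i)\<^sup>2)) \<partial>tensor_power gauss N) = of_nat N"
    by (subst nn_integral_sum) (auto simp: comp)
  moreover have "(\<integral>\<^sup>+x. (\<Sum>i<N. ennreal ((x i)\<^sup>2)) \<partial>tensor_power gauss N) =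
     (\<integral>\<^sup>+y. \<integral>\<^sup>+s. (\<Sum>i<N. ennreal (((\<lambda>i\<in>{..<N}. s * y i) i)\<^sup>2)) \<partial>K \<partial>uniform_sphere N)"
    by (rule polar) measurable
  moreover have "\<dots> = (\<integral>\<^sup>+y. of_nat N * (\<integral>\<^sup>+s. ennreal (s\<^sup>2) \<partial>K) \<partial>uniform_sphere N)"
    using AE_uniform_sphere_kac_sphere[OF N]
  proof (intro nn_integral_cong_AE, eventually_elim)
    fix y assume y: "y \<in> kac_sphere N"
    have "(\<Sum>i<N. ennreal (((\<lambda>i\<in>{..<N}. s * y i) i)\<^sup>2)) = of_nat N * ennreal (s\<^sup>2)" for s
    proof -
      have "(\<Sum>i<N. ennreal (((\<lambda>i\<in>{..<N}. s * y i) i)\<^sup>2)) = ennreal (\<Sum>i<N. s\<^sup>2 * (y i)\<^sup>2)"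
        by (subst sum_ennreal[symmetric]) (auto simp: power_mult_distrib intro!: sum.cong)
      also have "(\<Sum>i<N. s\<^sup>2 * (y i)\<^sup>2) = real N * s\<^sup>2"
        using y by (simp add: sum_distrib_left[symmetric] kac_sphere_def)
      finally show ?thesis by (simp add: ennreal_mult ennreal_of_nat_eq_real_of_nat)
    qed
    then show "(\<integral>\<^sup>+s. (\<Sum>i<N. ennreal (((\<lambda>i\<in>{..<N}. s * y i) i)\<^sup>2)) \<partial>K) = of_nat N * (\<integral>\<^sup>+s. ennreal (s\<^sup>2) \<partial>K)"
      by (simp add: nn_integral_cmult)
  qed
  moreover have "\<dots> = of_nat N * (\<integral>\<^sup>+s. ennreal (s\<^sup>2) \<partial>K)"
    using U.emeasure_space_1 by simp
  ultimately have "of_nat N * (\<integral>\<^sup>+s. ennreal (s\<^sup>2) \<partial>K) = of_nat N * 1" by simp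
  then have sq: "(\<integral>\<^sup>+s. ennreal (s\<^sup>2) \<partial>K) = 1"
    using N by (subst (asm) ennreal_mult_cancel_left) (auto simp: ennreal_of_nat_eq_real_of_nat)
  show ?thesis
  proof (rule that[OF _ setsK _ sq polar])
    show "prob_space K" using mass by (intro prob_spaceI) simp
    have "AE s in lborel. ennreal (k s) > 0 \<longrightarrow> s > 0"
      by (rule AE_I2) (auto simp: k_def indicator_def split: if_splits)
    then show "AE s in K. s > 0" unfolding K_def by (subst AE_density) auto
  qed auto
qed

subsection \<open>The spherical gradient\<close>

text \<open>Makes functions that are Borel for the function topology measurable on
  \<open>Rn N\<close>. The coordinates beyond N are constantly \<open>undefined\<close> there, hence
  measurable too.\<close>

lemma borel_measurable_id_Rn: "(\<lambda>x. x) \<in> measurable (Rn N) (borel :: (nat \<Rightarrow> real) measure)"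
proof (rule measurable_coordinatewise_then_product)
  fix i
  show "(\<lambda>x. x i) \<in> borel_measurable (Rn N)"
  proof (cases "i < N")
    case False
    then have "(\<lambda>x. x i) \<in> borel_measurable (Rn N) \<longleftrightarrow> (\<lambda>x. undefined :: real) \<in> borel_measurable (Rn N)"
      by (intro measurable_cong) (auto simp: extensional_def)
    then show ?thesis by simp
  qed simp
qed

text \<open>A closed subset of a product of compact sets: intervals for the coordinates below N and
  the singleton of \<open>undefined\<close> beyond, so that Tychonoff applies in the full function
  space.\<close>

lemma compact_kac_sphere: "compact (kac_sphere N)"
proof -
  define S where "S i = (if i < N then {- sqrt (real N) .. sqrt (real N)} else {undefined :: real})" for i
  have "compactin (product_topology (\<lambda>_::nat. euclidean :: real topology) UNIV) (PiE UNIV S)"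
    by (subst compactin_PiE) (auto simp: S_def)
  then have "compact (PiE UNIV S)"
    by (simp add: euclidean_product_topology)
  moreover have "closed {x :: nat \<Rightarrow> real. (\<Sum>i<N. (x i)\<^sup>2) = real N}"
    by (intro closed_Collect_eq continuous_intros continuous_on_product_coordinates)
  moreover have "kac_sphere N = PiE UNIV S \<inter> {x. (\<Sum>i<N. (x i)\<^sup>2) = real N}"
  proof (intro set_eqI iffI)
    fix x assume x: "x \<in> kac_sphere N"
    have "x i \<in> S i" for i
    proof (cases "i < N")
      case True
      then have "(x i)\<^sup>2 \<le> (\<Sum>i<N. (x i)\<^sup>2)" by (intro member_le_sum) auto
      then have "(x i)\<^sup>2 \<le> real N" using x by (simp add: kac_sphere_def)
      then have "\<bar>x i\<bar> \<le> sqrt (real N)" by (rule real_le_rsqrt[OF _, of "\<bar>x i\<bar>", simplified])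
      then show ?thesis using True by (auto simp: S_def)
    qed (use x in \<open>auto simp: S_def kac_sphere_def extensional_def\<close>)
    then show "x \<in> PiE UNIV S \<inter> {x. (\<Sum>i<N. (x i)\<^sup>2) = real N}"
      using x by (auto simp: kac_sphere_def)
  qed (auto simp: kac_sphere_def extensional_def S_def PiE_def Pi_def split: if_splits)
  ultimately show ?thesis by (simp add: compact_Int_closed)
qed

lemma continuous_on_coord [continuous_intros]:
  "continuous_on S (\<lambda>x :: nat \<Rightarrow> real. x i)"
  by (rule continuous_on_subset[OF continuous_on_product_coordinates]) simp

text \<open>A function that is continuous on the sphere is arbitrary elsewhere and may fail to be
  measurable on \<open>Rn N\<close>. This is why an indicator accompanies the integrands on the
  sphere from here on; it changes them only off the sphere.\<close>

lemma borel_measurable_indicator_kac_sphere: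
  fixes H :: "(nat \<Rightarrow> real) \<Rightarrow> real"
  assumes "continuous_on (kac_sphere N) H"
  shows "(\<lambda>y. indicator (kac_sphere N) y * H y) \<in> borel_measurable (Rn N)"
proof -
  have "(\<lambda>y. indicator (kac_sphere N) y *\<^sub>R H y) \<in> borel_measurable borel"
    using assms compact_kac_sphere
    by (intro borel_measurable_continuous_on_indicator) (auto intro: borel_compact)
  then show ?thesis
    using measurable_compose[OF borel_measurable_id_Rn] by simp
qed

text \<open>The polarized form: equal vectors give the squared length of the tangential gradient,
  different ones its pairing with a test field.\<close>

lemma lagrange_identity:
  fixes a b y :: "nat \<Rightarrow> real"
  shows "(\<Sum>i<N. \<Sum>j<N. (y i * a j - y j * a i) * (y i * b j - y j * b i)) =
    2 * ((\<Sum>i<N. (y i)\<^sup>2) * (\<Sum>i<N. a i * b i) - (\<Sum>i<N. y i * a i) * (\<Sum>i<N. y i * b i))"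
proof -
  have 1: "(\<Sum>i<N. \<Sum>j<N. (y i)\<^sup>2 * (a j * b j)) = (\<Sum>i<N. (y i)\<^sup>2) * (\<Sum>i<N. a i * b i)"
    by (simp add: sum_product)
  then have 2: "(\<Sum>i<N. \<Sum>j<N. (y j)\<^sup>2 * (a i * b i)) = (\<Sum>i<N. (y i)\<^sup>2) * (\<Sum>i<N. a i * b i)"
    by (subst sum.swap)
  have 3: "(\<Sum>i<N. \<Sum>j<N. (y i * b i) * (y j * a j)) = (\<Sum>i<N. y i * a i) * (\<Sum>i<N. y i * b i)"
    unfolding sum_product[symmetric] by (rule mult.commute)
  have 4: "(\<Sum>i<N. \<Sum>j<N. (y i * a i) * (y j * b j)) = (\<Sum>i<N. y i * a i) * (\<Sum>i<N. y i * b i)"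
    by (simp add: sum_product)
  have "(\<Sum>i<N. \<Sum>j<N. (y i * a j - y j * a i) * (y i * b j - y j * b i)) =
    (\<Sum>i<N. \<Sum>j<N. (y i)\<^sup>2 * (a j * b j) + (y j)\<^sup>2 * (a i * b i) - (y i * b i) * (y j * a j) - (y i * a i) * (y j * b j))"
    by (intro sum.cong refl) (simp add: power2_eq_square algebra_simps)
  also have "\<dots> = 2 * ((\<Sum>i<N. (y i)\<^sup>2) * (\<Sum>i<N. a i * b i) - (\<Sum>i<N. y i * a i) * (\<Sum>i<N. y i * b i))"
    unfolding sum.distrib sum_subtractf 1 2 3 4 by simp
  finally show ?thesis .
qed

text \<open>The orthogonal projection onto the tangent space at y, because |y|^2 = N on the sphere.
  The body is the expression in \<open>has_sphere_grad\<close>, so that the two unfold to the same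
  term.\<close>

definition tang :: "nat \<Rightarrow> (nat \<Rightarrow> real) \<Rightarrow> (nat \<Rightarrow> real) \<Rightarrow> nat \<Rightarrow> real" where
  "tang N y d = (\<lambda>i\<in>{..<N}. d i - (1 / real N) * (\<Sum>j<N. d j * y j) * y i)"

text \<open>What \<open>tang\<close> removes is a multiple of y, and
  \<open>y i * y j - y j * y i = 0\<close>.\<close>

lemma tang_wedge:
  assumes "i < N" "j < N"
  shows "y i * tang N y d j - y j * tang N y d i = y i * d j - y j * d i"
  using assms by (simp add: tang_def algebra_simps)

lemma tang_orthogonal:
  assumes "y \<in> kac_sphere N"
  shows "(\<Sum>i<N. tang N y d i * y i) = 0"
proof (cases "N = 0")
  case False
  have "(\<Sum>i<N. tang N y d i * y i) = (\<Sum>i<N. d i * y i - (1 / real N) * (\<Sum>j<N. d j * y j) * (y i)\<^sup>2)"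
    by (intro sum.cong) (auto simp: tang_def power2_eq_square algebra_simps)
  also have "\<dots> = (\<Sum>i<N. d i * y i) - (1 / real N) * (\<Sum>j<N. d j * y j) * (\<Sum>i<N. (y i)\<^sup>2)"
    unfolding sum_subtractf sum_distrib_left[symmetric] ..
  also have "\<dots> = 0" using assms False by (simp add: kac_sphere_def)
  finally show ?thesis .
qed simp

text \<open>Rotation derivatives determine the tangential part; this inversion gives uniqueness of
  the spherical gradient.\<close>

lemma tang_eq_wedge_sum:
  assumes y: "y \<in> kac_sphere N" and i: "i < N"
  shows "tang N y d i = (1 / real N) * (\<Sum>j<N. y j * (y j * d i - y i * d j))"
proof -
  have "(\<Sum>j<N. y j * (y j * d i - y i * d j)) = (\<Sum>j<N. (y j)\<^sup>2 * d i - (d j * y j) * y i)"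
    by (intro sum.cong) (auto simp: power2_eq_square algebra_simps)
  also have "\<dots> = (\<Sum>j<N. (y j)\<^sup>2) * d i - (\<Sum>j<N. d j * y j) * y i"
    unfolding sum_subtractf sum_distrib_right ..
  also have "(\<Sum>j<N. (y j)\<^sup>2) = real N" using y by (simp add: kac_sphere_def)
  finally show ?thesis using i by (simp add: tang_def field_simps)
qed

text \<open>Lagrange's identity for the tangential vector itself, whose product with y
  vanishes.\<close>

lemma sum_tang_sq:
  assumes y: "y \<in> kac_sphere N" and N: "N \<ge> 1"
  shows "(\<Sum>i<N. (tang N y d i)\<^sup>2) = (\<Sum>i<N. \<Sum>j<N. (y i * d j - y j * d i)\<^sup>2) / (2 * real N)"
proof -
  have "(\<Sum>i<N. \<Sum>j<N. (y i * tang N y d j - y j * tang N y d i) * (y i * tang N y d j - y j * tang N y d i))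
    = 2 * (real N * (\<Sum>i<N. tang N y d i * tang N y d i) - 0)"
    using y tang_orthogonal[OF y, of d]
    by (subst lagrange_identity) (simp add: kac_sphere_def mult.commute)
  moreover have "(\<Sum>i<N. \<Sum>j<N. (y i * tang N y d j - y j * tang N y d i) * (y i * tang N y d j - y j * tang N y d i))
    = (\<Sum>i<N. \<Sum>j<N. (y i * d j - y j * d i)\<^sup>2)"
    by (intro sum.cong refl) (simp add: tang_wedge power2_eq_square)
  ultimately show ?thesis using N by (simp add: power2_eq_square field_simps)
qed

lemma tang_cong: "(\<And>i. i < N \<Longrightarrow> d i = e i) \<Longrightarrow> tang N y d = tang N y e"
proof -
  assume e: "\<And>i. i < N \<Longrightarrow> d i = e i"
  then have "(\<Sum>j<N. d j * y j) = (\<Sum>j<N. e j * y j)" by (intro sum.cong) auto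
  then show ?thesis using e by (auto simp: tang_def fun_eq_iff)
qed

lemma L2_set_tang_le:
  assumes y: "y \<in> kac_sphere N" and N: "N \<ge> 1"
  shows "L2_set (tang N y d) {..<N} \<le> L2_set d {..<N}"
proof -
  define c where "c = (\<Sum>j<N. d j * y j) / real N"
  have "(\<Sum>i<N. (tang N y d i)\<^sup>2) = (\<Sum>i<N. (d i)\<^sup>2 - 2 * c * (d i * y i) + c\<^sup>2 * (y i)\<^sup>2)"
    by (intro sum.cong) (auto simp: tang_def c_def[symmetric] power2_eq_square algebra_simps)
  also have "\<dots> = (\<Sum>i<N. (d i)\<^sup>2) - 2 * c * (\<Sum>i<N. d i * y i) + c\<^sup>2 * (\<Sum>i<N. (y i)\<^sup>2)"
    unfolding sum.distrib sum_subtractf sum_distrib_left ..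
  also have "\<dots> = (\<Sum>i<N. (d i)\<^sup>2) - real N * c\<^sup>2"
    using y N by (simp add: kac_sphere_def c_def power2_eq_square)
  finally have "(\<Sum>i<N. (tang N y d i)\<^sup>2) \<le> (\<Sum>i<N. (d i)\<^sup>2)" by simp
  then show ?thesis by (simp add: L2_set_def)
qed

lemma tang_diff: "i < N \<Longrightarrow> tang N y (\<lambda>i. d i - e i) i = tang N y d i - tang N y e i"
  by (simp add: tang_def left_diff_distrib sum_subtractf algebra_simps diff_divide_distrib)

text \<open>A basic neighbourhood in the product topology constrains finitely many coordinates, and
  extensional points agree beyond N, so a cube in the first N coordinates fits inside.\<close>

lemma open_box_coord:
  fixes y :: "nat \<Rightarrow> real"
  assumes U: "openin (top_of_set (extensional {..<N})) U" and y: "y \<in> U"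
  obtains e where "e > 0" "\<And>x. x \<in> extensional {..<N} \<Longrightarrow> (\<And>i. i < N \<Longrightarrow> \<bar>x i - y i\<bar> < e) \<Longrightarrow> x \<in> U"
proof -
  obtain V where V: "open V" "U = extensional {..<N} \<inter> V"
    using U by (auto simp: openin_open)
  have "\<exists>X. y \<in> PiE UNIV X \<and> (\<forall>i. openin euclidean (X i)) \<and> finite {i. X i \<noteq> topspace euclidean} \<and> PiE UNIV X \<subseteq> V"
    using V y by (intro product_topology_open_contains_basis) (auto simp: open_fun_def[symmetric])
  then obtain X where X: "y \<in> PiE UNIV X" "\<And>i. open (X i)" "PiE UNIV X \<subseteq> V"
    unfolding open_openin[symmetric] by blast
  have "\<exists>e>0. ball (y i) e \<subseteq> X i" for i
    using X(1,2) by (metis PiE_mem UNIV_I openE)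
  then obtain e where e: "\<And>i. e i > 0" "\<And>i. ball (y i) (e i) \<subseteq> X i" by metis
  define d where "d = Min (insert 1 (e ` {..<N}))"
  have d: "d > 0" using e(1) by (auto simp: d_def)
  have de: "d \<le> e i" if "i < N" for i using that by (auto simp: d_def)
  show ?thesis
  proof (rule that[OF d])
    fix x assume x: "x \<in> extensional {..<N}" and dx: "\<And>i. i < N \<Longrightarrow> \<bar>x i - y i\<bar> < d"
    have "x i \<in> X i" for i
    proof (cases "i < N")
      case True
      then have "x i \<in> ball (y i) (e i)" using dx[OF True] de[OF True] by (auto simp: dist_real_def)
      then show ?thesis using e(2) by blast
    next
      case False
      then have "x i = y i" using x y V(2) by (auto simp: extensional_def)
      then show ?thesis using X(1) by auto
    qed
    then have "x \<in> V" using X(3) by auto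
    then show "x \<in> U" using V(2) x by simp
  qed
qed

lemma continuous_fun_upd2:
  fixes y :: "nat \<Rightarrow> real"
  shows "continuous_on S (\<lambda>p. y(i := fst p, j := snd p :: real))"
proof (rule continuous_on_coordinatewise_then_product)
  fix k show "continuous_on S (\<lambda>p. (y(i := fst p, j := snd p)) k)"
    by (cases "k = j"; cases "k = i") (auto intro: continuous_intros)
qed

text \<open>Along the rotation only the coordinates i and j move, so the chain rule is applied to a
  function of two variables. Its total derivative exists because one partial exists at the point and
  the other exists nearby and is continuous.\<close>

lemma C1_partials_plane_rot:
  assumes U: "openin (top_of_set (extensional {..<N})) U" and y: "y \<in> U"
    and C: "C1_partials N U k dk" and ij: "i < N" "j < N" "i \<noteq> j"
  shows "((\<lambda>t. k (plane_rot i j t y)) has_real_derivative (y i * dk j y - y j * dk i y)) (at 0)"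
proof -
  obtain e where e: "e > 0" and eU: "\<And>x. x \<in> extensional {..<N} \<Longrightarrow> (\<And>i. i < N \<Longrightarrow> \<bar>x i - y i\<bar> < e) \<Longrightarrow> x \<in> U"
    using open_box_coord[OF U y] by blast
  have yext: "y \<in> extensional {..<N}" using U y openin_subset[OF U] by auto
  define f where "f a b = k (y(i := a, j := b))" for a b
  define X where "X = ball (y i) e"
  define Y where "Y = ball (y j) e"
  have inU: "y(i := a, j := b) \<in> U" if "a \<in> X" "b \<in> Y" for a b
    using that ij yext e by (intro eU) (auto simp: X_def Y_def extensional_def dist_real_def)
  have d1: "((\<lambda>a. f a (y j)) has_derivative (\<lambda>h. dk i y * h)) (at (y i) within X)"
  proof -
    have "((\<lambda>t. k (y(i := t))) has_real_derivative dk i y) (at (y i))"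
      using C ij y by (auto simp: C1_partials_def)
    moreover have "(\<lambda>t. k (y(i := t))) = (\<lambda>a. f a (y j))"
      using ij by (auto simp: f_def fun_eq_iff intro!: arg_cong[of _ _ k])
    ultimately show ?thesis by (simp add: has_field_derivative_def has_derivative_at_withinI)
  qed
  have d2: "((\<lambda>b. f a b) has_derivative blinfun_apply (blinfun_scaleR_left (dk j (y(i := a, j := b))))) (at b within Y)"
    if ab: "a \<in> X" "b \<in> Y" for a b
  proof -
    have *: "((\<lambda>t. k (x(j := t))) has_real_derivative dk j x) (at (x j))" if "x \<in> U" for x
      using C ij that by (simp add: C1_partials_def)
    from *[OF inU[OF ab]] show ?thesis
      by (simp add: f_def has_field_derivative_def has_derivative_at_withinI mult.commute[of _ "dk j _"])
  qed
  have cont: "continuous (at (y i, y j) within X \<times> Y) (\<lambda>(a, b). blinfun_scaleR_left (dk j (y(i := a, j := b))) :: real \<Rightarrow>\<^sub>L real)"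
  proof -
    have "continuous_on (X \<times> Y) (\<lambda>p. dk j (y(i := fst p, j := snd p)))"
    proof (rule continuous_on_compose2[of U "dk j"])
      show "continuous_on U (dk j)" using C ij by (auto simp: C1_partials_def)
      show "continuous_on (X \<times> Y) (\<lambda>p. y(i := fst p, j := snd p))" by (rule continuous_fun_upd2)
    qed (use inU in auto)
    then have "continuous_on (X \<times> Y) (\<lambda>p. blinfun_scaleR_left (dk j (y(i := fst p, j := snd p))) :: real \<Rightarrow>\<^sub>L real)"
      by (intro bounded_linear.continuous_on[OF bounded_linear_blinfun_scaleR_left])
    then show ?thesis
      using e by (simp add: continuous_on_eq_continuous_within X_def Y_def case_prod_beta')
  qed
  have D: "((\<lambda>(a, b). f a b) has_derivative (\<lambda>(tx, ty). dk i y * tx + blinfun_apply (blinfun_scaleR_left (dk j (y(i := y i, j := y j)))) ty))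
      (at (y i, y j) within X \<times> Y)"
    by (rule has_derivative_partialsI[where fy = "\<lambda>a b. blinfun_scaleR_left (dk j (y(i := a, j := b)))", OF d1 d2 cont])
       (use e in \<open>auto simp: Y_def\<close>)
  have op: "open (X \<times> Y)" and inXY: "(y i, y j) \<in> X \<times> Y"
    using e by (auto simp: X_def Y_def open_Times)
  have eq: "(\<lambda>(tx, ty). dk i y * tx + blinfun_apply (blinfun_scaleR_left (dk j (y(i := y i, j := y j)))) ty) =
      (\<lambda>(tx, ty). dk i y * tx + dk j y * ty)"
    by (auto simp: fun_eq_iff)
  have D': "((\<lambda>(a, b). f a b) has_derivative (\<lambda>(tx, ty). dk i y * tx + dk j y * ty)) (at (y i, y j))"
    using D unfolding eq at_within_open[OF inXY op] .
  define c where "c t = (cos t * y i - sin t * y j, sin t * y i + cos t * y j)" for t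
  have c: "(c has_derivative (\<lambda>h. (- y j * h, y i * h))) (at 0)"
    unfolding c_def
  proof (rule has_derivative_Pair)
    show "((\<lambda>t. cos t * y i - sin t * y j) has_derivative (\<lambda>h. - y j * h)) (at 0)"
      unfolding has_field_derivative_def[symmetric] by (auto intro!: derivative_eq_intros)
    show "((\<lambda>t. sin t * y i + cos t * y j) has_derivative (\<lambda>h. y i * h)) (at 0)"
      unfolding has_field_derivative_def[symmetric] by (auto intro!: derivative_eq_intros)
  qed
  have c0: "c 0 = (y i, y j)" by (simp add: c_def)
  have "((\<lambda>t. (\<lambda>(a, b). f a b) (c t)) has_derivative (\<lambda>h. (\<lambda>(tx, ty). dk i y * tx + dk j y * ty) (- y j * h, y i * h))) (at 0)"
    by (rule has_derivative_compose[OF c], unfold c0, rule D')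
  moreover have "(\<lambda>t. (\<lambda>(a, b). f a b) (c t)) = (\<lambda>t. k (plane_rot i j t y))"
    by (simp add: f_def c_def plane_rot_def)
  moreover have "(\<lambda>h. (\<lambda>(tx, ty). dk i y * tx + dk j y * ty) (- y j * h, y i * h)) = (*) (y i * dk j y - y j * dk i y)"
    by (simp add: fun_eq_iff algebra_simps)
  ultimately show ?thesis
    unfolding has_field_derivative_def by simp
qed

text \<open>The orbit of y stays on the sphere, where the extension agrees with h. The derivative
  along it therefore sees h alone, whatever extension was chosen, and the radial part of the
  gradient drops out of the wedge.\<close>

lemma has_sphere_gradD:
  assumes G: "has_sphere_grad N h y G" and y: "y \<in> kac_sphere N"
  shows "i < N \<Longrightarrow> j < N \<Longrightarrow> i \<noteq> j \<Longrightarrow>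
      ((\<lambda>t. h (plane_rot i j t y)) has_real_derivative (y i * G j - y j * G i)) (at 0)"
    and "tang N y G = G"
proof -
  obtain U k dk where U: "openin (top_of_set (extensional {..<N})) U" "y \<in> U"
    and C: "C1_partials N U k dk" and k: "\<And>x. x \<in> U \<inter> kac_sphere N \<Longrightarrow> k x = h x"
    and Geq: "G = tang N y (\<lambda>i. dk i y)"
    using G unfolding has_sphere_grad_def tang_def by blast
  show "tang N y G = G"
  proof -
    have "(\<Sum>j<N. G j * y j) = 0" unfolding Geq by (rule tang_orthogonal[OF y])
    then show ?thesis unfolding tang_def[of N y G] by (auto simp: Geq tang_def fun_eq_iff)
  qed
  assume ij: "i < N" "j < N" "i \<noteq> j"
  obtain e where e: "e > 0" and eU: "\<And>x. x \<in> extensional {..<N} \<Longrightarrow> (\<And>i. i < N \<Longrightarrow> \<bar>x i - y i\<bar> < e) \<Longrightarrow> x \<in> U"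
    using open_box_coord[OF U] by blast
  have yext: "y \<in> extensional {..<N}" using y by (simp add: kac_sphere_def)
  have "eventually (\<lambda>t. \<bar>plane_rot i j t y i - y i\<bar> < e \<and> \<bar>plane_rot i j t y j - y j\<bar> < e) (at 0)"
  proof (rule eventually_conj)
    have "((\<lambda>t. \<bar>(cos t * y i - sin t * y j) - y i\<bar>) \<longlongrightarrow> \<bar>(cos 0 * y i - sin 0 * y j) - y i\<bar>) (at 0)"
      by (intro tendsto_intros)
    then show "eventually (\<lambda>t. \<bar>plane_rot i j t y i - y i\<bar> < e) (at 0)"
      using e ij by (auto simp: plane_rot_eval intro: order_tendstoD)
    have "((\<lambda>t. \<bar>(sin t * y i + cos t * y j) - y j\<bar>) \<longlongrightarrow> \<bar>(sin 0 * y i + cos 0 * y j) - y j\<bar>) (at 0)"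
      by (intro tendsto_intros)
    then show "eventually (\<lambda>t. \<bar>plane_rot i j t y j - y j\<bar> < e) (at 0)"
      using e ij by (auto simp: plane_rot_eval intro: order_tendstoD)
  qed
  then have ev: "eventually (\<lambda>t. k (plane_rot i j t y) = h (plane_rot i j t y)) (at 0)"
  proof eventually_elim
    case (elim t)
    have "plane_rot i j t y \<in> U"
    proof (rule eU)
      fix l show "\<bar>plane_rot i j t y l - y l\<bar> < e"
        using elim e by (cases "l = i"; cases "l = j") (auto simp: plane_rot_eval[OF ij(3)])
    qed (use ij yext in \<open>auto simp: plane_rot_extensional\<close>)
    then show ?case using y ij by (intro k) (auto simp: plane_rot_kac_sphere)
  qed
  have "((\<lambda>t. k (plane_rot i j t y)) has_real_derivative (y i * dk j y - y j * dk i y)) (at 0)"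
    by (rule C1_partials_plane_rot[OF U C ij])
  moreover have "y i * dk j y - y j * dk i y = y i * G j - y j * G i"
    using ij by (simp add: Geq tang_wedge)
  moreover have "\<forall>\<^sub>F t in nhds 0. k (plane_rot i j t y) = h (plane_rot i j t y)"
    using ev k[of y] U(2) y unfolding eventually_nhds_conv_at by simp
  ultimately show "((\<lambda>t. h (plane_rot i j t y)) has_real_derivative (y i * G j - y j * G i)) (at 0)"
    using DERIV_cong_ev[OF refl, of "\<lambda>t. k (plane_rot i j t y)" "\<lambda>t. h (plane_rot i j t y)" 0] by simp
qed

text \<open>Rotation derivatives are intrinsic and determine a tangential vector. Hence the choice
  operator in \<open>sphere_grad\<close> has a single candidate on the sphere.\<close>

lemma has_sphere_grad_unique:
  assumes "has_sphere_grad N h y G" "has_sphere_grad N h y G'" and y: "y \<in> kac_sphere N"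
  shows "G = G'"
proof -
  have w: "y j * G i - y i * G j = y j * G' i - y i * G' j" if "i < N" "j < N" for i j
  proof (cases "i = j")
    case False
    then show ?thesis
      using DERIV_unique[OF has_sphere_gradD(1)[OF assms(1) y, of j i] has_sphere_gradD(1)[OF assms(2) y, of j i]] that
      by simp
  qed simp
  have "tang N y G i = tang N y G' i" for i
  proof (cases "i < N")
    case True
    then show ?thesis
      unfolding tang_eq_wedge_sum[OF y True] using w by (intro arg_cong2[of _ _ _ _ "(*)"] sum.cong) auto
  qed (simp add: tang_def)
  then show ?thesis
    using has_sphere_gradD(2)[OF assms(1) y] has_sphere_gradD(2)[OF assms(2) y] by (metis ext)
qed

lemma sphere_grad_eqI:
  assumes "has_sphere_grad N h y G" "y \<in> kac_sphere N"
  shows "sphere_grad N h y = G"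
  unfolding sphere_grad_def using assms by (intro some_equality has_sphere_grad_unique[OF _ assms(1)]) auto

lemma has_sphere_grad_sphere_grad:
  assumes "sphere_C1 N h" "y \<in> kac_sphere N"
  shows "has_sphere_grad N h y (sphere_grad N h y)"
  using assms unfolding sphere_C1_def sphere_grad_def by (metis someI_ex)

text \<open>\<open>C1_partials\<close> speaks of partial derivatives only. Near y these are bounded,
  so the mean value theorem in one coordinate after another gives a Lipschitz estimate at y.\<close>

lemma C1_partials_continuous:
  assumes U: "openin (top_of_set (extensional {..<N})) U" and y: "y \<in> U"
    and C: "C1_partials N U k dk"
  shows "continuous (at y within U) k"
proof -
  \<comment> \<open>On \<open>U'\<close> every partial differs from its value at y by less than 1;
    this yields the common bound \<open>B\<close>.\<close>
  define U' where "U' = U \<inter> (\<Inter>i<N. U \<inter> dk i -` ball (dk i y) 1)"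
  have "openin (top_of_set U) (U \<inter> dk i -` ball (dk i y) 1)" if "i < N" for i
    using C that by (intro continuous_openin_preimage_gen) (auto simp: C1_partials_def)
  then have "openin (top_of_set U) ((\<Inter>i<N. U \<inter> dk i -` ball (dk i y) 1) \<inter> topspace (top_of_set U))"
    by (intro openin_INT) auto
  then have "openin (top_of_set U) U'"
    unfolding U'_def by (simp add: Int_commute)
  then have oU': "openin (top_of_set (extensional {..<N})) U'"
    using U openin_trans by blast
  have yU': "y \<in> U'" using y by (auto simp: U'_def)
  obtain e where e: "e > 0" and eU: "\<And>x. x \<in> extensional {..<N} \<Longrightarrow> (\<And>i. i < N \<Longrightarrow> \<bar>x i - y i\<bar> < e) \<Longrightarrow> x \<in> U'"
    using open_box_coord[OF oU' yU'] by blast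
  have ext: "x \<in> extensional {..<N}" if "x \<in> U" for x
    using openin_subset[OF U] that by auto
  define B where "B = (\<Sum>i<N. \<bar>dk i y\<bar>) + 1"
  have B: "\<bar>dk i x\<bar> \<le> B" if "x \<in> U'" "i < N" for x i
  proof -
    have "x \<in> dk i -` ball (dk i y) 1" using that unfolding U'_def by blast
    then have "\<bar>dk i x - dk i y\<bar> < 1" by (auto simp: dist_real_def)
    moreover have "\<bar>dk i y\<bar> \<le> (\<Sum>i<N. \<bar>dk i y\<bar>)" using that by (intro member_le_sum) auto
    ultimately show ?thesis unfolding B_def by linarith
  qed
  have bound: "\<bar>k x - k y\<bar> \<le> B * (\<Sum>i<N. \<bar>x i - y i\<bar>)"
    if x: "x \<in> U" and box: "\<And>i. i < N \<Longrightarrow> \<bar>x i - y i\<bar> < e" for x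
  proof -
    \<comment> \<open>A path from y to x that changes one coordinate at a time; all its points stay
      in the cube around y.\<close>
    define z where "z m = (\<lambda>i. if i < m then x i else y i)" for m
    have step: "\<bar>k (z (Suc m)) - k (z m)\<bar> \<le> B * \<bar>x m - y m\<bar>" if m: "m < N" for m
    proof -
      have inU: "(z m)(m := t) \<in> U'" if "t \<in> ball (y m) e" for t
        using that box m ext[OF x] ext[OF y] e
        by (intro eU) (auto simp: z_def extensional_def dist_real_def abs_minus_commute)
      have "norm ((\<lambda>t. k ((z m)(m := t))) (x m) - (\<lambda>t. k ((z m)(m := t))) (y m)) \<le> B * norm (x m - y m)"
      proof (rule field_differentiable_bound[of "ball (y m) e" _ "\<lambda>t. dk m ((z m)(m := t))"])
        fix t assume t: "t \<in> ball (y m) e"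
        have *: "((\<lambda>t. k (x(m := t))) has_real_derivative dk m x) (at (x m))" if "x \<in> U" for x
          using C m that by (simp add: C1_partials_def)
        have "(z m)(m := t) \<in> U" using inU[OF t] by (simp add: U'_def)
        from *[OF this] show "((\<lambda>t. k ((z m)(m := t))) has_field_derivative dk m ((z m)(m := t))) (at t within ball (y m) e)"
          by (simp add: has_field_derivative_at_within)
        show "norm (dk m ((z m)(m := t))) \<le> B" using B[OF inU[OF t] m] by simp
      qed (use e box[OF m] in \<open>auto simp: dist_real_def abs_minus_commute\<close>)
      moreover have "(z m)(m := x m) = z (Suc m)" "(z m)(m := y m) = z m"
        by (auto simp: z_def fun_eq_iff)
      ultimately show ?thesis by simp
    qed
    have "\<bar>k (z m) - k (z 0)\<bar> \<le> B * (\<Sum>i<m. \<bar>x i - y i\<bar>)" if "m \<le> N" for m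
      using that
    proof (induction m)
      case (Suc m)
      then show ?case using step[of m] by (auto simp: distrib_left)
    qed simp
    from this[of N] have "\<bar>k (z N) - k (z 0)\<bar> \<le> B * (\<Sum>i<N. \<bar>x i - y i\<bar>)" by simp
    moreover have "z N = x" "z 0 = y"
      using ext[OF x] ext[OF y] by (auto simp: z_def extensional_def fun_eq_iff)
    ultimately show ?thesis by simp
  qed
  have coord: "((\<lambda>x. x i) \<longlongrightarrow> y i) (at y within U)" for i
    using continuous_on_coord[of UNIV i] by (auto simp: continuous_on_def intro: tendsto_within_subset)
  have "((\<lambda>x. B * (\<Sum>i<N. \<bar>x i - y i\<bar>)) \<longlongrightarrow> B * (\<Sum>i<N. \<bar>y i - y i\<bar>)) (at y within U)"
    by (intro tendsto_intros coord)
  then have lim: "((\<lambda>x. B * (\<Sum>i<N. \<bar>x i - y i\<bar>)) \<longlongrightarrow> 0) (at y within U)" by simp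
  have "eventually (\<lambda>x. \<forall>i\<in>{..<N}. \<bar>x i - y i\<bar> < e) (at y within U)"
  proof (intro eventually_ball_finite ballI)
    fix i
    have "((\<lambda>x. \<bar>x i - y i\<bar>) \<longlongrightarrow> \<bar>y i - y i\<bar>) (at y within U)" by (intro tendsto_intros coord)
    then show "eventually (\<lambda>x. \<bar>x i - y i\<bar> < e) (at y within U)" using e by (auto intro: order_tendstoD)
  qed simp
  moreover have "eventually (\<lambda>x. x \<in> U) (at y within U)" by (simp add: eventually_at_filter)
  ultimately have "eventually (\<lambda>x. norm (k x - k y) \<le> B * (\<Sum>i<N. \<bar>x i - y i\<bar>)) (at y within U)"
    by eventually_elim (use bound in auto)
  from Lim_null_comparison[OF this lim] show ?thesis
    unfolding continuous_within by (subst LIM_zero_iff[symmetric])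
qed

lemma openin_kac_sphere_Int:
  assumes "openin (top_of_set (extensional {..<N})) U"
  shows "openin (top_of_set (kac_sphere N)) (U \<inter> kac_sphere N)"
proof -
  have "kac_sphere N \<subseteq> extensional {..<N}" by (auto simp: kac_sphere_def)
  then show ?thesis using assms by (auto simp: openin_open)
qed

lemma continuous_within_kac_sphere_transform:
  fixes k h :: "(nat \<Rightarrow> real) \<Rightarrow> real"
  assumes U: "openin (top_of_set (extensional {..<N})) U" and y: "y \<in> U" "y \<in> kac_sphere N"
    and k: "continuous (at y within U) k" and eq: "\<And>x. x \<in> U \<inter> kac_sphere N \<Longrightarrow> k x = h x"
  shows "continuous (at y within kac_sphere N) h"
proof -
  obtain V where V: "open V" "U = extensional {..<N} \<inter> V"
    using U by (auto simp: openin_open)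
  have "continuous (at y within (U \<inter> kac_sphere N)) k"
    using k by (rule continuous_within_subset) auto
  moreover have "at y within (U \<inter> kac_sphere N) = at y within kac_sphere N"
    using V y by (intro at_within_nhd[of y V]) (auto simp: kac_sphere_def)
  ultimately have "continuous (at y within kac_sphere N) k" by simp
  then show ?thesis
    by (rule continuous_transform_within_openin[OF _ openin_kac_sphere_Int[OF U]]) (use y eq in auto)
qed

text \<open>The gradient is chosen point by point, but an extension around y also serves the nearby
  points of the sphere. There uniqueness identifies \<open>sphere_grad\<close> with the projection
  of the continuous partials of that one extension.\<close>

lemma sphere_C1_continuous:
  assumes h: "sphere_C1 N h"
  shows "continuous_on (kac_sphere N) h"
    and "i < N \<Longrightarrow> continuous_on (kac_sphere N) (\<lambda>y. sphere_grad N h y i)"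
proof -
  have *: "continuous (at y within kac_sphere N) h \<and>
     (\<forall>i<N. continuous (at y within kac_sphere N) (\<lambda>y. sphere_grad N h y i))" if y: "y \<in> kac_sphere N" for y
  proof -
    obtain G where "has_sphere_grad N h y G" using h y by (auto simp: sphere_C1_def)
    then obtain U k dk where U: "openin (top_of_set (extensional {..<N})) U" "y \<in> U"
      and C: "C1_partials N U k dk" and k: "\<And>x. x \<in> U \<inter> kac_sphere N \<Longrightarrow> k x = h x"
      unfolding has_sphere_grad_def by blast
    have "continuous (at y within kac_sphere N) h"
      by (rule continuous_within_kac_sphere_transform[OF U y C1_partials_continuous[OF U C] k])
    moreover have "continuous (at y within kac_sphere N) (\<lambda>y. sphere_grad N h y i)" if i: "i < N" for i
    proof (rule continuous_within_kac_sphere_transform[OF U y])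
      have dk: "continuous (at y within U) (dk j)" if "j < N" for j
        using C U(2) that by (auto simp: C1_partials_def continuous_on_eq_continuous_within)
      have coord: "continuous (at y within U) (\<lambda>x. x j)" for j
        using continuous_on_coord[of U j] U(2) by (simp add: continuous_on_eq_continuous_within)
      show "continuous (at y within U) (\<lambda>x. dk i x - (1 / real N) * (\<Sum>j<N. dk j x * x j) * x i)"
        by (intro continuous_intros dk coord) (use i in auto)
      fix x assume x: "x \<in> U \<inter> kac_sphere N"
      have "has_sphere_grad N h x (tang N x (\<lambda>i. dk i x))"
        unfolding has_sphere_grad_def tang_def using U(1) C k x by blast
      then have "sphere_grad N h x = tang N x (\<lambda>i. dk i x)"
        using x by (intro sphere_grad_eqI) auto
      then show "dk i x - (1 / real N) * (\<Sum>j<N. dk j x * x j) * x i = sphere_grad N h x i"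
        using i by (simp add: tang_def)
    qed
    ultimately show ?thesis by blast
  qed
  show "continuous_on (kac_sphere N) h"
    "i < N \<Longrightarrow> continuous_on (kac_sphere N) (\<lambda>y. sphere_grad N h y i)"
    using * by (auto simp: continuous_on_eq_continuous_within)
qed

section \<open>Mean values of rotation derivatives\<close>

lemma bounded_on_kac_sphere:
  fixes A :: "(nat \<Rightarrow> real) \<Rightarrow> real"
  assumes "continuous_on (kac_sphere N) A"
  obtains B where "\<And>y. y \<in> kac_sphere N \<Longrightarrow> \<bar>A y\<bar> \<le> B" "B \<ge> 0"
proof -
  have "bounded (A ` kac_sphere N)"
    using assms compact_kac_sphere compact_continuous_image compact_imp_bounded by blast
  then obtain B where "B > 0" "\<And>y. y \<in> kac_sphere N \<Longrightarrow> \<bar>A y\<bar> \<le> B"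
    unfolding bounded_pos by auto
  then show ?thesis using that[of B] by auto
qed

lemma integrable_indicator_kac_sphere:
  fixes A :: "(nat \<Rightarrow> real) \<Rightarrow> real"
  assumes "continuous_on (kac_sphere N) A"
  shows "integrable (uniform_sphere N) (\<lambda>y. indicator (kac_sphere N) y * A y)"
proof -
  interpret U: prob_space "uniform_sphere N" by (rule prob_space_uniform_sphere)
  obtain B where B: "\<And>y. y \<in> kac_sphere N \<Longrightarrow> \<bar>A y\<bar> \<le> B" "B \<ge> 0"
    using bounded_on_kac_sphere[OF assms] by blast
  show ?thesis
  proof (rule U.integrable_const_bound[of _ B])
    show "AE y in uniform_sphere N. norm (indicator (kac_sphere N) y * A y) \<le> B"
      using B by (intro AE_I2) (auto simp: indicator_def)
    show "(\<lambda>y. indicator (kac_sphere N) y * A y) \<in> borel_measurable (uniform_sphere N)"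
      using borel_measurable_indicator_kac_sphere[OF assms] by (simp cong: measurable_cong_sets)
  qed
qed

text \<open>\<open>DA\<close> stands for L_ij A. For distinct i, j < N only the restriction of A to
  the sphere enters, because rotations preserve it.\<close>

definition rot_deriv ::
    "nat \<Rightarrow> nat \<Rightarrow> nat \<Rightarrow> ((nat \<Rightarrow> real) \<Rightarrow> real) \<Rightarrow> ((nat \<Rightarrow> real) \<Rightarrow> real) \<Rightarrow> bool" where
  "rot_deriv N i j A DA \<longleftrightarrow>
     (\<forall>y\<in>kac_sphere N. ((\<lambda>t. A (plane_rot i j t y)) has_real_derivative DA y) (at 0))"

text \<open>The group law moves the derivative at angle 0 to an arbitrary angle.\<close>

lemma rot_deriv_at:
  assumes A: "rot_deriv N i j A DA" and ij: "i < N" "j < N" "i \<noteq> j" and y: "y \<in> kac_sphere N"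
  shows "((\<lambda>s. A (plane_rot i j s y)) has_real_derivative DA (plane_rot i j t y)) (at t)"
proof -
  have "((\<lambda>s. A (plane_rot i j s (plane_rot i j t y))) has_real_derivative DA (plane_rot i j t y)) (at 0)"
    using A plane_rot_kac_sphere[OF ij y] by (auto simp: rot_deriv_def)
  then have "((\<lambda>s. A (plane_rot i j (s + t) y)) has_real_derivative DA (plane_rot i j t y)) (at 0)"
    using ij by (simp add: plane_rot_add)
  then show ?thesis using DERIV_shift[of "\<lambda>s. A (plane_rot i j s y)" _ 0 t] by simp
qed

text \<open>The mean of \<open>A\<close> over the rotated sphere does not depend on the angle.\<close>
lemma integral_rot_deriv_zero:
  assumes ij: "i < N" "j < N" "i \<noteq> j"
    and A: "continuous_on (kac_sphere N) A" and DA: "continuous_on (kac_sphere N) DA"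
    and R: "rot_deriv N i j A DA"
  shows "(\<integral>y. indicator (kac_sphere N) y * DA y \<partial>uniform_sphere N) = 0"
proof -
  let ?S = "kac_sphere N" and ?U = "uniform_sphere N"
  define A' where "A' y = indicator ?S y * A y" for y
  have A'm [measurable]: "A' \<in> borel_measurable (Rn N)"
    unfolding A'_def using borel_measurable_indicator_kac_sphere[OF A] .
  have A'i: "integrable ?U A'" unfolding A'_def by (rule integrable_indicator_kac_sphere[OF A])
  obtain B where B: "\<And>y. y \<in> ?S \<Longrightarrow> \<bar>DA y\<bar> \<le> B" "B \<ge> 0"
    using bounded_on_kac_sphere[OF DA] by blast
  interpret U: prob_space ?U by (rule prob_space_uniform_sphere)
  note [measurable] = measurable_plane_rot[OF ij(1,2)]
  \<comment> \<open>Angles in (0, 1], so that \<open>cos (r n / 2)\<close> is nonzero and rotation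
    invariance applies.\<close>
  define r :: "nat \<Rightarrow> real" where "r n = 1 / real (Suc n)" for n
  have r: "0 < r n" "r n \<le> 1" for n by (auto simp: r_def)
  have cosr: "cos (r n / 2) \<noteq> 0" for n
    using r[of n] pi_gt3 by (intro less_imp_neq[symmetric] cos_gt_zero) auto
  define Q where "Q n y = (A' (plane_rot i j (r n) y) - A' y) / r n" for n y
  have rotint: "integrable ?U (\<lambda>y. A' (plane_rot i j (r n) y))"
    "(\<integral>y. A' (plane_rot i j (r n) y) \<partial>?U) = (\<integral>y. A' y \<partial>?U)" for n
  proof -
    have "integrable (distr ?U (Rn N) (plane_rot i j (r n))) A'"
      unfolding distr_uniform_sphere_rot[OF ij cosr] by (rule A'i)
    then show "integrable ?U (\<lambda>y. A' (plane_rot i j (r n) y))"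
      by (subst (asm) integrable_distr_eq) auto
    have "(\<integral>y. A' y \<partial>distr ?U (Rn N) (plane_rot i j (r n))) = (\<integral>y. A' (plane_rot i j (r n) y) \<partial>?U)"
      by (intro integral_distr) auto
    then show "(\<integral>y. A' (plane_rot i j (r n) y) \<partial>?U) = (\<integral>y. A' y \<partial>?U)"
      unfolding distr_uniform_sphere_rot[OF ij cosr] by simp
  qed
  have Q0: "(\<integral>y. Q n y \<partial>?U) = 0" for n
    unfolding Q_def using rotint[of n] A'i by simp
  have "(\<lambda>n. \<integral>y. Q n y \<partial>?U) \<longlonglongrightarrow> (\<integral>y. indicator ?S y * DA y \<partial>?U)"
  proof (rule integral_dominated_convergence[where w = "\<lambda>_. B"])
    show "(\<lambda>y. indicator ?S y * DA y) \<in> borel_measurable ?U"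
      using borel_measurable_indicator_kac_sphere[OF DA] by (simp cong: measurable_cong_sets)
    show "Q n \<in> borel_measurable ?U" for n
      unfolding Q_def[abs_def] by measurable
    have N1: "N \<ge> 1" using ij by simp
    show "AE y in ?U. (\<lambda>n. Q n y) \<longlonglongrightarrow> indicator ?S y * DA y"
      using AE_uniform_sphere_kac_sphere[OF N1]
    proof eventually_elim
      case (elim y)
      have "((\<lambda>t. A (plane_rot i j t y)) has_real_derivative DA y) (at 0)"
        using R elim by (simp add: rot_deriv_def)
      then have "((\<lambda>t. (A (plane_rot i j (0 + t) y) - A (plane_rot i j 0 y)) / t) \<longlongrightarrow> DA y) (at 0)"
        unfolding DERIV_def .
      moreover have "filterlim r (at 0) sequentially"
        unfolding r_def filterlim_at using LIMSEQ_inverse_real_of_nat by (auto simp: inverse_eq_divide)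
      ultimately have "(\<lambda>n. (A (plane_rot i j (0 + r n) y) - A (plane_rot i j 0 y)) / r n) \<longlonglongrightarrow> DA y"
        by (rule filterlim_compose)
      then show ?case using elim plane_rot_kac_sphere[OF ij elim] by (simp add: Q_def A'_def)
    qed
    \<comment> \<open>The mean value theorem along the orbit of y, which never leaves the sphere,
      bounds the difference quotients by a bound of \<open>DA\<close>.\<close>
    show "AE y in ?U. norm (Q n y) \<le> B" for n
      using AE_uniform_sphere_kac_sphere[OF N1]
    proof eventually_elim
      case (elim y)
      have "norm (A (plane_rot i j (r n) y) - A (plane_rot i j 0 y)) \<le> B * norm (r n - 0)"
      proof (rule field_differentiable_bound[of UNIV "\<lambda>s. A (plane_rot i j s y)" "\<lambda>s. DA (plane_rot i j s y)"])
        fix t :: real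
        show "((\<lambda>s. A (plane_rot i j s y)) has_field_derivative DA (plane_rot i j t y)) (at t within UNIV)"
          using rot_deriv_at[OF R ij elim] by simp
        show "norm (DA (plane_rot i j t y)) \<le> B" using B plane_rot_kac_sphere[OF ij elim] by simp
      qed auto
      then show ?case using elim plane_rot_kac_sphere[OF ij elim] r[of n]
        by (simp add: Q_def A'_def divide_le_eq)
    qed
  qed simp
  then show ?thesis unfolding Q0 using LIMSEQ_unique tendsto_const by blast
qed

subsection \<open>Integration by parts on the sphere\<close>

lemma rot_deriv_sphere_C1:
  assumes H: "sphere_C1 N H" and ij: "i < N" "j < N" "i \<noteq> j"
  shows "rot_deriv N i j H (\<lambda>y. y i * sphere_grad N H y j - y j * sphere_grad N H y i)"
  unfolding rot_deriv_def
  using has_sphere_gradD(1)[OF has_sphere_grad_sphere_grad[OF H] _ ij] by blast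

text \<open>A rotation derivative has mean zero; this is applied to
  \<open>\<psi> (H y) * w y\<close>. The function \<open>\<psi>\<close> leaves room for a later
  choice that separates the zeros of the density from the rest.\<close>

lemma sphere_parts_C1:
  assumes H: "sphere_C1 N H" and ij: "i < N" "j < N" "i \<noteq> j"
    and \<psi>: "\<And>s. (\<psi> has_real_derivative \<psi>' s) (at s)" and \<psi>'c: "continuous_on UNIV \<psi>'"
    and w: "rot_deriv N i j w Dw" "continuous_on (kac_sphere N) w" "continuous_on (kac_sphere N) Dw"
  shows "(\<integral>y. indicator (kac_sphere N) y *
      (\<psi>' (H y) * (y i * sphere_grad N H y j - y j * sphere_grad N H y i) * w y + \<psi> (H y) * Dw y) \<partial>uniform_sphere N) = 0"
proof (rule integral_rot_deriv_zero[OF ij])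
  note H_cont = sphere_C1_continuous[OF H]
  have \<psi>c: "continuous_on UNIV \<psi>"
    using \<psi> by (intro DERIV_continuous_on) (auto intro: has_field_derivative_at_within)
  have \<psi>H: "continuous_on (kac_sphere N) (\<lambda>y. \<psi> (H y))" "continuous_on (kac_sphere N) (\<lambda>y. \<psi>' (H y))"
    by (auto intro: continuous_on_compose2[OF \<psi>c H_cont(1)] continuous_on_compose2[OF \<psi>'c H_cont(1)])
  show "continuous_on (kac_sphere N) (\<lambda>y. \<psi> (H y) * w y)"
    by (intro continuous_intros \<psi>H w)
  show "continuous_on (kac_sphere N) (\<lambda>y. \<psi>' (H y) * (y i * sphere_grad N H y j - y j * sphere_grad N H y i) * w y + \<psi> (H y) * Dw y)"
    by (intro continuous_intros \<psi>H w H_cont(2) ij)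
  show "rot_deriv N i j (\<lambda>y. \<psi> (H y) * w y) (\<lambda>y. \<psi>' (H y) * (y i * sphere_grad N H y j - y j * sphere_grad N H y i) * w y + \<psi> (H y) * Dw y)"
    unfolding rot_deriv_def
  proof
    fix y assume y: "y \<in> kac_sphere N"
    have 1: "((\<lambda>t. H (plane_rot i j t y)) has_real_derivative (y i * sphere_grad N H y j - y j * sphere_grad N H y i)) (at 0)"
      using rot_deriv_sphere_C1[OF H ij] y by (simp add: rot_deriv_def)
    have 2: "((\<lambda>t. w (plane_rot i j t y)) has_real_derivative Dw y) (at 0)"
      using w(1) y by (simp add: rot_deriv_def)
    have 3: "((\<lambda>t. \<psi> (H (plane_rot i j t y))) has_real_derivative
        \<psi>' (H (plane_rot i j 0 y)) * (y i * sphere_grad N H y j - y j * sphere_grad N H y i)) (at 0)"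
      by (rule DERIV_chain2[OF \<psi> 1])
    show "((\<lambda>t. \<psi> (H (plane_rot i j t y)) * w (plane_rot i j t y)) has_real_derivative
        \<psi>' (H y) * (y i * sphere_grad N H y j - y j * sphere_grad N H y i) * w y + \<psi> (H y) * Dw y) (at 0)"
      using DERIV_mult[OF 3 2] by (simp add: algebra_simps)
  qed
qed

lemma nn_integral_kac_sphere_cong:
  assumes "N \<ge> 1" "\<And>y. y \<in> kac_sphere N \<Longrightarrow> F y = G y"
  shows "(\<integral>\<^sup>+y. F y \<partial>uniform_sphere N) = (\<integral>\<^sup>+y. G y \<partial>uniform_sphere N)"
  using AE_uniform_sphere_kac_sphere[OF assms(1)] assms(2)
  by (intro nn_integral_cong_AE) (auto elim: eventually_mono)

lemma abs_le_sqrt_kac_sphere: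
  assumes "y \<in> kac_sphere N" "i < N"
  shows "\<bar>y i\<bar> \<le> sqrt (real N)"
proof -
  have "(y i)\<^sup>2 \<le> (\<Sum>i<N. (y i)\<^sup>2)" using assms by (intro member_le_sum) auto
  then have "(y i)\<^sup>2 \<le> real N" using assms by (simp add: kac_sphere_def)
  then show ?thesis by (rule real_le_rsqrt[OF _, of "\<bar>y i\<bar>", simplified])
qed

text \<open>Turns L^1 closeness of gradients into L^1 closeness of rotation derivatives; a
  coordinate on the sphere is at most sqrt N in absolute value.\<close>

lemma wedge_diff_le:
  assumes y: "y \<in> kac_sphere N" and ij: "i < N" "j < N"
  shows "\<bar>(y i * a j - y j * a i) - (y i * b j - y j * b i)\<bar> \<le> 2 * sqrt (real N) * L2_set (\<lambda>i. a i - b i) {..<N}"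
proof -
  have c: "\<bar>a l - b l\<bar> \<le> L2_set (\<lambda>i. a i - b i) {..<N}" if "l < N" for l
  proof -
    have "(a l - b l)\<^sup>2 \<le> (\<Sum>i<N. (a i - b i)\<^sup>2)" using that by (intro member_le_sum) auto
    then show ?thesis unfolding L2_set_def by (rule real_le_rsqrt[OF _, of "\<bar>a l - b l\<bar>", simplified])
  qed
  have "(y i * a j - y j * a i) - (y i * b j - y j * b i) = y i * (a j - b j) - y j * (a i - b i)"
    by (simp add: algebra_simps)
  also have "\<bar>\<dots>\<bar> \<le> \<bar>y i\<bar> * \<bar>a j - b j\<bar> + \<bar>y j\<bar> * \<bar>a i - b i\<bar>"
    by (metis abs_mult abs_triangle_ineq4)
  also have "\<dots> \<le> sqrt (real N) * L2_set (\<lambda>i. a i - b i) {..<N} + sqrt (real N) * L2_set (\<lambda>i. a i - b i) {..<N}"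
    using abs_le_sqrt_kac_sphere[OF y] ij c by (intro add_mono mult_mono) auto
  finally show ?thesis by simp
qed

lemma ennreal_tendsto_0_le:
  fixes f :: "'a \<Rightarrow> ennreal"
  assumes "(g \<longlongrightarrow> 0) F" "\<And>n. f n \<le> g n"
  shows "(f \<longlongrightarrow> 0) F"
  by (rule tendsto_sandwich[OF _ _ tendsto_const assms(1)]) (auto simp: assms(2))

lemma L1_AE_subseq:
  fixes u :: "nat \<Rightarrow> 'a \<Rightarrow> real"
  assumes u: "\<And>n. integrable M (u n)" and h: "integrable M h"
    and L1: "(\<lambda>n. \<integral>\<^sup>+x. ennreal \<bar>u n x - h x\<bar> \<partial>M) \<longlonglongrightarrow> 0"
  obtains r :: "nat \<Rightarrow> nat" where "strict_mono r" "AE x in M. (\<lambda>n. u (r n) x) \<longlonglongrightarrow> h x"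
proof -
  have "(\<integral>\<^sup>+x. ennreal \<bar>u n x - h x\<bar> \<partial>M) = ennreal (\<integral>x. norm (u n x - h x) \<partial>M)" for n
    using u h by (subst nn_integral_eq_integral) auto
  then have "(\<lambda>n. ennreal (\<integral>x. norm (u n x - h x) \<partial>M)) \<longlonglongrightarrow> ennreal 0"
    using L1 by simp
  then have "(\<lambda>n. \<integral>x. norm (u n x - h x) \<partial>M) \<longlonglongrightarrow> 0"
    by (subst (asm) tendsto_ennreal_iff) auto
  then obtain r :: "nat \<Rightarrow> nat" where "strict_mono r" "AE x in M. (\<lambda>n. u (r n) x - h x) \<longlonglongrightarrow> 0"
    using tendsto_L1_AE_subseq[of M "\<lambda>n x. u n x - h x"] u h by auto
  then show ?thesis using that by (simp add: LIM_zero_iff)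
qed

text \<open>The identity for C^1 functions passes to the L^1 limit. As \<open>\<psi>\<close> is
  1-Lipschitz, \<open>\<psi> (H n)\<close> converges in L^1. The factor \<open>\<psi>' (H n)\<close>
  is merely bounded and converges almost everywhere along a subsequence, which suffices against the
  fixed integrable limit of the derivatives.\<close>

lemma sphere_parts_weak:
  assumes weak: "has_weak_sphere_grad N h g" and hm: "h \<in> borel_measurable (Rn N)"
    and hi: "integrable (uniform_sphere N) h" and ij: "i < N" "j < N" "i \<noteq> j"
    and \<psi>: "\<And>s. (\<psi> has_real_derivative \<psi>' s) (at s)" and \<psi>'c: "continuous_on UNIV \<psi>'"
    and \<psi>'01: "\<And>s. 0 \<le> \<psi>' s" "\<And>s. \<psi>' s \<le> 1"
    and w: "rot_deriv N i j w Dw" "continuous_on (kac_sphere N) w" "continuous_on (kac_sphere N) Dw"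
  shows "integrable (uniform_sphere N) (\<lambda>y. indicator (kac_sphere N) y * (y i * g y j - y j * g y i))"
    and "(\<integral>y. indicator (kac_sphere N) y * (\<psi>' (h y) * (y i * g y j - y j * g y i) * w y + \<psi> (h y) * Dw y)
      \<partial>uniform_sphere N) = 0"
proof -
  let ?S = "kac_sphere N" and ?U = "uniform_sphere N"
  interpret U: prob_space ?U by (rule prob_space_uniform_sphere)
  have N1: "N \<ge> 1" using ij by simp
  have [measurable]: "(\<lambda>y. g y l) \<in> borel_measurable (Rn N)" if "l < N" for l
    using weak that by (auto simp: has_weak_sphere_grad_def)
  note [measurable] = hm
  obtain H0 where H0: "\<And>n. sphere_C1 N (H0 n)"
     "(\<lambda>n. \<integral>\<^sup>+y. ennreal \<bar>H0 n y - h y\<bar> \<partial>?U) \<longlonglongrightarrow> 0"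
     "(\<lambda>n. \<integral>\<^sup>+y. ennreal (L2_set (\<lambda>i. sphere_grad N (H0 n) y i - g y i) {..<N}) \<partial>?U) \<longlonglongrightarrow> 0"
    using weak unfolding has_weak_sphere_grad_def by blast
  define h' where "h' y = indicator ?S y * h y" for y
  have [measurable]: "h' \<in> borel_measurable (Rn N)" unfolding h'_def by measurable
  have h'i: "integrable ?U h'"
    unfolding h'_def by (rule Bochner_Integration.integrable_bound[OF hi]) (auto simp: indicator_def)
  \<comment> \<open>Almost everywhere convergence is needed to pass to the limit inside the
    continuous function \<open>\<psi>'\<close>.\<close>
  obtain r :: "nat \<Rightarrow> nat" where r: "strict_mono r" "AE y in ?U. (\<lambda>n. indicator ?S y * H0 (r n) y) \<longlonglongrightarrow> h' y"
  proof (rule L1_AE_subseq[OF integrable_indicator_kac_sphere h'i])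
    show "continuous_on ?S (H0 n)" for n by (rule sphere_C1_continuous(1)[OF H0(1)])
    have "(\<integral>\<^sup>+y. ennreal \<bar>indicator ?S y * H0 n y - h' y\<bar> \<partial>?U) = (\<integral>\<^sup>+y. ennreal \<bar>H0 n y - h y\<bar> \<partial>?U)" for n
      by (rule nn_integral_kac_sphere_cong[OF N1]) (simp add: h'_def)
    then show "(\<lambda>n. \<integral>\<^sup>+y. ennreal \<bar>indicator ?S y * H0 n y - h' y\<bar> \<partial>?U) \<longlonglongrightarrow> 0" using H0(2) by simp
  qed
  define H where "H n = H0 (r n)" for n
  have HC: "sphere_C1 N (H n)" for n by (simp add: H_def H0)
  have H1: "(\<lambda>n. \<integral>\<^sup>+y. ennreal \<bar>H n y - h y\<bar> \<partial>?U) \<longlonglongrightarrow> 0"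
    using LIMSEQ_subseq_LIMSEQ[OF H0(2) r(1)] by (simp add: H_def o_def)
  have H2: "(\<lambda>n. \<integral>\<^sup>+y. ennreal (L2_set (\<lambda>i. sphere_grad N (H n) y i - g y i) {..<N}) \<partial>?U) \<longlonglongrightarrow> 0"
    using LIMSEQ_subseq_LIMSEQ[OF H0(3) r(1)] by (simp add: H_def o_def)
  have HA: "AE y in ?U. (\<lambda>n. H n y) \<longlonglongrightarrow> h y"
    using r(2) AE_uniform_sphere_kac_sphere[OF N1] by eventually_elim (simp add: H_def h'_def)
  define L where "L y = indicator ?S y * (y i * g y j - y j * g y i)" for y
  define LH where "LH n y = indicator ?S y * (y i * sphere_grad N (H n) y j - y j * sphere_grad N (H n) y i)" for n y
  have [measurable]: "L \<in> borel_measurable (Rn N)" unfolding L_def using ij by measurable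
  have LHc: "continuous_on ?S (\<lambda>y. y i * sphere_grad N (H n) y j - y j * sphere_grad N (H n) y i)" for n
    by (intro continuous_intros sphere_C1_continuous(2)[OF HC] ij)
  have LHi: "integrable ?U (LH n)" for n
    unfolding LH_def by (rule integrable_indicator_kac_sphere[OF LHc])
  have [measurable]: "LH n \<in> borel_measurable (Rn N)" for n
    unfolding LH_def by (rule borel_measurable_indicator_kac_sphere[OF LHc])
  define c where "c = 2 * sqrt (real N)"
  have LL: "(\<integral>\<^sup>+y. ennreal \<bar>LH n y - L y\<bar> \<partial>?U) \<le>
      ennreal c * (\<integral>\<^sup>+y. ennreal (L2_set (\<lambda>i. sphere_grad N (H n) y i - g y i) {..<N}) \<partial>?U)" for n
  proof -
    \<comment> \<open>Measurability of the gradients of \<open>H n\<close> is available only after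
      restriction to the sphere, hence the indicator inside the norm as well.\<close>
    define d where "d y = indicator ?S y * L2_set (\<lambda>i. indicator ?S y * sphere_grad N (H n) y i - g y i) {..<N}" for y
    have [measurable]: "(\<lambda>y. indicator ?S y * sphere_grad N (H n) y l) \<in> borel_measurable (Rn N)" if "l < N" for l
      by (rule borel_measurable_indicator_kac_sphere[OF sphere_C1_continuous(2)[OF HC that]])
    have [measurable]: "d \<in> borel_measurable (Rn N)"
      unfolding d_def L2_set_def by measurable
    have "(\<integral>\<^sup>+y. ennreal \<bar>LH n y - L y\<bar> \<partial>?U) \<le> (\<integral>\<^sup>+y. ennreal (c * d y) \<partial>?U)"
      by (intro nn_integral_mono ennreal_leI)
         (use wedge_diff_le[OF _ ij(1,2)] in \<open>auto simp: LH_def L_def d_def c_def indicator_def\<close>)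
    also have "\<dots> = ennreal c * (\<integral>\<^sup>+y. ennreal (d y) \<partial>?U)"
      by (subst nn_integral_cmult[symmetric]) (auto simp: ennreal_mult' c_def)
    also have "(\<integral>\<^sup>+y. ennreal (d y) \<partial>?U) = (\<integral>\<^sup>+y. ennreal (L2_set (\<lambda>i. sphere_grad N (H n) y i - g y i) {..<N}) \<partial>?U)"
      by (rule nn_integral_kac_sphere_cong[OF N1]) (simp add: d_def)
    finally show ?thesis .
  qed
  have "(\<lambda>n. ennreal c * (\<integral>\<^sup>+y. ennreal (L2_set (\<lambda>i. sphere_grad N (H n) y i - g y i) {..<N}) \<partial>?U)) \<longlonglongrightarrow> ennreal c * 0"
    by (intro ennreal_tendsto_cmult H2) simp
  then have LL0: "(\<lambda>n. \<integral>\<^sup>+y. ennreal \<bar>LH n y - L y\<bar> \<partial>?U) \<longlonglongrightarrow> 0"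
    by (intro ennreal_tendsto_0_le[OF _ LL]) simp
  then have "eventually (\<lambda>n. (\<integral>\<^sup>+y. ennreal \<bar>LH n y - L y\<bar> \<partial>?U) < 1) sequentially"
    by (rule order_tendstoD) simp
  \<comment> \<open>A single index at finite L^1 distance from an integrable function makes the
    limit \<open>L\<close> integrable.\<close>
  then obtain n0 where n0: "(\<integral>\<^sup>+y. ennreal \<bar>LH n0 y - L y\<bar> \<partial>?U) < 1"
    by (auto simp: eventually_sequentially)
  have "integrable ?U (\<lambda>y. LH n0 y - L y)"
    by (rule integrableI_bounded) (use n0 in \<open>auto intro: less_trans\<close>)
  then have "integrable ?U (\<lambda>y. LH n0 y - (LH n0 y - L y))"
    by (rule Bochner_Integration.integrable_diff[OF LHi])
  moreover have "(\<lambda>y. LH n0 y - (LH n0 y - L y)) = L" by (simp add: fun_eq_iff)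
  ultimately have Li: "integrable ?U L" by (simp only:)
  then show "integrable ?U (\<lambda>y. indicator ?S y * (y i * g y j - y j * g y i))"
    unfolding L_def .
  obtain B where B: "\<And>y. y \<in> ?S \<Longrightarrow> \<bar>w y\<bar> \<le> B" "B \<ge> 0"
    using bounded_on_kac_sphere[OF w(2)] by blast
  obtain C where C: "\<And>y. y \<in> ?S \<Longrightarrow> \<bar>Dw y\<bar> \<le> C" "C \<ge> 0"
    using bounded_on_kac_sphere[OF w(3)] by blast
  have \<psi>c: "continuous_on UNIV \<psi>"
    using \<psi> by (intro DERIV_continuous_on) (auto intro: has_field_derivative_at_within)
  have [measurable]: "\<psi> \<in> borel_measurable borel" "\<psi>' \<in> borel_measurable borel"
    using \<psi>c \<psi>'c by (auto intro: borel_measurable_continuous_onI)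
  have lip: "\<bar>\<psi> a - \<psi> b\<bar> \<le> \<bar>a - b\<bar>" for a b
    using field_differentiable_bound[of UNIV \<psi> \<psi>' 1 a b] \<psi> \<psi>'01 by (auto simp: abs_le_iff)
  define w' where "w' y = indicator ?S y * w y" for y
  define Dw' where "Dw' y = indicator ?S y * Dw y" for y
  have [measurable]: "w' \<in> borel_measurable (Rn N)" "Dw' \<in> borel_measurable (Rn N)"
    unfolding w'_def Dw'_def using borel_measurable_indicator_kac_sphere w by auto
  have w'B: "\<bar>w' y\<bar> \<le> B" "\<bar>Dw' y\<bar> \<le> C" for y
    using B C by (auto simp: w'_def Dw'_def indicator_def)
  define H' where "H' n y = indicator ?S y * H n y" for n y
  have [measurable]: "H' n \<in> borel_measurable (Rn N)" for n
    unfolding H'_def by (rule borel_measurable_indicator_kac_sphere[OF sphere_C1_continuous(1)[OF HC]])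
  have H'i: "integrable ?U (H' n)" for n
    unfolding H'_def by (rule integrable_indicator_kac_sphere[OF sphere_C1_continuous(1)[OF HC]])
  define E where "E n y = \<psi>' (H' n y) * LH n y * w' y + \<psi> (H' n y) * Dw' y" for n y
  define E0 where "E0 y = \<psi>' (h' y) * L y * w' y + \<psi> (h' y) * Dw' y" for y
  have [measurable]: "E n \<in> borel_measurable (Rn N)" "E0 \<in> borel_measurable (Rn N)" for n
    unfolding E_def E0_def by measurable
  have E_int: "integrable ?U (\<lambda>y. \<psi>' (k y) * l y * w' y + \<psi> (k y) * Dw' y)"
    if k: "integrable ?U k" and l: "integrable ?U l" for k l :: "(nat \<Rightarrow> real) \<Rightarrow> real"
  proof (rule Bochner_Integration.integrable_bound)
    show "integrable ?U (\<lambda>y. B * \<bar>l y\<bar> + C * (\<bar>\<psi> 0\<bar> + \<bar>k y\<bar>))"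
      using k l by (intro Bochner_Integration.integrable_add integrable_mult_right) auto
    have [measurable]: "k \<in> borel_measurable (Rn N)" "l \<in> borel_measurable (Rn N)"
      using k l borel_measurable_integrable by (auto cong: measurable_cong_sets)
    show "(\<lambda>y. \<psi>' (k y) * l y * w' y + \<psi> (k y) * Dw' y) \<in> borel_measurable ?U" by measurable
    have "\<bar>\<psi>' (k y) * l y * w' y\<bar> \<le> B * \<bar>l y\<bar>" for y
    proof -
      have "\<bar>\<psi>' (k y)\<bar> * \<bar>l y\<bar> * \<bar>w' y\<bar> \<le> 1 * \<bar>l y\<bar> * B"
        using \<psi>'01[of "k y"] w'B[of y] by (intro mult_mono) auto
      then show ?thesis by (simp add: abs_mult mult.commute)
    qed
    moreover have "\<bar>\<psi> (k y) * Dw' y\<bar> \<le> C * (\<bar>\<psi> 0\<bar> + \<bar>k y\<bar>)" for y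
    proof -
      have "\<bar>\<psi> (k y)\<bar> \<le> \<bar>\<psi> 0\<bar> + \<bar>k y\<bar>" using lip[of "k y" 0] by auto
      then have "\<bar>\<psi> (k y)\<bar> * \<bar>Dw' y\<bar> \<le> (\<bar>\<psi> 0\<bar> + \<bar>k y\<bar>) * C"
        using w'B[of y] by (intro mult_mono) auto
      then show ?thesis by (simp add: abs_mult mult.commute)
    qed
    ultimately show "AE y in ?U. norm (\<psi>' (k y) * l y * w' y + \<psi> (k y) * Dw' y) \<le> norm (B * \<bar>l y\<bar> + C * (\<bar>\<psi> 0\<bar> + \<bar>k y\<bar>))"
      by (intro AE_I2) (smt (verit) real_norm_def)
  qed
  \<comment> \<open>The difference is split by replacing first the derivative, then
    \<open>\<psi>'\<close>, then \<open>\<psi>\<close>. Each term tends to 0 in L^1, the middle one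
    by dominated convergence with majorant |L|.\<close>
  have bound: "ennreal \<bar>E n y - E0 y\<bar> \<le> ennreal B * ennreal \<bar>LH n y - L y\<bar> + ennreal B * ennreal (\<bar>\<psi>' (H' n y) - \<psi>' (h' y)\<bar> * \<bar>L y\<bar>)
      + ennreal C * ennreal \<bar>H' n y - h' y\<bar>" for n y
  proof -
    have "E n y - E0 y = \<psi>' (H' n y) * w' y * (LH n y - L y) + w' y * ((\<psi>' (H' n y) - \<psi>' (h' y)) * L y) + Dw' y * (\<psi> (H' n y) - \<psi> (h' y))"
      by (simp add: E_def E0_def algebra_simps)
    moreover have "\<bar>\<psi>' (H' n y) * w' y * (LH n y - L y)\<bar> \<le> (1 * B) * \<bar>LH n y - L y\<bar>"
      unfolding abs_mult using \<psi>'01[of "H' n y"] w'B[of y] by (intro mult_mono) auto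
    moreover have "\<bar>w' y * ((\<psi>' (H' n y) - \<psi>' (h' y)) * L y)\<bar> \<le> B * (\<bar>\<psi>' (H' n y) - \<psi>' (h' y)\<bar> * \<bar>L y\<bar>)"
      unfolding abs_mult using w'B[of y] by (intro mult_mono) auto
    moreover have "\<bar>Dw' y * (\<psi> (H' n y) - \<psi> (h' y))\<bar> \<le> C * \<bar>H' n y - h' y\<bar>"
      unfolding abs_mult using w'B[of y] lip by (intro mult_mono) auto
    ultimately have "\<bar>E n y - E0 y\<bar> \<le> B * \<bar>LH n y - L y\<bar> + B * (\<bar>\<psi>' (H' n y) - \<psi>' (h' y)\<bar> * \<bar>L y\<bar>) + C * \<bar>H' n y - h' y\<bar>"
      by linarith
    then have "ennreal \<bar>E n y - E0 y\<bar> \<le> ennreal (B * \<bar>LH n y - L y\<bar> + B * (\<bar>\<psi>' (H' n y) - \<psi>' (h' y)\<bar> * \<bar>L y\<bar>) + C * \<bar>H' n y - h' y\<bar>)"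
      by (rule ennreal_leI)
    then show ?thesis using B C by (simp add: ennreal_mult)
  qed
  have H'0: "(\<lambda>n. \<integral>\<^sup>+y. ennreal \<bar>H' n y - h' y\<bar> \<partial>?U) \<longlonglongrightarrow> 0"
  proof -
    have "(\<integral>\<^sup>+y. ennreal \<bar>H' n y - h' y\<bar> \<partial>?U) = (\<integral>\<^sup>+y. ennreal \<bar>H n y - h y\<bar> \<partial>?U)" for n
      by (rule nn_integral_kac_sphere_cong[OF N1]) (simp add: h'_def H'_def)
    then show ?thesis using H1 by simp
  qed
  have P0: "(\<lambda>n. \<integral>\<^sup>+y. ennreal (\<bar>\<psi>' (H' n y) - \<psi>' (h' y)\<bar> * \<bar>L y\<bar>) \<partial>?U) \<longlonglongrightarrow> (\<integral>\<^sup>+y. 0 \<partial>?U)"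
  proof (rule nn_integral_dominated_convergence[where w = "\<lambda>y. ennreal \<bar>L y\<bar>"])
    show "AE y in ?U. ennreal (\<bar>\<psi>' (H' n y) - \<psi>' (h' y)\<bar> * \<bar>L y\<bar>) \<le> ennreal \<bar>L y\<bar>" for n
    proof (intro AE_I2 ennreal_leI)
      fix y
      have "\<bar>\<psi>' (H' n y) - \<psi>' (h' y)\<bar> \<le> 1" using \<psi>'01[of "H' n y"] \<psi>'01[of "h' y"] by linarith
      then show "\<bar>\<psi>' (H' n y) - \<psi>' (h' y)\<bar> * \<bar>L y\<bar> \<le> \<bar>L y\<bar>" by (simp add: mult_left_le_one_le)
    qed
    show "(\<integral>\<^sup>+y. ennreal \<bar>L y\<bar> \<partial>?U) < \<infinity>"
      using Li by (simp add: integrable_iff_bounded)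
    show "AE y in ?U. (\<lambda>n. ennreal (\<bar>\<psi>' (H' n y) - \<psi>' (h' y)\<bar> * \<bar>L y\<bar>)) \<longlonglongrightarrow> 0"
      using HA AE_uniform_sphere_kac_sphere[OF N1]
    proof eventually_elim
      case (elim y)
      then have "(\<lambda>n. H' n y) \<longlonglongrightarrow> h' y" by (simp add: H'_def h'_def)
      then have "(\<lambda>n. \<psi>' (H' n y)) \<longlonglongrightarrow> \<psi>' (h' y)"
        by (rule continuous_on_tendsto_compose[OF \<psi>'c]) auto
      then have "(\<lambda>n. \<bar>\<psi>' (H' n y) - \<psi>' (h' y)\<bar> * \<bar>L y\<bar>) \<longlonglongrightarrow> \<bar>\<psi>' (h' y) - \<psi>' (h' y)\<bar> * \<bar>L y\<bar>"
        by (intro tendsto_intros)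
      then have "(\<lambda>n. ennreal (\<bar>\<psi>' (H' n y) - \<psi>' (h' y)\<bar> * \<bar>L y\<bar>)) \<longlonglongrightarrow> ennreal (\<bar>\<psi>' (h' y) - \<psi>' (h' y)\<bar> * \<bar>L y\<bar>)"
        by (rule tendsto_ennrealI)
      then show ?case by simp
    qed
  qed measurable
  have "(\<lambda>n. \<integral>y. E n y \<partial>?U) \<longlonglongrightarrow> (\<integral>y. E0 y \<partial>?U)"
  proof (rule tendsto_L1_int)
    show "integrable ?U (E n)" for n unfolding E_def by (rule E_int[OF H'i LHi])
    show "integrable ?U E0" unfolding E0_def by (rule E_int[OF h'i Li])
    have le: "(\<integral>\<^sup>+y. ennreal (norm (E n y - E0 y)) \<partial>?U) \<le> ennreal B * (\<integral>\<^sup>+y. ennreal \<bar>LH n y - L y\<bar> \<partial>?U)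
       + ennreal B * (\<integral>\<^sup>+y. ennreal (\<bar>\<psi>' (H' n y) - \<psi>' (h' y)\<bar> * \<bar>L y\<bar>) \<partial>?U)
       + ennreal C * (\<integral>\<^sup>+y. ennreal \<bar>H' n y - h' y\<bar> \<partial>?U)" for n
    proof -
      have "(\<integral>\<^sup>+y. ennreal (norm (E n y - E0 y)) \<partial>?U) \<le> (\<integral>\<^sup>+y. ennreal B * ennreal \<bar>LH n y - L y\<bar> + ennreal B * ennreal (\<bar>\<psi>' (H' n y) - \<psi>' (h' y)\<bar> * \<bar>L y\<bar>)
      + ennreal C * ennreal \<bar>H' n y - h' y\<bar> \<partial>?U)"
        unfolding real_norm_def by (intro nn_integral_mono bound)
      also have "\<dots> = ennreal B * (\<integral>\<^sup>+y. ennreal \<bar>LH n y - L y\<bar> \<partial>?U)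
       + ennreal B * (\<integral>\<^sup>+y. ennreal (\<bar>\<psi>' (H' n y) - \<psi>' (h' y)\<bar> * \<bar>L y\<bar>) \<partial>?U)
       + ennreal C * (\<integral>\<^sup>+y. ennreal \<bar>H' n y - h' y\<bar> \<partial>?U)"
        by (subst nn_integral_add; (subst nn_integral_add)?; simp add: nn_integral_cmult)
      finally show ?thesis .
    qed
    have "(\<lambda>n. ennreal B * (\<integral>\<^sup>+y. ennreal \<bar>LH n y - L y\<bar> \<partial>?U)
       + ennreal B * (\<integral>\<^sup>+y. ennreal (\<bar>\<psi>' (H' n y) - \<psi>' (h' y)\<bar> * \<bar>L y\<bar>) \<partial>?U)
       + ennreal C * (\<integral>\<^sup>+y. ennreal \<bar>H' n y - h' y\<bar> \<partial>?U)) \<longlonglongrightarrow> ennreal B * 0 + ennreal B * 0 + ennreal C * 0"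
      using P0 by (intro tendsto_add ennreal_tendsto_cmult LL0 H'0) auto
    then show "(\<lambda>n. \<integral>\<^sup>+y. ennreal (norm (E n y - E0 y)) \<partial>?U) \<longlonglongrightarrow> 0"
      by (intro ennreal_tendsto_0_le[OF _ le]) simp
  qed
  moreover have "(\<integral>y. E n y \<partial>?U) = 0" for n
  proof -
    have "E n = (\<lambda>y. indicator ?S y *
      (\<psi>' (H n y) * (y i * sphere_grad N (H n) y j - y j * sphere_grad N (H n) y i) * w y + \<psi> (H n y) * Dw y))"
      by (rule ext) (simp add: E_def H'_def LH_def w'_def Dw'_def indicator_def)
    then show ?thesis using sphere_parts_C1[OF HC[of n] ij \<psi> \<psi>'c w] by simp
  qed
  ultimately have "(\<integral>y. E0 y \<partial>?U) = 0"
    by (simp add: LIMSEQ_const_iff)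
  moreover have "E0 y = indicator ?S y * (\<psi>' (h y) * (y i * g y j - y j * g y i) * w y + \<psi> (h y) * Dw y)" for y
    by (simp add: E0_def h'_def L_def w'_def Dw'_def indicator_def)
  ultimately show "(\<integral>y. indicator ?S y * (\<psi>' (h y) * (y i * g y j - y j * g y i) * w y + \<psi> (h y) * Dw y) \<partial>?U) = 0"
    by simp
qed

lemma norm_mult_le_bound:
  fixes a x B :: real
  assumes "\<bar>a\<bar> \<le> B"
  shows "norm (x * a) \<le> norm (B * x)"
proof -
  have "\<bar>x\<bar> * \<bar>a\<bar> \<le> \<bar>x\<bar> * B" using assms by (intro mult_left_mono) auto
  moreover have "B \<ge> 0" using assms by linarith
  ultimately show ?thesis by (simp add: abs_mult mult.commute)
qed

text \<open>Taking \<open>\<psi> s = s - \<delta> arctan (s / \<delta>)\<close> and letting \<open>\<delta>\<close> tend to \<open>0\<close> shows that the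
  weak gradient does not charge the set where \<open>h\<close> vanishes.\<close>
lemma sphere_parts_weak_support:
  assumes weak: "has_weak_sphere_grad N h g" and hm: "h \<in> borel_measurable (Rn N)"
    and hi: "integrable (uniform_sphere N) h" and ij: "i < N" "j < N" "i \<noteq> j"
    and w: "rot_deriv N i j w Dw" "continuous_on (kac_sphere N) w" "continuous_on (kac_sphere N) Dw"
  shows "integrable (uniform_sphere N) (\<lambda>y. indicator (kac_sphere N) y * (of_bool (h y \<noteq> 0) * (y i * g y j - y j * g y i) * w y))"
    and "integrable (uniform_sphere N) (\<lambda>y. indicator (kac_sphere N) y * (h y * Dw y))"
    and "(\<integral>y. indicator (kac_sphere N) y * (of_bool (h y \<noteq> 0) * (y i * g y j - y j * g y i) * w y) \<partial>uniform_sphere N)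
      = - (\<integral>y. indicator (kac_sphere N) y * (h y * Dw y) \<partial>uniform_sphere N)"
proof -
  let ?S = "kac_sphere N" and ?U = "uniform_sphere N"
  have [measurable]: "(\<lambda>y. g y l) \<in> borel_measurable (Rn N)" if "l < N" for l
    using weak that by (auto simp: has_weak_sphere_grad_def)
  note [measurable] = hm
  define \<delta> :: "nat \<Rightarrow> real" where "\<delta> n = 1 / real (Suc n)" for n
  have \<delta>: "\<delta> n > 0" for n by (simp add: \<delta>_def)
  have \<delta>0: "\<delta> \<longlonglongrightarrow> 0"
    unfolding \<delta>_def using LIMSEQ_inverse_real_of_nat by (simp add: inverse_eq_divide)
  define \<psi> where "\<psi> n s = s - \<delta> n * arctan (s / \<delta> n)" for n s
  \<comment> \<open>This equals s^2 / (s^2 + \<delta>^2): between 0 and 1, zero at s = 0, and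
    tending to 1 elsewhere, so that the indicator of {h \<noteq> 0} appears in the limit.\<close>
  define \<psi>' where "\<psi>' n s = 1 - 1 / (1 + (s / \<delta> n)\<^sup>2)" for n s
  have pos: "1 + (s / \<delta> n)\<^sup>2 > 0" for s n by (simp add: add_pos_nonneg)
  have \<psi>: "(\<psi> n has_real_derivative \<psi>' n s) (at s)" for n s
    unfolding \<psi>_def \<psi>'_def using \<delta>[of n]
    by (auto intro!: derivative_eq_intros simp: inverse_eq_divide)
  have \<psi>'c: "continuous_on UNIV (\<psi>' n)" for n
  proof -
    have "\<forall>s\<in>UNIV. 1 + (s / \<delta> n)\<^sup>2 \<noteq> 0" using pos by (metis less_irrefl)
    then show ?thesis unfolding \<psi>'_def using \<delta>[of n] by (intro continuous_intros) auto
  qed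
  have \<psi>'01: "0 \<le> \<psi>' n s" "\<psi>' n s \<le> 1" for n s
    using pos[of s n] by (auto simp: \<psi>'_def divide_le_eq)
  have \<psi>le: "\<bar>\<psi> n s\<bar> \<le> \<bar>s\<bar>" for n s
    using field_differentiable_bound[of UNIV "\<psi> n" "\<psi>' n" 1 s 0] \<psi> \<psi>'01 by (auto simp: abs_le_iff \<psi>_def)
  have [measurable]: "\<psi> n \<in> borel_measurable borel" "\<psi>' n \<in> borel_measurable borel" for n
    unfolding \<psi>_def[abs_def] \<psi>'_def[abs_def] by measurable
  define L where "L y = indicator ?S y * (y i * g y j - y j * g y i)" for y
  have [measurable]: "L \<in> borel_measurable (Rn N)" unfolding L_def using ij by measurable
  have Li: "integrable ?U L"
    unfolding L_def by (rule sphere_parts_weak(1)[OF weak hm hi ij \<psi>[of 0] \<psi>'c[of 0] \<psi>'01[of 0] w])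
  obtain B where B: "\<And>y. y \<in> ?S \<Longrightarrow> \<bar>w y\<bar> \<le> B" "B \<ge> 0"
    using bounded_on_kac_sphere[OF w(2)] by blast
  obtain C where C: "\<And>y. y \<in> ?S \<Longrightarrow> \<bar>Dw y\<bar> \<le> C" "C \<ge> 0"
    using bounded_on_kac_sphere[OF w(3)] by blast
  define w' where "w' y = indicator ?S y * w y" for y
  define Dw' where "Dw' y = indicator ?S y * Dw y" for y
  have [measurable]: "w' \<in> borel_measurable (Rn N)" "Dw' \<in> borel_measurable (Rn N)"
    unfolding w'_def Dw'_def using borel_measurable_indicator_kac_sphere w by auto
  have w'B: "\<bar>w' y\<bar> \<le> B" "\<bar>Dw' y\<bar> \<le> C" for y
    using B C by (auto simp: w'_def Dw'_def indicator_def)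
  define E1 where "E1 y = of_bool (h y \<noteq> 0) * L y * w' y" for y
  define E2 where "E2 y = h y * Dw' y" for y
  have E1i: "integrable ?U E1"
  proof (rule Bochner_Integration.integrable_bound)
    show "integrable ?U (\<lambda>y. B * L y)" using Li by simp
    show "AE y in ?U. norm (E1 y) \<le> norm (B * L y)"
      using norm_mult_le_bound[OF w'B(1)] by (intro AE_I2) (auto simp: E1_def)
  qed (simp add: E1_def[abs_def])
  have E2i: "integrable ?U E2"
  proof (rule Bochner_Integration.integrable_bound)
    show "integrable ?U (\<lambda>y. C * h y)" using hi by simp
    show "AE y in ?U. norm (E2 y) \<le> norm (C * h y)"
      unfolding E2_def by (intro AE_I2 norm_mult_le_bound w'B)
  qed (simp add: E2_def[abs_def])
  have E1eq: "E1 = (\<lambda>y. indicator ?S y * (of_bool (h y \<noteq> 0) * (y i * g y j - y j * g y i) * w y))"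
    by (auto simp: fun_eq_iff E1_def L_def w'_def indicator_def)
  have E2eq: "E2 = (\<lambda>y. indicator ?S y * (h y * Dw y))"
    by (auto simp: fun_eq_iff E2_def Dw'_def)
  define E where "E n y = \<psi>' n (h y) * L y * w' y + \<psi> n (h y) * Dw' y" for n y
  have "(\<lambda>n. \<integral>y. E n y \<partial>?U) \<longlonglongrightarrow> (\<integral>y. E1 y + E2 y \<partial>?U)"
  proof (rule integral_dominated_convergence[where w = "\<lambda>y. B * \<bar>L y\<bar> + C * \<bar>h y\<bar>"])
    show "integrable ?U (\<lambda>y. B * \<bar>L y\<bar> + C * \<bar>h y\<bar>)" using Li hi by simp
    show "AE y in ?U. norm (E n y) \<le> B * \<bar>L y\<bar> + C * \<bar>h y\<bar>" for n
    proof (rule AE_I2)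
      fix y
      have "\<bar>\<psi>' n (h y) * L y * w' y\<bar> \<le> 1 * \<bar>L y\<bar> * B"
        unfolding abs_mult using \<psi>'01[of n "h y"] w'B[of y] by (intro mult_mono) auto
      moreover have "\<bar>\<psi> n (h y) * Dw' y\<bar> \<le> \<bar>h y\<bar> * C"
        unfolding abs_mult using \<psi>le w'B[of y] by (intro mult_mono) auto
      ultimately show "norm (E n y) \<le> B * \<bar>L y\<bar> + C * \<bar>h y\<bar>"
        unfolding E_def real_norm_def by (smt (verit) mult.commute)
    qed
    show "AE y in ?U. (\<lambda>n. E n y) \<longlonglongrightarrow> E1 y + E2 y"
    proof (rule AE_I2)
      fix y
      have "(\<lambda>n. \<delta> n * arctan (h y / \<delta> n)) \<longlonglongrightarrow> 0"
      proof (rule Lim_null_comparison)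
        show "(\<lambda>n. \<delta> n * (pi / 2)) \<longlonglongrightarrow> 0" by (rule tendsto_mult_left_zero[OF \<delta>0])
        show "\<forall>\<^sub>F n in sequentially. norm (\<delta> n * arctan (h y / \<delta> n)) \<le> \<delta> n * (pi / 2)"
        proof (intro always_eventually allI)
          fix n
          have "\<bar>arctan (h y / \<delta> n)\<bar> \<le> pi / 2"
            using arctan_bounded[of "h y / \<delta> n"] by linarith
          then show "norm (\<delta> n * arctan (h y / \<delta> n)) \<le> \<delta> n * (pi / 2)"
            unfolding real_norm_def abs_mult using \<delta>[of n] by (intro mult_mono) auto
        qed
      qed
      from tendsto_diff[OF tendsto_const[of "h y"] this]
      have 1: "(\<lambda>n. \<psi> n (h y)) \<longlonglongrightarrow> h y" by (simp add: \<psi>_def)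
      have 2: "(\<lambda>n. \<psi>' n (h y)) \<longlonglongrightarrow> of_bool (h y \<noteq> 0)"
      proof (cases "h y = 0")
        case False
        have "1 / (1 + (h y / \<delta> n)\<^sup>2) = (\<delta> n)\<^sup>2 / ((\<delta> n)\<^sup>2 + (h y)\<^sup>2)" for n
          using \<delta>[of n] by (simp add: power_divide field_simps)
        moreover have "(\<lambda>n. (\<delta> n)\<^sup>2 / ((\<delta> n)\<^sup>2 + (h y)\<^sup>2)) \<longlonglongrightarrow> 0\<^sup>2 / (0\<^sup>2 + (h y)\<^sup>2)"
          using False by (intro tendsto_intros \<delta>0) auto
        ultimately have "(\<lambda>n. 1 / (1 + (h y / \<delta> n)\<^sup>2)) \<longlonglongrightarrow> 0" by simp
        from tendsto_diff[OF tendsto_const[of 1] this] show ?thesis using False by (simp add: \<psi>'_def)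
      qed (simp add: \<psi>'_def)
      show "(\<lambda>n. E n y) \<longlonglongrightarrow> E1 y + E2 y"
        unfolding E_def E1_def E2_def by (intro tendsto_intros 1 2)
    qed
  qed (simp_all add: E_def[abs_def] E1_def[abs_def] E2_def[abs_def])
  moreover have "(\<integral>y. E n y \<partial>?U) = 0" for n
  proof -
    have "E n y = indicator ?S y * (\<psi>' n (h y) * (y i * g y j - y j * g y i) * w y + \<psi> n (h y) * Dw y)" for y
      by (simp add: E_def L_def w'_def Dw'_def indicator_def)
    then show ?thesis using sphere_parts_weak(2)[OF weak hm hi ij \<psi>[of n] \<psi>'c[of n] \<psi>'01[of n] w] by simp
  qed
  ultimately have "(\<integral>y. E1 y + E2 y \<partial>?U) = 0"
    by (simp add: LIMSEQ_const_iff)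
  then have "(\<integral>y. E1 y \<partial>?U) + (\<integral>y. E2 y \<partial>?U) = 0"
    using E1i E2i by simp
  then have "(\<integral>y. E1 y \<partial>?U) = - (\<integral>y. E2 y \<partial>?U)" by linarith
  then show "(\<integral>y. indicator ?S y * (of_bool (h y \<noteq> 0) * (y i * g y j - y j * g y i) * w y) \<partial>?U)
      = - (\<integral>y. indicator ?S y * (h y * Dw y) \<partial>?U)"
    unfolding E1eq E2eq .
  show "integrable ?U (\<lambda>y. indicator ?S y * (of_bool (h y \<noteq> 0) * (y i * g y j - y j * g y i) * w y))"
    using E1i unfolding E1eq .
  show "integrable ?U (\<lambda>y. indicator ?S y * (h y * Dw y))"
    using E2i unfolding E2eq .
qed

section \<open>The duality lower bound for the spherical Fisher information\<close>

lemma rot_deriv_wedge: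
  assumes ij: "i \<noteq> j" and \<phi>: "\<And>s. (\<phi> has_real_derivative \<phi>' s) (at s)"
  shows "rot_deriv N i j (\<lambda>y. y i * \<phi> (y j) - y j * \<phi> (y i))
    (\<lambda>y. (y i)\<^sup>2 * \<phi>' (y j) + (y j)\<^sup>2 * \<phi>' (y i) - y i * \<phi> (y i) - y j * \<phi> (y j))"
  unfolding rot_deriv_def
proof
  fix y :: "nat \<Rightarrow> real"
  have a: "((\<lambda>t. cos t * y i - sin t * y j) has_real_derivative (- y j)) (at 0)"
    by (auto intro!: derivative_eq_intros)
  have b: "((\<lambda>t. sin t * y i + cos t * y j) has_real_derivative y i) (at 0)"
    by (auto intro!: derivative_eq_intros)
  have c: "((\<lambda>t. \<phi> (sin t * y i + cos t * y j)) has_real_derivative (\<phi>' (sin 0 * y i + cos 0 * y j) * y i)) (at 0)"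
    by (rule DERIV_chain2[OF \<phi> b])
  have d: "((\<lambda>t. \<phi> (cos t * y i - sin t * y j)) has_real_derivative (\<phi>' (cos 0 * y i - sin 0 * y j) * (- y j))) (at 0)"
    by (rule DERIV_chain2[OF \<phi> a])
  show "((\<lambda>t. plane_rot i j t y i * \<phi> (plane_rot i j t y j) - plane_rot i j t y j * \<phi> (plane_rot i j t y i))
      has_real_derivative ((y i)\<^sup>2 * \<phi>' (y j) + (y j)\<^sup>2 * \<phi>' (y i) - y i * \<phi> (y i) - y j * \<phi> (y j))) (at 0)"
    unfolding plane_rot_eval(1,2)[OF ij]
    by (rule DERIV_cong[OF DERIV_diff[OF DERIV_mult[OF a c] DERIV_mult[OF b d]]])
       (simp add: power2_eq_square algebra_simps)
qed

lemma ennreal_integral_le_nn_integral: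
  fixes f :: "'a \<Rightarrow> real"
  assumes "integrable M f"
  shows "ennreal (\<integral>x. f x \<partial>M) \<le> (\<integral>\<^sup>+x. ennreal (f x) \<partial>M)"
proof -
  have "(\<integral>x. f x \<partial>M) \<le> (\<integral>x. max 0 (f x) \<partial>M)"
    using assms by (intro integral_mono) auto
  then have "ennreal (\<integral>x. f x \<partial>M) \<le> ennreal (\<integral>x. max 0 (f x) \<partial>M)" by (rule ennreal_leI)
  also have "\<dots> = (\<integral>\<^sup>+x. ennreal (max 0 (f x)) \<partial>M)"
    using assms by (subst nn_integral_eq_integral) auto
  also have "\<dots> = (\<integral>\<^sup>+x. ennreal (f x) \<partial>M)"
    by (intro nn_integral_cong) (simp add: max_def ennreal_neg)
  finally show ?thesis .
qed

text \<open>Minus twice the share of one coordinate in the spherical divergence of the tangential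
  part of (\<phi>(y_1), ..., \<phi>(y_N)), minus \<phi>^2. For N to infinity it becomes - 2 (\<phi>'
  - t \<phi>) - \<phi>^2, the integrand of the Gaussian variational formula once h' has been
  integrated by parts.\<close>

definition fisher_test :: "nat \<Rightarrow> (real \<Rightarrow> real) \<Rightarrow> (real \<Rightarrow> real) \<Rightarrow> real \<Rightarrow> real" where
  "fisher_test N \<phi> \<phi>' t = - 2 * ((1 - t\<^sup>2 / real N) * \<phi>' t - (1 - 1 / real N) * (t * \<phi> t)) - (\<phi> t)\<^sup>2"

text \<open>Rotations exist for i \<noteq> j only, whereas the formula \<open>D i j\<close> does not
  vanish on the diagonal. Removing the diagonal from the full double sum, which is evaluated by
  |y|^2 = N, creates the 1/N corrections in \<open>fisher_test\<close>.\<close>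

lemma sum_fisher_test:
  assumes y: "y \<in> kac_sphere N" and N: "N \<ge> 1"
  shows "(\<Sum>j<N. fisher_test N \<phi> \<phi>' (y j)) =
    - (1 / real N) * (\<Sum>i<N. \<Sum>j<N. if i = j then 0 else
        (y i)\<^sup>2 * \<phi>' (y j) + (y j)\<^sup>2 * \<phi>' (y i) - y i * \<phi> (y i) - y j * \<phi> (y j)) - (\<Sum>i<N. (\<phi> (y i))\<^sup>2)"
proof -
  define D where "D i j = (y i)\<^sup>2 * \<phi>' (y j) + (y j)\<^sup>2 * \<phi>' (y i) - y i * \<phi> (y i) - y j * \<phi> (y j)" for i j
  define P where "P = (\<Sum>j<N. \<phi>' (y j))"
  define Q where "Q = (\<Sum>j<N. y j * \<phi> (y j))"
  define R where "R = (\<Sum>j<N. (y j)\<^sup>2 * \<phi>' (y j))"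
  have S: "(\<Sum>i<N. (y i)\<^sup>2) = real N" using y by (simp add: kac_sphere_def)
  have "(\<Sum>i<N. \<Sum>j<N. if i = j then 0 else D i j) = (\<Sum>i<N. (\<Sum>j<N. D i j) - D i i)"
  proof (intro sum.cong refl)
    fix i assume "i \<in> {..<N}"
    then have "(\<Sum>j<N. if i = j then 0 else D i j) = (\<Sum>j\<in>{..<N}-{i}. if i = j then 0 else D i j)"
      by (subst sum.remove[of _ i]) auto
    also have "\<dots> = (\<Sum>j\<in>{..<N}-{i}. D i j)" by (intro sum.cong) auto
    also have "\<dots> = (\<Sum>j<N. D i j) - D i i"
      using \<open>i \<in> {..<N}\<close> by (subst (2) sum.remove[of _ i]) auto
    finally show "(\<Sum>j<N. if i = j then 0 else D i j) = (\<Sum>j<N. D i j) - D i i" .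
  qed
  also have "\<dots> = (\<Sum>i<N. \<Sum>j<N. D i j) - (\<Sum>i<N. D i i)" by (simp add: sum_subtractf)
  also have "(\<Sum>i<N. \<Sum>j<N. D i j) = real N * P + real N * P - real N * Q - real N * Q"
    unfolding D_def sum.distrib sum_subtractf
    by (simp add: sum_distrib_left[symmetric] sum_distrib_right[symmetric] S P_def Q_def)
  also have "(\<Sum>i<N. D i i) = 2 * R - 2 * Q"
  proof -
    have "(\<Sum>i<N. D i i) = (\<Sum>i<N. 2 * ((y i)\<^sup>2 * \<phi>' (y i)) - 2 * (y i * \<phi> (y i)))"
      by (intro sum.cong) (auto simp: D_def)
    then show ?thesis unfolding sum_subtractf sum_distrib_left[symmetric] R_def Q_def .
  qed
  finally have 1: "(\<Sum>i<N. \<Sum>j<N. if i = j then 0 else D i j) = 2 * (real N * P) - 2 * (real N * Q) - (2 * R - 2 * Q)"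
    by simp
  have "(\<Sum>j<N. fisher_test N \<phi> \<phi>' (y j)) = (\<Sum>j<N. - 2 * \<phi>' (y j) + (2 / real N) * ((y j)\<^sup>2 * \<phi>' (y j))
     + (2 * (1 - 1 / real N)) * (y j * \<phi> (y j)) - (\<phi> (y j))\<^sup>2)"
    by (intro sum.cong) (auto simp: fisher_test_def algebra_simps)
  also have "\<dots> = - 2 * P + (2 / real N) * R + (2 * (1 - 1 / real N)) * Q - (\<Sum>i<N. (\<phi> (y i))\<^sup>2)"
    unfolding sum.distrib sum_subtractf sum_distrib_left[symmetric] P_def Q_def R_def ..
  also have "- 2 * P + (2 / real N) * R + (2 * (1 - 1 / real N)) * Q =
      - (1 / real N) * (2 * (real N * P) - 2 * (real N * Q) - (2 * R - 2 * Q))"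
    using N by (simp add: field_simps)
  finally show ?thesis unfolding 1[symmetric] D_def .
qed

text \<open>Duality: \<open>\<bar>v\<bar>\<^sup>2 / h \<ge> 2 v \<cdot> \<Phi> - h \<bar>\<Phi>\<bar>\<^sup>2\<close> is tested with the tangential part \<open>\<Phi>\<close> of
  the vector field with components \<open>\<phi> (y i)\<close>.\<close>
lemma fisher_pointwise:
  assumes y: "y \<in> kac_sphere N" and N: "N \<ge> 1" and h: "h > 0"
  shows "(1 / real N) * (\<Sum>i<N. \<Sum>j<N. (y i * v j - y j * v i) * (y i * a j - y j * a i)) - h * (\<Sum>i<N. (a i)\<^sup>2)
    \<le> (L2_set v {..<N})\<^sup>2 / h"
proof -
  define \<Phi> where "\<Phi> = tang N y a"
  \<comment> \<open>Projection shortens the field; using its Euclidean length instead keeps the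
    quadratic term a sum of functions of one coordinate each.\<close>
  have \<Phi>: "(\<Sum>i<N. (\<Phi> i)\<^sup>2) \<le> (\<Sum>i<N. (a i)\<^sup>2)"
    using power_mono[OF L2_set_tang_le[OF y N, of a] L2_set_nonneg, of 2] by (simp add: L2_set_sq \<Phi>_def)
  have orth: "(\<Sum>i<N. y i * \<Phi> i) = 0"
    using tang_orthogonal[OF y, of a] by (simp add: \<Phi>_def mult.commute)
  have "(\<Sum>i<N. \<Sum>j<N. (y i * v j - y j * v i) * (y i * a j - y j * a i)) =
     (\<Sum>i<N. \<Sum>j<N. (y i * v j - y j * v i) * (y i * \<Phi> j - y j * \<Phi> i))"
    by (intro sum.cong refl) (simp add: \<Phi>_def tang_wedge)
  also have "\<dots> = 2 * (real N * (\<Sum>i<N. v i * \<Phi> i))"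
    unfolding lagrange_identity orth using y by (simp add: kac_sphere_def)
  finally have 1: "(1 / real N) * (\<Sum>i<N. \<Sum>j<N. (y i * v j - y j * v i) * (y i * a j - y j * a i)) = (\<Sum>i<N. 2 * (v i * \<Phi> i))"
    using N by (simp add: sum_distrib_left)
  have "(\<Sum>i<N. 2 * (v i * \<Phi> i)) \<le> (\<Sum>i<N. (v i)\<^sup>2 / h + h * (\<Phi> i)\<^sup>2)"
  proof (rule sum_mono)
    fix i
    have "0 \<le> (v i - h * \<Phi> i)\<^sup>2 / h" using h by simp
    also have "\<dots> = (v i)\<^sup>2 / h + h * (\<Phi> i)\<^sup>2 - 2 * (v i * \<Phi> i)"
      using h by (simp add: power2_eq_square field_simps)
    finally show "2 * (v i * \<Phi> i) \<le> (v i)\<^sup>2 / h + h * (\<Phi> i)\<^sup>2" by simp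
  qed
  also have "\<dots> = (\<Sum>i<N. (v i)\<^sup>2) / h + h * (\<Sum>i<N. (\<Phi> i)\<^sup>2)"
    by (simp add: sum.distrib sum_divide_distrib sum_distrib_left)
  also have "\<dots> \<le> (\<Sum>i<N. (v i)\<^sup>2) / h + h * (\<Sum>i<N. (a i)\<^sup>2)"
    using \<Phi> h by simp
  finally show ?thesis unfolding 1 L2_set_sq by simp
qed

text \<open>Any admissible pair is tested. After the pointwise inequality the gradient enters
  linearly, so integration by parts removes it and leaves an integral against F, which no longer
  depends on the pair.\<close>

lemma sphere_fisher_lower:
  assumes N: "N \<ge> 1" and F: "prob_space F"
    and \<phi>: "\<And>s. (\<phi> has_real_derivative \<phi>' s) (at s)" and \<phi>'c: "continuous_on UNIV \<phi>'"
  shows "ennreal (\<integral>y. indicator (kac_sphere N) y * (\<Sum>j<N. fisher_test N \<phi> \<phi>' (y j)) \<partial>F) \<le> sphere_fisher N F"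
  unfolding sphere_fisher_def
proof (rule Inf_greatest)
  let ?S = "kac_sphere N" and ?U = "uniform_sphere N"
  fix v assume "v \<in> {(\<integral>\<^sup>+y. ennreal ((L2_set (g y) {..<N})\<^sup>2 / h y) \<partial>?U) | h g.
      h \<in> borel_measurable (Rn N) \<and> (\<forall>y. 0 \<le> h y) \<and> has_weak_sphere_grad N h g \<and>
      F = density ?U (\<lambda>y. ennreal (h y))}"
  then obtain h g where hm [measurable]: "h \<in> borel_measurable (Rn N)" and h0: "\<forall>y. 0 \<le> h y"
    and weak: "has_weak_sphere_grad N h g" and Fh: "F = density ?U (\<lambda>y. ennreal (h y))"
    and v: "v = (\<integral>\<^sup>+y. ennreal ((L2_set (g y) {..<N})\<^sup>2 / h y) \<partial>?U)" by blast
  have [measurable]: "(\<lambda>y. g y l) \<in> borel_measurable (Rn N)" if "l < N" for l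
    using weak that by (auto simp: has_weak_sphere_grad_def)
  interpret F: prob_space F by (rule F)
  have "(\<integral>\<^sup>+y. ennreal (h y) \<partial>?U) = emeasure F (space F)"
    unfolding Fh using sets.top[of "Rn N"]
    by (subst emeasure_density) (auto intro!: nn_integral_cong)
  then have h1: "(\<integral>\<^sup>+y. ennreal (h y) \<partial>?U) = 1" using F.emeasure_space_1 by simp
  have hi: "integrable ?U h"
    using h0 h1 by (intro integrableI_nonneg) auto
  have \<phi>c: "continuous_on UNIV \<phi>"
    using \<phi> by (intro DERIV_continuous_on) (auto intro: has_field_derivative_at_within)
  have \<phi>S: "continuous_on ?S (\<lambda>y. \<phi> (y i))" "continuous_on ?S (\<lambda>y. \<phi>' (y i))" for i
    by (auto intro: continuous_on_compose2[OF \<phi>c continuous_on_coord] continuous_on_compose2[OF \<phi>'c continuous_on_coord])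
  define W where "W i j y = y i * \<phi> (y j) - y j * \<phi> (y i)" for i j and y :: "nat \<Rightarrow> real"
  define D where "D i j y = (y i)\<^sup>2 * \<phi>' (y j) + (y j)\<^sup>2 * \<phi>' (y i) - y i * \<phi> (y i) - y j * \<phi> (y j)" for i j and y :: "nat \<Rightarrow> real"
  \<comment> \<open>\<open>a\<close> is the gradient term and \<open>b\<close> what integration by
    parts makes of it, up to sign. On the diagonal \<open>a\<close> vanishes by itself, while
    \<open>b\<close> has to be set to 0.\<close>
  define a where "a i j y = indicator ?S y * (of_bool (h y \<noteq> 0) * (y i * g y j - y j * g y i) * W i j y)" for i j y
  define b where "b i j y = (if i = j then 0 else indicator ?S y * (h y * D i j y))" for i j y
  have ab: "integrable ?U (a i j) \<and> integrable ?U (b i j) \<and> (\<integral>y. a i j y \<partial>?U) = - (\<integral>y. b i j y \<partial>?U)"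
    if ij: "i < N" "j < N" for i j
  proof (cases "i = j")
    case False
    have W: "rot_deriv N i j (W i j) (D i j)" "continuous_on ?S (W i j)" "continuous_on ?S (D i j)"
      unfolding W_def D_def using rot_deriv_wedge[OF False \<phi>] \<phi>S by (auto intro!: continuous_intros)
    show ?thesis
      using sphere_parts_weak_support[OF weak hm hi ij False W] False by (simp add: a_def[abs_def] b_def[abs_def])
  qed (simp add: a_def[abs_def] b_def[abs_def])
  define s where "s y = indicator ?S y * (h y * (\<Sum>i<N. (\<phi> (y i))\<^sup>2))" for y
  have bdd: "integrable ?U (\<lambda>y. indicator ?S y * (h y * c y))" if c: "continuous_on ?S c" for c
  proof -
    obtain B where B: "\<And>y. y \<in> ?S \<Longrightarrow> \<bar>c y\<bar> \<le> B" "B \<ge> 0"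
      using bounded_on_kac_sphere[OF c] by blast
    have "integrable ?U (\<lambda>y. h y * (indicator ?S y * c y))"
    proof (rule Bochner_Integration.integrable_bound)
      show "integrable ?U (\<lambda>y. B * h y)" using hi by simp
      show "AE y in ?U. norm (h y * (indicator ?S y * c y)) \<le> norm (B * h y)"
        using B by (intro AE_I2 norm_mult_le_bound) (auto simp: indicator_def)
      have [measurable]: "(\<lambda>y. indicator ?S y * c y) \<in> borel_measurable (Rn N)"
        by (rule borel_measurable_indicator_kac_sphere[OF c])
      show "(\<lambda>y. h y * (indicator ?S y * c y)) \<in> borel_measurable ?U" by measurable
    qed
    then show ?thesis by (simp add: mult.left_commute)
  qed
  have si: "integrable ?U s" unfolding s_def by (intro bdd continuous_intros \<phi>S)
  define P where "P y = (1 / real N) * (\<Sum>i<N. \<Sum>j<N. a i j y) - s y" for y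
  have Pi: "integrable ?U P"
    unfolding P_def using ab si by (intro Bochner_Integration.integrable_diff integrable_mult_right Bochner_Integration.integrable_sum) auto
  have P_eq: "(\<integral>y. P y \<partial>?U) = (\<integral>y. - (1 / real N) * (\<Sum>i<N. \<Sum>j<N. b i j y) - s y \<partial>?U)"
  proof -
    have dsum: "integrable ?U (\<lambda>y. \<Sum>i<N. \<Sum>j<N. f i j y)"
       "(\<integral>y. (\<Sum>i<N. \<Sum>j<N. f i j y) \<partial>?U) = (\<Sum>i<N. \<Sum>j<N. \<integral>y. f i j y \<partial>?U)"
      if f: "\<And>i j. i < N \<Longrightarrow> j < N \<Longrightarrow> integrable ?U (f i j)" for f :: "nat \<Rightarrow> nat \<Rightarrow> (nat \<Rightarrow> real) \<Rightarrow> real"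
    proof -
      show "integrable ?U (\<lambda>y. \<Sum>i<N. \<Sum>j<N. f i j y)"
        using f by (intro Bochner_Integration.integrable_sum) auto
      have "(\<integral>y. (\<Sum>i<N. \<Sum>j<N. f i j y) \<partial>?U) = (\<Sum>i<N. \<integral>y. (\<Sum>j<N. f i j y) \<partial>?U)"
        using f by (intro Bochner_Integration.integral_sum Bochner_Integration.integrable_sum) auto
      also have "\<dots> = (\<Sum>i<N. \<Sum>j<N. \<integral>y. f i j y \<partial>?U)"
        using f by (intro sum.cong refl Bochner_Integration.integral_sum) auto
      finally show "(\<integral>y. (\<Sum>i<N. \<Sum>j<N. f i j y) \<partial>?U) = (\<Sum>i<N. \<Sum>j<N. \<integral>y. f i j y \<partial>?U)" .
    qed
    have ai: "\<And>i j. i < N \<Longrightarrow> j < N \<Longrightarrow> integrable ?U (a i j)"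
      and bi: "\<And>i j. i < N \<Longrightarrow> j < N \<Longrightarrow> integrable ?U (b i j)" using ab by blast+
    define A where "A y = (\<Sum>i<N. \<Sum>j<N. a i j y)" for y
    define B where "B y = (\<Sum>i<N. \<Sum>j<N. b i j y)" for y
    have A: "integrable ?U A" and B: "integrable ?U B"
      unfolding A_def B_def by (rule dsum(1)[OF ai], assumption+, rule dsum(1)[OF bi])
    have AB: "(\<integral>y. A y \<partial>?U) = - (\<integral>y. B y \<partial>?U)"
    proof -
      have "(\<integral>y. A y \<partial>?U) = (\<Sum>i<N. \<Sum>j<N. \<integral>y. a i j y \<partial>?U)"
        unfolding A_def by (rule dsum(2)) (rule ai)
      moreover have "(\<integral>y. B y \<partial>?U) = (\<Sum>i<N. \<Sum>j<N. \<integral>y. b i j y \<partial>?U)"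
        unfolding B_def by (rule dsum(2)) (rule bi)
      ultimately show ?thesis using ab by (simp add: sum_negf[symmetric])
    qed
    have "(\<integral>y. P y \<partial>?U) = (1 / real N) * (\<integral>y. A y \<partial>?U) - (\<integral>y. s y \<partial>?U)"
      unfolding P_def A_def[symmetric] using A si by simp
    also have "\<dots> = - (1 / real N) * (\<integral>y. B y \<partial>?U) - (\<integral>y. s y \<partial>?U)"
      unfolding AB by simp
    also have "\<dots> = (\<integral>y. - (1 / real N) * B y - s y \<partial>?U)"
      using B si by simp
    finally show ?thesis unfolding B_def .
  qed
  have "- (1 / real N) * (\<Sum>i<N. \<Sum>j<N. b i j y) - s y = h y * (indicator ?S y * (\<Sum>j<N. fisher_test N \<phi> \<phi>' (y j)))" for y
  proof (cases "y \<in> ?S")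
    case True
    have b1: "(\<Sum>i<N. \<Sum>j<N. b i j y) = h y * (\<Sum>i<N. \<Sum>j<N. if i = j then 0 else D i j y)"
      using True by (simp add: b_def sum_distrib_left if_distrib cong: if_cong)
    have ft: "(\<Sum>j<N. fisher_test N \<phi> \<phi>' (y j)) =
      - (1 / real N) * (\<Sum>i<N. \<Sum>j<N. if i = j then 0 else D i j y) - (\<Sum>i<N. (\<phi> (y i))\<^sup>2)"
      unfolding D_def by (rule sum_fisher_test[OF True N])
    show ?thesis
      unfolding b1 ft s_def using True by (simp add: right_diff_distrib)
  next
    case False
    then have "b i j y = 0" for i j by (simp add: b_def)
    then show ?thesis using False by (simp add: s_def)
  qed
  then have "(\<integral>y. P y \<partial>?U) = (\<integral>y. h y * (indicator ?S y * (\<Sum>j<N. fisher_test N \<phi> \<phi>' (y j))) \<partial>?U)"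
    unfolding P_eq by simp
  also have "\<dots> = (\<integral>y. indicator ?S y * (\<Sum>j<N. fisher_test N \<phi> \<phi>' (y j)) \<partial>F)"
  proof -
    have "continuous_on ?S (\<lambda>y. \<Sum>j<N. fisher_test N \<phi> \<phi>' (y j))"
      unfolding fisher_test_def using N by (intro continuous_intros \<phi>S) auto
    then have [measurable]: "(\<lambda>y. indicator ?S y * (\<Sum>j<N. fisher_test N \<phi> \<phi>' (y j))) \<in> borel_measurable (Rn N)"
      by (rule borel_measurable_indicator_kac_sphere)
    show ?thesis unfolding Fh using h0 by (subst integral_density) auto
  qed
  finally have "ennreal (\<integral>y. indicator ?S y * (\<Sum>j<N. fisher_test N \<phi> \<phi>' (y j)) \<partial>F) = ennreal (\<integral>y. P y \<partial>?U)" by simp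
  also have "\<dots> \<le> (\<integral>\<^sup>+y. ennreal (P y) \<partial>?U)" by (rule ennreal_integral_le_nn_integral[OF Pi])
  also have "\<dots> \<le> (\<integral>\<^sup>+y. ennreal ((L2_set (g y) {..<N})\<^sup>2 / h y) \<partial>?U)"
  proof (intro nn_integral_mono ennreal_leI)
    fix y
    show "P y \<le> (L2_set (g y) {..<N})\<^sup>2 / h y"
    proof (cases "y \<in> ?S \<and> h y \<noteq> 0")
      case True
      then have "h y > 0" using h0 by (simp add: less_le)
      then show ?thesis
        using True fisher_pointwise[of y N "h y" "g y" "\<lambda>i. \<phi> (y i)"] N by (simp add: P_def a_def s_def W_def)
    next
      \<comment> \<open>Where h = 0 the right side is 0 by the convention for division, while the
        gradient may be nonzero; the factor \<open>of_bool\<close> in \<open>a\<close> is what makes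
        \<open>P\<close> vanish there.\<close>
      case False
      then have "a i j y = 0" for i j by (auto simp: a_def)
      moreover have "s y = 0" using False by (auto simp: s_def)
      ultimately have "P y = 0" by (simp add: P_def)
      then show ?thesis using h0 by simp
    qed
  qed
  finally show "ennreal (\<integral>y. indicator ?S y * (\<Sum>j<N. fisher_test N \<phi> \<phi>' (y j)) \<partial>F) \<le> v"
    unfolding v .
qed

subsection \<open>Conditioning on the direction\<close>

text \<open>Dominated convergence for the difference quotients, which the mean value theorem bounds
  by \<open>B\<close>.\<close>

lemma has_real_derivative_integral:
  fixes f f' :: "real \<Rightarrow> 'a \<Rightarrow> real"
  assumes int: "\<And>t. integrable M (f t)"
    and d: "\<And>t x. x \<in> space M \<Longrightarrow> ((\<lambda>t. f t x) has_real_derivative f' t x) (at t)"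
    and m: "f' t0 \<in> borel_measurable M"
    and b: "\<And>t x. x \<in> space M \<Longrightarrow> \<bar>f' t x\<bar> \<le> B x" and B: "integrable M B"
  shows "((\<lambda>t. \<integral>x. f t x \<partial>M) has_real_derivative (\<integral>x. f' t0 x \<partial>M)) (at t0)"
  unfolding DERIV_def tendsto_at_iff_sequentially o_def
proof (intro allI impI)
  fix X :: "nat \<Rightarrow> real"
  assume X: "\<forall>i. X i \<in> UNIV - {0}" "X \<longlonglongrightarrow> 0"
  have "(\<lambda>n. \<integral>x. (f (t0 + X n) x - f t0 x) / X n \<partial>M) \<longlonglongrightarrow> (\<integral>x. f' t0 x \<partial>M)"
  proof (rule integral_dominated_convergence[OF m _ B])
    show "(\<lambda>x. (f (t0 + X n) x - f t0 x) / X n) \<in> borel_measurable M" for n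
      using int by (intro borel_measurable_divide borel_measurable_diff) auto
    show "AE x in M. (\<lambda>n. (f (t0 + X n) x - f t0 x) / X n) \<longlonglongrightarrow> f' t0 x"
    proof (rule AE_I2)
      fix x assume "x \<in> space M"
      from d[OF this, of t0] X show "(\<lambda>n. (f (t0 + X n) x - f t0 x) / X n) \<longlonglongrightarrow> f' t0 x"
        unfolding DERIV_def tendsto_at_iff_sequentially o_def by blast
    qed
    show "AE x in M. norm ((f (t0 + X n) x - f t0 x) / X n) \<le> B x" for n
    proof (rule AE_I2)
      fix x assume x: "x \<in> space M"
      have "norm (f (t0 + X n) x - f t0 x) \<le> B x * norm (t0 + X n - t0)"
        by (rule field_differentiable_bound[of UNIV "\<lambda>t. f t x" "\<lambda>t. f' t x"]) (use d[OF x] b[OF x] in auto)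
      then show "norm ((f (t0 + X n) x - f t0 x) / X n) \<le> B x"
        using X(1) by (simp add: divide_le_eq)
    qed
  qed
  moreover have "(\<integral>x. (f (t0 + X n) x - f t0 x) / X n \<partial>M) = ((\<integral>x. f (t0 + X n) x \<partial>M) - (\<integral>x. f t0 x \<partial>M)) / X n" for n
    using int by simp
  ultimately show "(\<lambda>n. ((\<integral>x. f (t0 + X n) x \<partial>M) - (\<integral>x. f t0 x \<partial>M)) / X n) \<longlonglongrightarrow> (\<integral>x. f' t0 x \<partial>M)"
    by (simp only:)
qed

abbreviation scl :: "nat \<Rightarrow> real \<Rightarrow> (nat \<Rightarrow> real) \<Rightarrow> nat \<Rightarrow> real" where
  "scl N s y \<equiv> (\<lambda>i\<in>{..<N}. s * y i)"

locale polar_kernel =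
  fixes N :: nat and K :: "real measure"
  assumes N: "N \<ge> 1" and prob_K: "prob_space K" and sets_K: "sets K = sets borel"
    and K_pos: "AE s in K. s > 0" and K_sq: "(\<integral>\<^sup>+s. ennreal (s\<^sup>2) \<partial>K) = 1"
    and polar: "\<And>G. G \<in> borel_measurable (Rn N) \<Longrightarrow> (\<integral>\<^sup>+x. G x \<partial>tensor_power gauss N) =
       (\<integral>\<^sup>+y. \<integral>\<^sup>+s. G (scl N s y) \<partial>K \<partial>uniform_sphere N)"
begin

sublocale K: prob_space K by (rule prob_K)

sublocale U: prob_space "uniform_sphere N" by (rule prob_space_uniform_sphere)

lemma measurable_K [simp]: "measurable K M = measurable borel M"
  by (rule measurable_cong_sets[OF sets_K refl])

lemma measurable_U [simp]: "measurable (uniform_sphere N) M = measurable (Rn N) M"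
  by (rule measurable_cong_sets) simp_all

lemma measurable_TG [simp]: "measurable (tensor_power gauss N) M = measurable (Rn N) M"
  by (rule measurable_cong_sets) simp_all

lemma space_K [simp]: "space K = UNIV"
  using sets_eq_imp_space_eq[OF sets_K] by simp

lemma measurable_scl:
  fixes A :: "(nat \<Rightarrow> real) \<Rightarrow> 'b::topological_space"
  assumes "A \<in> borel_measurable (Rn N)"
  shows "(\<lambda>s. A (scl N s y)) \<in> borel_measurable borel"
  by (rule measurable_compose[OF measurable_scale_snd assms])

lemma measurable_scl_pair:
  fixes A :: "(nat \<Rightarrow> real) \<Rightarrow> 'b::topological_space"
  assumes "A \<in> borel_measurable (Rn N)"
  shows "(\<lambda>(y, s). A (scl N s y)) \<in> borel_measurable (Rn N \<Otimes>\<^sub>M K)"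
  using borel_measurable_scale_pair[OF assms]
  by (simp add: case_prod_beta' measurable_cong_sets[OF sets_pair_measure_cong[OF refl sets_K] refl])

lemma measurable_nn_cond:
  assumes "A \<in> borel_measurable (Rn N)"
  shows "(\<lambda>y. \<integral>\<^sup>+s. A (scl N s y) \<partial>K) \<in> borel_measurable (Rn N)"
  by (rule K.borel_measurable_nn_integral[OF measurable_scl_pair[OF assms]])

text \<open>By independence of radius and direction, the conditional expectation given the direction
  y is an average over the ray through y. It is defined for every y, with value 0 where the
  integrand is not integrable.\<close>

definition cond :: "((nat \<Rightarrow> real) \<Rightarrow> real) \<Rightarrow> (nat \<Rightarrow> real) \<Rightarrow> real" where
  "cond A y = (\<integral>s. A (scl N s y) \<partial>K)"

lemma measurable_cond [measurable]:
  assumes "A \<in> borel_measurable (Rn N)"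
  shows "cond A \<in> borel_measurable (Rn N)"
  unfolding cond_def[abs_def] by (rule K.borel_measurable_lebesgue_integral[OF measurable_scl_pair[OF assms]])

lemma AE_integrable_cond:
  fixes A :: "(nat \<Rightarrow> real) \<Rightarrow> real"
  assumes A: "integrable (tensor_power gauss N) A"
  shows "AE y in uniform_sphere N. integrable K (\<lambda>s. A (scl N s y))"
proof -
  have Am [measurable]: "A \<in> borel_measurable (Rn N)" using borel_measurable_integrable[OF A] by simp
  have "(\<integral>\<^sup>+y. \<integral>\<^sup>+s. ennreal (norm (A (scl N s y))) \<partial>K \<partial>uniform_sphere N) = (\<integral>\<^sup>+x. ennreal (norm (A x)) \<partial>tensor_power gauss N)"
    by (rule polar[symmetric]) measurable
  also have "\<dots> < \<infinity>" using A unfolding integrable_iff_bounded by blast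
  finally have "AE y in uniform_sphere N. (\<integral>\<^sup>+s. ennreal (norm (A (scl N s y))) \<partial>K) \<noteq> \<infinity>"
    by (intro nn_integral_noteq_infinite) (auto intro: measurable_nn_cond)
  then show ?thesis
  proof eventually_elim
    case (elim y)
    then show ?case
      using measurable_scl[OF Am, of y] by (intro integrableI_bounded) (auto simp: top.not_eq_extremum)
  qed
qed

text \<open>Conditional expectation is a contraction in L^1; this carries approximations from R^N
  over to the sphere.\<close>

lemma nn_integral_cond_diff_le:
  assumes A: "integrable (tensor_power gauss N) A" and B: "integrable (tensor_power gauss N) B"
  shows "(\<integral>\<^sup>+y. ennreal \<bar>cond A y - cond B y\<bar> \<partial>uniform_sphere N) \<le> (\<integral>\<^sup>+x. ennreal \<bar>A x - B x\<bar> \<partial>tensor_power gauss N)"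
proof -
  have [measurable]: "A \<in> borel_measurable (Rn N)" "B \<in> borel_measurable (Rn N)"
    using borel_measurable_integrable A B by auto
  have "(\<integral>\<^sup>+y. ennreal \<bar>cond A y - cond B y\<bar> \<partial>uniform_sphere N) \<le>
    (\<integral>\<^sup>+y. \<integral>\<^sup>+s. ennreal \<bar>A (scl N s y) - B (scl N s y)\<bar> \<partial>K \<partial>uniform_sphere N)"
    using AE_integrable_cond[OF A] AE_integrable_cond[OF B]
  proof (intro nn_integral_mono_AE, eventually_elim)
    case (elim y)
    have "ennreal \<bar>cond A y - cond B y\<bar> = ennreal (norm (\<integral>s. A (scl N s y) - B (scl N s y) \<partial>K))"
      using elim by (simp add: cond_def)
    also have "\<dots> \<le> (\<integral>\<^sup>+s. ennreal (norm (A (scl N s y) - B (scl N s y))) \<partial>K)"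
      using elim by (intro integral_norm_bound_ennreal) auto
    finally show ?case by simp
  qed
  also have "\<dots> = (\<integral>\<^sup>+x. ennreal \<bar>A x - B x\<bar> \<partial>tensor_power gauss N)"
    by (rule polar[symmetric]) measurable
  finally show ?thesis .
qed

lemma nn_integral_cond:
  assumes A: "integrable (tensor_power gauss N) A" and A0: "\<And>x. A x \<ge> 0"
  shows "AE y in uniform_sphere N. (\<integral>\<^sup>+s. ennreal (A (scl N s y)) \<partial>K) = ennreal (cond A y)"
  using AE_integrable_cond[OF A]
  by eventually_elim (auto simp: cond_def A0 intro!: nn_integral_eq_integral)

lemma K_abs_integrable: "integrable K (\<lambda>s. \<bar>s\<bar>)"
proof (rule Bochner_Integration.integrable_bound)
  have "integrable K (\<lambda>s. s\<^sup>2)"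
    using K_sq by (intro integrableI_nonneg) auto
  then show "integrable K (\<lambda>s. 1 + s\<^sup>2)" by simp
  show "AE s in K. norm \<bar>s\<bar> \<le> norm (1 + s\<^sup>2)"
  proof (rule AE_I2)
    fix s :: real
    have "0 \<le> (\<bar>s\<bar> - 1)\<^sup>2" by simp
    then have "2 * \<bar>s\<bar> \<le> 1 + s\<^sup>2" by (simp add: power2_eq_square algebra_simps)
    then show "norm \<bar>s\<bar> \<le> norm (1 + s\<^sup>2)" by simp
  qed
qed simp

lemma to_sphere_scl:
  assumes y: "y \<in> kac_sphere N" and s: "s > 0"
  shows "to_sphere N (scl N s y) = y"
proof -
  have "L2_set y {..<N} = sqrt (real N)" using y by (simp add: L2_set_def kac_sphere_def)
  then have "L2_set (scl N s y) {..<N} = s * sqrt (real N)" using s by (simp add: L2_set_scale)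
  then show ?thesis using y s N by (auto simp: to_sphere_def fun_eq_iff kac_sphere_def extensional_def)
qed

text \<open>Recovers s from the point s y of a ray over the sphere, so that a factor s under the
  K-integral becomes a function of x and \<open>cond\<close> can be applied to it.\<close>

definition rad :: "(nat \<Rightarrow> real) \<Rightarrow> real" where
  "rad x = L2_set x {..<N} / sqrt (real N)"

lemma measurable_rad [measurable]: "rad \<in> borel_measurable (Rn N)"
  unfolding rad_def[abs_def] by measurable

lemma rad_scl:
  assumes y: "y \<in> kac_sphere N" and s: "s > 0"
  shows "rad (scl N s y) = s"
proof -
  have "L2_set y {..<N} = sqrt (real N)" using y by (simp add: L2_set_def kac_sphere_def)
  then have "L2_set (scl N s y) {..<N} = s * sqrt (real N)" using s by (simp add: L2_set_scale)
  then show ?thesis using N by (simp add: rad_def)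
qed

lemma rad_le: "rad x \<le> (\<Sum>i<N. \<bar>x i\<bar>)" "rad x \<ge> 0"
proof -
  have "rad x \<le> L2_set x {..<N}"
  proof -
    have "L2_set x {..<N} / sqrt (real N) \<le> L2_set x {..<N} / 1"
      using N by (intro divide_left_mono) (auto simp: L2_set_nonneg)
    then show ?thesis by (simp add: rad_def)
  qed
  also have "\<dots> \<le> (\<Sum>i<N. \<bar>x i\<bar>)" by (rule L2_set_le_sum_abs)
  finally show "rad x \<le> (\<Sum>i<N. \<bar>x i\<bar>)" .
  show "rad x \<ge> 0" by (simp add: rad_def L2_set_nonneg)
qed

text \<open>The projection of s y is y for almost every s, so the indicator leaves the inner
  integral and only the density is averaged.\<close>

lemma rescaled_tensor_eq_density:
  assumes H: "integrable (tensor_power gauss N) H" and H0: "\<And>x. H x \<ge> 0"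
    and \<mu>: "tensor_power \<mu> N = density (tensor_power gauss N) (\<lambda>x. ennreal (H x))"
  shows "rescaled_tensor \<mu> N = density (uniform_sphere N) (\<lambda>y. ennreal (cond H y))"
proof (rule measure_eqI)
  have [measurable]: "H \<in> borel_measurable (Rn N)" using borel_measurable_integrable[OF H] by simp
  fix A assume "A \<in> sets (rescaled_tensor \<mu> N)"
  then have [measurable]: "A \<in> sets (Rn N)" by (simp add: rescaled_tensor_def)
  have mT: "to_sphere N \<in> measurable (tensor_power \<mu> N) (Rn N)"
    unfolding \<mu> by simp
  have "emeasure (rescaled_tensor \<mu> N) A = (\<integral>\<^sup>+x. indicator A x \<partial>rescaled_tensor \<mu> N)"
    by (simp add: rescaled_tensor_def)
  also have "\<dots> = (\<integral>\<^sup>+x. indicator A (to_sphere N x) \<partial>tensor_power \<mu> N)"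
    unfolding rescaled_tensor_def using mT by (subst nn_integral_distr) auto
  also have "\<dots> = (\<integral>\<^sup>+x. ennreal (H x) * indicator A (to_sphere N x) \<partial>tensor_power gauss N)"
    unfolding \<mu> by (subst nn_integral_density) auto
  also have "\<dots> = (\<integral>\<^sup>+y. \<integral>\<^sup>+s. ennreal (H (scl N s y)) * indicator A (to_sphere N (scl N s y)) \<partial>K \<partial>uniform_sphere N)"
    by (rule polar) measurable
  also have "\<dots> = (\<integral>\<^sup>+y. ennreal (cond H y) * indicator A y \<partial>uniform_sphere N)"
    using nn_integral_cond[OF H H0] AE_uniform_sphere_kac_sphere[OF N]
  proof (intro nn_integral_cong_AE, eventually_elim)
    case (elim y)
    have "(\<integral>\<^sup>+s. ennreal (H (scl N s y)) * indicator A (to_sphere N (scl N s y)) \<partial>K) =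
      (\<integral>\<^sup>+s. ennreal (H (scl N s y)) * indicator A y \<partial>K)"
      using K_pos by (intro nn_integral_cong_AE) (auto elim!: eventually_mono simp: to_sphere_scl[OF elim(4)])
    also have "\<dots> = (\<integral>\<^sup>+s. ennreal (H (scl N s y)) \<partial>K) * indicator A y"
      using measurable_scl[of H y] by (intro nn_integral_multc) simp
    finally show ?case unfolding elim(3) .
  qed
  also have "\<dots> = emeasure (density (uniform_sphere N) (\<lambda>y. ennreal (cond H y))) A"
    by (subst emeasure_density) auto
  finally show "emeasure (rescaled_tensor \<mu> N) A = emeasure (density (uniform_sphere N) (\<lambda>y. ennreal (cond H y))) A" .
qed (simp add: rescaled_tensor_def)

text \<open>Jensen's inequality for the jointly convex function l^2 / k, through its supporting
  planes l^2 / k \<ge> 2 a l - a^2 k with a = m / c. The last assumption covers k = 0, where the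
  quotient is 0 by convention.\<close>

lemma jensen_cond:
  assumes H: "integrable (tensor_power gauss N) H" and H0: "\<And>x. H x \<ge> 0"
    and L: "integrable (tensor_power gauss N) L" and L0: "\<And>x. H x = 0 \<Longrightarrow> L x = 0"
  shows "(\<integral>\<^sup>+y. ennreal ((cond L y)\<^sup>2 / cond H y) \<partial>uniform_sphere N) \<le>
    (\<integral>\<^sup>+x. ennreal ((L x)\<^sup>2 / H x) \<partial>tensor_power gauss N)"
proof -
  have [measurable]: "H \<in> borel_measurable (Rn N)" "L \<in> borel_measurable (Rn N)"
    using borel_measurable_integrable H L by auto
  have "(\<integral>\<^sup>+y. ennreal ((cond L y)\<^sup>2 / cond H y) \<partial>uniform_sphere N) \<le>
     (\<integral>\<^sup>+y. \<integral>\<^sup>+s. ennreal ((L (scl N s y))\<^sup>2 / H (scl N s y)) \<partial>K \<partial>uniform_sphere N)"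
    using AE_integrable_cond[OF H] AE_integrable_cond[OF L]
  proof (intro nn_integral_mono_AE, eventually_elim)
    case (elim y)
    define m where "m = cond L y"
    define c where "c = cond H y"
    show "ennreal ((cond L y)\<^sup>2 / cond H y) \<le> (\<integral>\<^sup>+s. ennreal ((L (scl N s y))\<^sup>2 / H (scl N s y)) \<partial>K)"
    proof (cases "c > 0")
      case True
      have "m\<^sup>2 / c = 2 * (m / c) * m - (m / c)\<^sup>2 * c"
        using True by (simp add: power2_eq_square)
      also have "\<dots> = (\<integral>s. 2 * (m / c) * L (scl N s y) - (m / c)\<^sup>2 * H (scl N s y) \<partial>K)"
        using elim by (simp add: m_def c_def cond_def)
      finally have "ennreal (m\<^sup>2 / c) = ennreal (\<integral>s. 2 * (m / c) * L (scl N s y) - (m / c)\<^sup>2 * H (scl N s y) \<partial>K)"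
        by simp
      also have "\<dots> \<le> (\<integral>\<^sup>+s. ennreal (2 * (m / c) * L (scl N s y) - (m / c)\<^sup>2 * H (scl N s y)) \<partial>K)"
        using elim by (intro ennreal_integral_le_nn_integral) auto
      also have "\<dots> \<le> (\<integral>\<^sup>+s. ennreal ((L (scl N s y))\<^sup>2 / H (scl N s y)) \<partial>K)"
      proof (intro nn_integral_mono ennreal_leI)
        fix s
        define l where "l = L (scl N s y)"
        define k where "k = H (scl N s y)"
        have "2 * (m / c) * l - (m / c)\<^sup>2 * k \<le> l\<^sup>2 / k"
        proof (cases "k = 0")
          case False
          then have k: "k > 0" using H0[of "scl N s y"] by (simp add: k_def)
          have "0 \<le> (l - (m / c) * k)\<^sup>2 / k" using k by simp
          also have "\<dots> = l\<^sup>2 / k - 2 * (m / c) * l + (m / c)\<^sup>2 * k"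
            using k True by (simp add: power2_eq_square field_simps)
          finally show ?thesis by simp
        next
          case True
          then have "l = 0" using L0[of "scl N s y"] by (simp add: k_def l_def)
          then show ?thesis using True by simp
        qed
        then show "2 * (m / c) * L (scl N s y) - (m / c)\<^sup>2 * H (scl N s y) \<le> (L (scl N s y))\<^sup>2 / H (scl N s y)"
          by (simp add: l_def k_def)
      qed
      finally show ?thesis by (simp add: m_def c_def)
    next
      case False
      then have "m\<^sup>2 / c \<le> 0" by (simp add: divide_nonneg_nonpos)
      then show ?thesis by (simp add: m_def c_def ennreal_neg)
    qed
  qed
  also have "\<dots> = (\<integral>\<^sup>+x. ennreal ((L x)\<^sup>2 / H x) \<partial>tensor_power gauss N)"
    by (rule polar[symmetric]) measurable
  finally show ?thesis .
qed

end

section \<open>Products of one-dimensional functions and C^1 cutoffs\<close>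

lemma integrable_tensor_power_prod:
  fixes q :: "nat \<Rightarrow> real \<Rightarrow> real"
  assumes "\<And>i. i < N \<Longrightarrow> integrable gauss (q i)"
  shows "integrable (tensor_power gauss N) (\<lambda>x. \<Prod>i<N. q i (x i))"
    and "(\<integral>x. (\<Prod>i<N. q i (x i)) \<partial>tensor_power gauss N) = (\<Prod>i<N. \<integral>x. q i x \<partial>gauss)"
proof -
  interpret G: prob_space gauss by (rule prob_space_gauss)
  interpret product_sigma_finite "\<lambda>_::nat. gauss" by standard
  show "integrable (tensor_power gauss N) (\<lambda>x. \<Prod>i<N. q i (x i))"
    unfolding tensor_power_def using assms by (intro product_integrable_prod) auto
  show "(\<integral>x. (\<Prod>i<N. q i (x i)) \<partial>tensor_power gauss N) = (\<Prod>i<N. \<integral>x. q i x \<partial>gauss)"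
    unfolding tensor_power_def using assms by (intro product_integral_prod) auto
qed

lemma prod_split_one:
  fixes q :: "nat \<Rightarrow> real"
  assumes "i < N"
  shows "(\<Prod>k<N. q k) = q i * (\<Prod>k\<in>{..<N}-{i}. q k)"
  using assms by (subst prod.remove[of _ i]) auto

lemma prod_split_two:
  fixes q :: "nat \<Rightarrow> real"
  assumes "i < N" "j < N" "i \<noteq> j"
  shows "(\<Prod>k<N. q k) = q i * (q j * (\<Prod>k\<in>{..<N}-{i}-{j}. q k))"
  using assms by (subst prod.remove[of _ i]; simp) (subst prod.remove[of _ j]; simp)

text \<open>Squaring removes the kink of the positive part; this makes the cutoff below C^1.\<close>

lemma DERIV_max_0_sq: "((\<lambda>z::real. (max 0 z)\<^sup>2) has_real_derivative (2 * max 0 z)) (at z)"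
proof -
  consider "z > 0" | "z < 0" | "z = 0" by linarith
  then show ?thesis
  proof cases
    case 1
    have "((\<lambda>z::real. z\<^sup>2) has_real_derivative (2 * z)) (at z)" by (auto intro!: derivative_eq_intros)
    then have "((\<lambda>z::real. (max 0 z)\<^sup>2) has_real_derivative (2 * z)) (at z)"
      by (rule has_field_derivative_transform_within_open[where S = "{0<..}"]) (use 1 in auto)
    then show ?thesis using 1 by simp
  next
    case 2
    have "((\<lambda>z::real. 0) has_real_derivative 0) (at z)" by simp
    then have "((\<lambda>z::real. (max 0 z)\<^sup>2) has_real_derivative 0) (at z)"
      by (rule has_field_derivative_transform_within_open[where S = "{..<0}"]) (use 2 in auto)
    then show ?thesis using 2 by simp
  next
    case 3
    have "((\<lambda>h::real. (max 0 h)\<^sup>2 / h) \<longlongrightarrow> 0) (at 0)"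
    proof (rule Lim_null_comparison)
      show "((\<lambda>h::real. \<bar>h\<bar>) \<longlongrightarrow> 0) (at 0)" by (rule tendsto_rabs_zero) simp
      show "\<forall>\<^sub>F h in at 0. norm ((max 0 h)\<^sup>2 / h) \<le> \<bar>h\<bar>" for h :: real
        by (rule always_eventually) (auto simp: max_def power2_eq_square)
    qed
    then show ?thesis using 3 by (simp add: DERIV_def)
  qed
qed

text \<open>A C^1 bump supported in [-(n+1), n+1]. The successor keeps the scale nonzero at n =
  0.\<close>

definition cutoff :: "nat \<Rightarrow> real \<Rightarrow> real" where
  "cutoff n x = (max 0 (1 - x\<^sup>2 / (real (Suc n))\<^sup>2))\<^sup>2"

definition cutoff' :: "nat \<Rightarrow> real \<Rightarrow> real" where
  "cutoff' n x = 2 * max 0 (1 - x\<^sup>2 / (real (Suc n))\<^sup>2) * (- 2 * x / (real (Suc n))\<^sup>2)"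

lemma cutoff_deriv: "(cutoff n has_real_derivative cutoff' n x) (at x)"
proof -
  have "((\<lambda>x. 1 - x\<^sup>2 / (real (Suc n))\<^sup>2) has_real_derivative (- 2 * x / (real (Suc n))\<^sup>2)) (at x)"
    unfolding divide_inverse by (auto intro!: derivative_eq_intros simp del: of_nat_Suc)
  from DERIV_chain2[OF DERIV_max_0_sq this] show ?thesis
    unfolding cutoff_def[abs_def] cutoff'_def by simp
qed

lemma continuous_on_cutoff: "continuous_on S (cutoff n)" "continuous_on S (cutoff' n)"
  unfolding cutoff_def[abs_def] cutoff'_def[abs_def]
  by (auto intro!: continuous_intros simp del: of_nat_Suc)

lemma cutoff_01: "0 \<le> cutoff n x" "cutoff n x \<le> 1"
proof -
  have "max 0 (1 - x\<^sup>2 / (real (Suc n))\<^sup>2) \<le> 1" by (simp del: of_nat_Suc)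
  then show "cutoff n x \<le> 1" unfolding cutoff_def by (intro power_le_one) auto
qed (simp add: cutoff_def)

lemma cutoff_support:
  assumes "\<bar>x\<bar> \<ge> real (Suc n)"
  shows "cutoff n x = 0" "cutoff' n x = 0"
proof -
  have "(real (Suc n))\<^sup>2 \<le> x\<^sup>2" using assms by (metis abs_le_square_iff abs_of_nat)
  then have "1 - x\<^sup>2 / (real (Suc n))\<^sup>2 \<le> 0" by (simp add: le_divide_eq del: of_nat_Suc)
  then show "cutoff n x = 0" "cutoff' n x = 0" by (simp_all add: cutoff_def cutoff'_def max_def del: of_nat_Suc)
qed

text \<open>On the support |x| / (n+1)^2 \<le> 1, so the bound is uniform in n, as the later
  domination arguments require.\<close>

lemma cutoff'_bound: "\<bar>cutoff' n x\<bar> \<le> 4"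
proof (cases "\<bar>x\<bar> \<ge> real (Suc n)")
  case False
  define m where "m = real (Suc n)"
  have m: "m \<ge> 1" "\<bar>x\<bar> \<le> m" using False by (auto simp: m_def)
  have a: "\<bar>max 0 (1 - x\<^sup>2 / m\<^sup>2)\<bar> \<le> 1" using m by simp
  have "\<bar>x\<bar> / m\<^sup>2 \<le> m / m\<^sup>2" using m by (intro divide_right_mono) auto
  also have "\<dots> \<le> 1" using m by (simp add: power2_eq_square)
  finally have b: "\<bar>x\<bar> / m\<^sup>2 \<le> 1" .
  have "\<bar>cutoff' n x\<bar> = 4 * (\<bar>max 0 (1 - x\<^sup>2 / m\<^sup>2)\<bar> * (\<bar>x\<bar> / m\<^sup>2))"
    unfolding cutoff'_def m_def[symmetric] by (simp add: abs_mult)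
  also have "\<dots> \<le> 4 * (1 * 1)" using a b m by (intro mult_left_mono mult_mono) auto
  finally show ?thesis by simp
qed (simp add: cutoff_support)

lemma cutoff_lim: "(\<lambda>n. cutoff n x) \<longlonglongrightarrow> 1" "(\<lambda>n. cutoff' n x) \<longlonglongrightarrow> 0"
proof -
  have 0: "(\<lambda>n. inverse (real (Suc n))) \<longlonglongrightarrow> 0" by (rule LIMSEQ_inverse_real_of_nat)
  have 1: "(\<lambda>n. (max 0 (1 - x\<^sup>2 * (inverse (real (Suc n)))\<^sup>2))\<^sup>2) \<longlonglongrightarrow> (max 0 (1 - x\<^sup>2 * 0\<^sup>2))\<^sup>2"
    by (intro tendsto_intros 0)
  have 2: "(\<lambda>n. 2 * max 0 (1 - x\<^sup>2 * (inverse (real (Suc n)))\<^sup>2) * (- 2 * x * (inverse (real (Suc n)))\<^sup>2))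
     \<longlonglongrightarrow> 2 * max 0 (1 - x\<^sup>2 * 0\<^sup>2) * (- 2 * x * 0\<^sup>2)"
    by (intro tendsto_intros 0)
  show "(\<lambda>n. cutoff n x) \<longlonglongrightarrow> 1" "(\<lambda>n. cutoff' n x) \<longlonglongrightarrow> 0"
    using 1 2 by (simp_all add: cutoff_def cutoff'_def divide_inverse power_inverse del: of_nat_Suc)
qed

section \<open>One-dimensional densities of finite Fisher information relative to the
  Gaussian\<close>

locale fisher_density =
  fixes h g :: "real \<Rightarrow> real"
  assumes h_nonneg: "\<And>x. 0 \<le> h x"
    and h_deriv: "\<And>x. (h has_real_derivative g x) (at x)"
    and g_cont: "continuous_on UNIV g"
    and h_mass: "(\<integral>\<^sup>+x. ennreal (h x) \<partial>gauss) = 1"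
    and h_second: "(\<integral>\<^sup>+x. ennreal (x\<^sup>2 * h x) \<partial>gauss) = 1"
    and I_fin: "(\<integral>\<^sup>+x. ennreal ((g x)\<^sup>2 / h x) \<partial>gauss) < \<infinity>"
begin

lemma h_cont: "continuous_on S h"
  using h_deriv by (intro DERIV_continuous_on) (auto intro: has_field_derivative_at_within)

lemma g_cont': "continuous_on S g"
  using g_cont continuous_on_subset by blast

lemma h_measurable [measurable]: "h \<in> borel_measurable borel"
  by (rule borel_measurable_continuous_onI[OF h_cont])

lemma g_measurable [measurable]: "g \<in> borel_measurable borel"
  by (rule borel_measurable_continuous_onI[OF g_cont])

text \<open>A zero of the nonnegative h is a minimum. So the information integrand is 0 / 0 there,
  and assigning it the value 0 loses nothing.\<close>

lemma g_zero: "h x = 0 \<Longrightarrow> g x = 0"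
  using DERIV_local_min[OF h_deriv[of x], of 1] h_nonneg by auto

definition q :: "real \<Rightarrow> real" where "q x = (g x)\<^sup>2 / h x"

lemma q_nonneg: "q x \<ge> 0"
  by (simp add: q_def h_nonneg)

lemma q_measurable [measurable]: "q \<in> borel_measurable borel"
  unfolding q_def[abs_def] by measurable

text \<open>Young's inequality weighted by h. With a = 1 and a = x it derives the integrability of g
  and of x g from mass, second moment and finite information.\<close>

lemma xg_le: "2 * (\<bar>a\<bar> * \<bar>g x\<bar>) \<le> q x + a\<^sup>2 * h x"
proof (cases "h x = 0")
  case False
  then have "h x > 0" using h_nonneg[of x] by simp
  then have "0 \<le> (\<bar>g x\<bar> - \<bar>a\<bar> * h x)\<^sup>2 / h x" by simp
  also have "\<dots> = q x + a\<^sup>2 * h x - 2 * (\<bar>a\<bar> * \<bar>g x\<bar>)"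
    using \<open>h x > 0\<close> unfolding q_def power2_abs[of "g x", symmetric] power2_abs[of a, symmetric]
    by (simp add: power2_eq_square field_simps)
  finally show ?thesis by simp
qed (simp add: g_zero q_def)

lemma integrable_h: "integrable gauss h"
  by (rule integrableI_nonneg) (auto simp: h_nonneg h_mass)

lemma integral_h: "(\<integral>x. h x \<partial>gauss) = 1"
  using nn_integral_eq_integral[OF integrable_h] h_mass h_nonneg by (simp add: ennreal_eq_1)

lemma integrable_x2h: "integrable gauss (\<lambda>x. x\<^sup>2 * h x)"
  by (rule integrableI_nonneg) (auto simp: h_nonneg h_second)

lemma integral_x2h: "(\<integral>x. x\<^sup>2 * h x \<partial>gauss) = 1"
  using nn_integral_eq_integral[OF integrable_x2h] h_second h_nonneg by (simp add: ennreal_eq_1)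

lemma integrable_q: "integrable gauss q"
  by (rule integrableI_nonneg) (use I_fin q_nonneg in \<open>auto simp: q_def[abs_def]\<close>)

definition I :: real where "I = (\<integral>x. q x \<partial>gauss)"

lemma I_eq: "(\<integral>\<^sup>+x. ennreal ((g x)\<^sup>2 / h x) \<partial>gauss) = ennreal I"
  unfolding I_def q_def[symmetric] by (rule nn_integral_eq_integral[OF integrable_q]) (simp add: q_nonneg)

lemma I_nonneg: "I \<ge> 0"
  unfolding I_def by (simp add: q_nonneg)

lemma integrable_xh: "integrable gauss (\<lambda>x. x * h x)"
proof (rule Bochner_Integration.integrable_bound)
  show "integrable gauss (\<lambda>x. h x + x\<^sup>2 * h x)" using integrable_h integrable_x2h by simp
  show "AE x in gauss. norm (x * h x) \<le> norm (h x + x\<^sup>2 * h x)"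
  proof (rule AE_I2)
    fix x :: real
    have "0 \<le> (\<bar>x\<bar> - 1)\<^sup>2" by simp
    then have "\<bar>x\<bar> \<le> 1 + x\<^sup>2" by (simp add: power2_eq_square algebra_simps)
    then have "\<bar>x\<bar> * h x \<le> (1 + x\<^sup>2) * h x" using h_nonneg by (intro mult_right_mono) auto
    then show "norm (x * h x) \<le> norm (h x + x\<^sup>2 * h x)"
      using h_nonneg[of x] by (simp add: abs_mult algebra_simps)
  qed
qed simp

lemma integrable_g: "integrable gauss g"
proof (rule Bochner_Integration.integrable_bound)
  show "integrable gauss (\<lambda>x. q x + h x)" using integrable_h integrable_q by simp
  show "AE x in gauss. norm (g x) \<le> norm (q x + h x)"
  proof (rule AE_I2)
    fix x show "norm (g x) \<le> norm (q x + h x)"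
      using xg_le[of 1 x] h_nonneg[of x] q_nonneg[of x] by (simp add: abs_if split: if_splits)
  qed
qed simp

lemma integrable_xg: "integrable gauss (\<lambda>x. x * g x)"
proof (rule Bochner_Integration.integrable_bound)
  show "integrable gauss (\<lambda>x. q x + x\<^sup>2 * h x)" using integrable_x2h integrable_q by simp
  show "AE x in gauss. norm (x * g x) \<le> norm (q x + x\<^sup>2 * h x)"
  proof (rule AE_I2)
    fix x
    have "0 \<le> x\<^sup>2 * h x" using h_nonneg by simp
    then show "norm (x * g x) \<le> norm (q x + x\<^sup>2 * h x)"
      using xg_le[of x x] q_nonneg[of x] by (simp add: abs_mult)
  qed
qed simp

lemma prob_space_density: "prob_space (density gauss (\<lambda>x. ennreal (h x)))"
  by (rule prob_spaceI) (simp add: emeasure_density h_mass)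

end

section \<open>The conditioned product density and its spherical gradient\<close>

locale fisher_density_polar = fisher_density h g + polar_kernel N K
  for h g :: "real \<Rightarrow> real" and N :: nat and K :: "real measure"
begin

definition pr :: "(real \<Rightarrow> real) \<Rightarrow> (nat \<Rightarrow> real) \<Rightarrow> real" where
  "pr p x = (\<Prod>i<N. p (x i))"

text \<open>The i-th partial derivative of \<open>pr p\<close> when p' is the derivative of p. The
  factor i is left out of the product instead of being divided away, because p may vanish.\<close>

definition dpr :: "(real \<Rightarrow> real) \<Rightarrow> (real \<Rightarrow> real) \<Rightarrow> nat \<Rightarrow> (nat \<Rightarrow> real) \<Rightarrow> real" where
  "dpr p p' i x = p' (x i) * (\<Prod>j\<in>{..<N}-{i}. p (x j))"

lemma pr_measurable [measurable]: "p \<in> borel_measurable borel \<Longrightarrow> pr p \<in> borel_measurable (Rn N)"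
  unfolding pr_def[abs_def] by (intro borel_measurable_prod) auto

lemma dpr_measurable:
  assumes [measurable]: "p \<in> borel_measurable borel" "p' \<in> borel_measurable borel" and i: "i < N"
  shows "dpr p p' i \<in> borel_measurable (Rn N)"
proof -
  have "(\<lambda>x. p' (x i)) \<in> borel_measurable (Rn N)" using i by measurable
  moreover have "(\<lambda>x. \<Prod>j\<in>{..<N}-{i}. p (x j)) \<in> borel_measurable (Rn N)"
    by (intro borel_measurable_prod) auto
  ultimately show ?thesis unfolding dpr_def[abs_def] by measurable
qed

lemma dpr_eq_prod: "i < N \<Longrightarrow> dpr p p' i x = (\<Prod>k<N. (if k = i then p' else p) (x k))"
  by (subst prod_split_one[of i]) (auto simp: dpr_def intro!: prod.cong)

lemma dpr_scl:
  "i < N \<Longrightarrow> dpr p p' i (scl N s z) = p' (s * z i) * (\<Prod>j\<in>{..<N}-{i}. p (s * z j))"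
  by (auto simp: dpr_def intro!: prod.cong)

lemma integrable_pr: "integrable gauss p \<Longrightarrow> integrable (tensor_power gauss N) (pr p)"
  unfolding pr_def[abs_def] by (intro integrable_tensor_power_prod)

text \<open>\<open>rad x\<close> is at most the sum of the |x j|, and \<open>x j\<close> times
  \<open>dpr\<close> is again a product of one-variable functions, with a factor x p' for j = i and
  x p otherwise.\<close>

lemma integrable_rad_dpr:
  assumes p: "integrable gauss p" "integrable gauss (\<lambda>x. x * p x)"
    and p': "integrable gauss p'" "integrable gauss (\<lambda>x. x * p' x)" and i: "i < N"
  shows "integrable (tensor_power gauss N) (\<lambda>x. rad x * dpr p p' i x)"
proof (rule Bochner_Integration.integrable_bound)
  have [measurable]: "p \<in> borel_measurable borel" "p' \<in> borel_measurable borel"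
    using borel_measurable_integrable[OF p(1)] borel_measurable_integrable[OF p'(1)] by auto
  have "integrable (tensor_power gauss N) (\<lambda>x. x j * dpr p p' i x)" if j: "j < N" for j
  proof -
    define f where "f k t = (if k = j then t else 1) * (if k = i then p' else p) t" for k and t :: real
    have "integrable gauss (f k)" for k
      using p p' by (cases "k = i"; cases "k = j") (simp_all add: f_def[abs_def])
    then have "integrable (tensor_power gauss N) (\<lambda>x. \<Prod>k<N. f k (x k))"
      by (intro integrable_tensor_power_prod)
    moreover have "(\<Prod>k<N. f k (x k)) = x j * dpr p p' i x" for x
    proof -
      have "(\<Prod>k<N. f k (x k)) = (\<Prod>k<N. if k = j then x k else 1) * (\<Prod>k<N. (if k = i then p' else p) (x k))"
        unfolding f_def prod.distrib ..
      then show ?thesis using i j by (simp add: dpr_eq_prod)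
    qed
    ultimately show ?thesis by simp
  qed
  then show "integrable (tensor_power gauss N) (\<lambda>x. \<Sum>j<N. \<bar>x j * dpr p p' i x\<bar>)"
    by (intro Bochner_Integration.integrable_sum integrable_abs) auto
  show "(\<lambda>x. rad x * dpr p p' i x) \<in> borel_measurable (tensor_power gauss N)"
    using dpr_measurable[of p p' i] i by simp
  show "AE x in tensor_power gauss N. norm (rad x * dpr p p' i x) \<le> norm (\<Sum>j<N. \<bar>x j * dpr p p' i x\<bar>)"
  proof (rule AE_I2)
    fix x
    have "\<bar>rad x * dpr p p' i x\<bar> \<le> (\<Sum>j<N. \<bar>x j\<bar>) * \<bar>dpr p p' i x\<bar>"
      unfolding abs_mult using rad_le[of x] by (intro mult_right_mono) auto
    then show "norm (rad x * dpr p p' i x) \<le> norm (\<Sum>j<N. \<bar>x j * dpr p p' i x\<bar>)"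
      by (simp add: abs_mult sum_distrib_right)
  qed
qed

text \<open>For bounded factors \<open>cond (pr p)\<close> is C^1 on the whole space, so it serves
  as its own extension. Differentiating under the K-integral in coordinate i brings out a factor s,
  whose integrability comes from the second moment of K.\<close>

lemma has_sphere_grad_cond_pr:
  assumes p: "\<And>x. (p has_real_derivative p' x) (at x)" and p'c: "continuous_on UNIV p'"
    and B: "\<And>x. \<bar>p x\<bar> \<le> B" "\<And>x. \<bar>p' x\<bar> \<le> B" and y: "y \<in> kac_sphere N"
  shows "has_sphere_grad N (cond (pr p)) y (tang N y (\<lambda>i. cond (\<lambda>x. rad x * dpr p p' i x) y))"
proof -
  have pc: "continuous_on UNIV p"
    using p by (intro DERIV_continuous_on) (auto intro: has_field_derivative_at_within)
  have [measurable]: "p \<in> borel_measurable borel" "p' \<in> borel_measurable borel"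
    using pc p'c by (auto intro: borel_measurable_continuous_onI)
  have B0: "B \<ge> 0" using B(1)[of 0] by linarith
  define C where "C = B * B ^ (N - 1)"
  have dpr_bound: "\<bar>p' a * (\<Prod>j\<in>{..<N}-{i}. p (z j))\<bar> \<le> C" if "i < N" for a i and z :: "nat \<Rightarrow> real"
  proof -
    have "\<bar>\<Prod>j\<in>{..<N}-{i}. p (z j)\<bar> \<le> (\<Prod>j\<in>{..<N}-{i}. B)"
      unfolding abs_prod by (intro prod_mono) (auto simp: B)
    also have "\<dots> = B ^ (N - 1)" using that by simp
    finally show ?thesis unfolding abs_mult C_def using B B0 by (intro mult_mono) auto
  qed
  \<comment> \<open>Partial derivatives are needed at all x, whereas the form with
    \<open>rad\<close> agrees with this one only on the sphere, where the point s y has radial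
    variable s.\<close>
  define dk where "dk i x = (\<integral>s. s * dpr p p' i (scl N s x) \<partial>K)" for i x
  have C1: "C1_partials N (extensional {..<N}) (cond (pr p)) dk"
    unfolding C1_partials_def
  proof (intro allI impI conjI ballI)
    fix i and x :: "nat \<Rightarrow> real" assume i: "i < N" and x: "x \<in> extensional {..<N}"
    define R where "R s = (\<Prod>j\<in>{..<N}-{i}. p (s * x j))" for s
    have [measurable]: "R \<in> borel_measurable borel" unfolding R_def[abs_def] by measurable
    have "((\<lambda>t. \<integral>s. p (s * t) * R s \<partial>K) has_real_derivative (\<integral>s. (p' (s * x i) * s) * R s \<partial>K)) (at (x i))"
    proof (rule has_real_derivative_integral[where B = "\<lambda>s. C * \<bar>s\<bar>"])
      show "integrable K (\<lambda>s. p (s * t) * R s)" for t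
      proof (rule K.integrable_const_bound[of _ "B * B ^ (N - 1)"])
        show "AE s in K. norm (p (s * t) * R s) \<le> B * B ^ (N - 1)"
        proof (rule AE_I2)
          fix s
          have "\<bar>R s\<bar> \<le> (\<Prod>j\<in>{..<N}-{i}. B)"
            unfolding R_def abs_prod by (intro prod_mono) (auto simp: B)
          also have "\<dots> = B ^ (N - 1)" using i by simp
          finally show "norm (p (s * t) * R s) \<le> B * B ^ (N - 1)"
            unfolding real_norm_def abs_mult using B B0 by (intro mult_mono) auto
        qed
      qed simp
      fix t s :: real
      have "((\<lambda>t. s * t) has_real_derivative s) (at t)" by (auto intro!: derivative_eq_intros)
      from DERIV_cmult_right[OF DERIV_chain2[OF p this], of "R s"]
      show "((\<lambda>t. p (s * t) * R s) has_real_derivative (p' (s * t) * s) * R s) (at t)" .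
      show "\<bar>(p' (s * t) * s) * R s\<bar> \<le> C * \<bar>s\<bar>"
      proof -
        have "\<bar>(p' (s * t) * s) * R s\<bar> = \<bar>p' (s * t) * R s\<bar> * \<bar>s\<bar>" by (simp add: abs_mult)
        also have "\<dots> \<le> C * \<bar>s\<bar>" unfolding R_def by (intro mult_right_mono dpr_bound[OF i]) simp
        finally show ?thesis .
      qed
    qed (use K_abs_integrable in simp_all)
    moreover have "cond (pr p) (x(i := t)) = (\<integral>s. p (s * t) * R s \<partial>K)" for t
      unfolding cond_def pr_def R_def using i by (subst prod_split_one[OF i]) (auto intro!: Bochner_Integration.integral_cong prod.cong)
    moreover have "dk i x = (\<integral>s. (p' (s * x i) * s) * R s \<partial>K)"
      unfolding dk_def dpr_def R_def using i by (auto intro!: Bochner_Integration.integral_cong prod.cong)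
    ultimately show "((\<lambda>t. cond (pr p) (x(i := t))) has_real_derivative dk i x) (at (x i))" by simp
  next
    fix i assume i: "i < N"
    show "continuous_on (extensional {..<N}) (dk i)"
    proof (rule continuous_on_sequentiallyI)
      fix u :: "nat \<Rightarrow> nat \<Rightarrow> real" and a
      assume u: "u \<longlonglongrightarrow> a"
      have uc: "(\<lambda>n. u n j) \<longlonglongrightarrow> a j" for j
        using continuous_on_tendsto_compose[OF continuous_on_coord[of UNIV j] u] by simp
      have m: "(\<lambda>s. s * dpr p p' i (scl N s z)) \<in> borel_measurable K" for z
        using measurable_scl[OF dpr_measurable[of p p' i], of z] i by simp
      show "(\<lambda>n. dk i (u n)) \<longlonglongrightarrow> dk i a"
        unfolding dk_def
      proof (rule integral_dominated_convergence[where w = "\<lambda>s. C * \<bar>s\<bar>", OF m m])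
        show "integrable K (\<lambda>s. C * \<bar>s\<bar>)" using K_abs_integrable by simp
        show "AE s in K. (\<lambda>n. s * dpr p p' i (scl N s (u n))) \<longlonglongrightarrow> s * dpr p p' i (scl N s a)"
        proof (rule AE_I2)
          fix s
          have "(\<lambda>n. s * (p' (s * u n i) * (\<Prod>j\<in>{..<N}-{i}. p (s * u n j)))) \<longlonglongrightarrow>
             s * (p' (s * a i) * (\<Prod>j\<in>{..<N}-{i}. p (s * a j)))"
            by (intro tendsto_intros uc continuous_on_tendsto_compose[OF pc] continuous_on_tendsto_compose[OF p'c]) auto
          then show "(\<lambda>n. s * dpr p p' i (scl N s (u n))) \<longlonglongrightarrow> s * dpr p p' i (scl N s a)"
            using i by (simp add: dpr_scl)
        qed
        show "AE s in K. norm (s * dpr p p' i (scl N s (u n))) \<le> C * \<bar>s\<bar>" for n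
        proof (rule AE_I2)
          fix s
          show "norm (s * dpr p p' i (scl N s (u n))) \<le> C * \<bar>s\<bar>"
            unfolding dpr_def real_norm_def abs_mult[of s] mult.commute[of "\<bar>s\<bar>"]
            by (intro mult_right_mono dpr_bound[OF i]) simp
        qed
      qed
    qed
  qed
  have "dk i y = cond (\<lambda>x. rad x * dpr p p' i x) y" if i: "i < N" for i
    unfolding dk_def cond_def
  proof (rule integral_cong_AE)
    show "(\<lambda>s. s * dpr p p' i (scl N s y)) \<in> borel_measurable K"
      using measurable_scl[OF dpr_measurable[of p p' i], of y] i by simp
    have "(\<lambda>x. rad x * dpr p p' i x) \<in> borel_measurable (Rn N)"
      using dpr_measurable[of p p' i] i by simp
    from measurable_scl[OF this] show "(\<lambda>s. rad (scl N s y) * dpr p p' i (scl N s y)) \<in> borel_measurable K"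
      by simp
    show "AE s in K. s * dpr p p' i (scl N s y) = rad (scl N s y) * dpr p p' i (scl N s y)"
      using K_pos by eventually_elim (simp add: rad_scl[OF y])
  qed
  then have eq: "tang N y (\<lambda>i. cond (\<lambda>x. rad x * dpr p p' i x) y) = tang N y (\<lambda>i. dk i y)"
    by (intro tang_cong) simp
  have "y \<in> extensional {..<N}" using y by (simp add: kac_sphere_def)
  then show ?thesis
    unfolding has_sphere_grad_def eq
    unfolding tang_def
    by (intro exI[of _ "extensional {..<N}"] exI[of _ "cond (pr p)"] exI[of _ dk] conjI ballI C1) simp_all
qed

end

section \<open>Cutoff approximation and the weak gradient\<close>

context fisher_density_polar
begin

text \<open>Cutting off makes h and its derivative bounded, as the C^1 statement requires, while
  both stay dominated uniformly in n: by h and by |g| + 4 h.\<close>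

definition hn :: "nat \<Rightarrow> real \<Rightarrow> real" where "hn n x = h x * cutoff n x"

definition gn :: "nat \<Rightarrow> real \<Rightarrow> real" where "gn n x = g x * cutoff n x + h x * cutoff' n x"

lemma hn_deriv: "(hn n has_real_derivative gn n x) (at x)"
proof -
  have "((\<lambda>x. h x * cutoff n x) has_real_derivative g x * cutoff n x + cutoff' n x * h x) (at x)"
    by (rule DERIV_mult[OF h_deriv cutoff_deriv])
  then show ?thesis by (simp add: hn_def[abs_def] gn_def mult.commute)
qed

lemma gn_cont: "continuous_on S (gn n)"
  unfolding gn_def[abs_def] by (intro continuous_intros h_cont g_cont' continuous_on_cutoff)

lemma hn_cont: "continuous_on S (hn n)"
  unfolding hn_def[abs_def] by (intro continuous_intros h_cont continuous_on_cutoff)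

lemma hn_measurable [measurable]: "hn n \<in> borel_measurable borel" "gn n \<in> borel_measurable borel"
  by (rule borel_measurable_continuous_onI[OF hn_cont] borel_measurable_continuous_onI[OF gn_cont])+

lemma hn_gn_bounded:
  obtains B where "\<And>x. \<bar>hn n x\<bar> \<le> B" "\<And>x. \<bar>gn n x\<bar> \<le> B"
proof -
  define J where "J = {- real (Suc n) .. real (Suc n)}"
  have "bounded (hn n ` J)" "bounded (gn n ` J)"
    unfolding J_def by (auto intro!: compact_imp_bounded compact_continuous_image hn_cont gn_cont)
  then obtain B1 B2 where B: "\<And>x. x \<in> J \<Longrightarrow> \<bar>hn n x\<bar> \<le> B1" "\<And>x. x \<in> J \<Longrightarrow> \<bar>gn n x\<bar> \<le> B2"
    unfolding bounded_iff by auto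
  have out: "hn n x = 0" "gn n x = 0" if "x \<notin> J" for x
  proof -
    have "\<bar>x\<bar> \<ge> real (Suc n)" using that by (auto simp: J_def)
    then show "hn n x = 0" "gn n x = 0" by (simp_all add: hn_def gn_def cutoff_support del: of_nat_Suc)
  qed
  have "\<bar>hn n x\<bar> \<le> max 0 (max B1 B2)" "\<bar>gn n x\<bar> \<le> max 0 (max B1 B2)" for x
    using B[of x] out[of x] by (cases "x \<in> J"; fastforce)+
  then show ?thesis using that by blast
qed

lemma hn_bounds: "0 \<le> hn n x" "hn n x \<le> h x"
  using cutoff_01[of n x] h_nonneg[of x] by (auto simp: hn_def mult_left_le)

lemma gn_bound: "\<bar>gn n x\<bar> \<le> \<bar>g x\<bar> + 4 * h x"
proof -
  have "\<bar>g x * cutoff n x\<bar> \<le> \<bar>g x\<bar> * 1"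
    unfolding abs_mult using cutoff_01[of n x] by (intro mult_left_mono) auto
  moreover have "\<bar>h x * cutoff' n x\<bar> \<le> h x * 4"
    unfolding abs_mult using cutoff'_bound[of n x] h_nonneg[of x] by (intro mult_mono) auto
  ultimately show ?thesis unfolding gn_def by linarith
qed

lemma hn_lim: "(\<lambda>n. hn n x) \<longlonglongrightarrow> h x" "(\<lambda>n. gn n x) \<longlonglongrightarrow> g x"
proof -
  show "(\<lambda>n. hn n x) \<longlonglongrightarrow> h x"
    unfolding hn_def using tendsto_mult[OF tendsto_const cutoff_lim(1), of "h x" x] by simp
  show "(\<lambda>n. gn n x) \<longlonglongrightarrow> g x"
    unfolding gn_def using tendsto_add[OF tendsto_mult[OF tendsto_const cutoff_lim(1), of "g x" x]
      tendsto_mult[OF tendsto_const cutoff_lim(2), of "h x" x]] by simp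
qed

lemma integrable_hn: "integrable gauss (hn n)" "integrable gauss (\<lambda>x. x * hn n x)"
proof -
  show "integrable gauss (hn n)"
    by (rule Bochner_Integration.integrable_bound[OF integrable_h]) (use hn_bounds[of n] h_nonneg in auto)
  show "integrable gauss (\<lambda>x. x * hn n x)"
    by (rule Bochner_Integration.integrable_bound[OF integrable_xh])
      (use hn_bounds[of n] h_nonneg in \<open>auto simp: abs_mult intro!: mult_left_mono\<close>)
qed

lemma integrable_gb: "integrable gauss (\<lambda>x. \<bar>g x\<bar> + 4 * h x)" "integrable gauss (\<lambda>x. x * (\<bar>g x\<bar> + 4 * h x))"
proof -
  show "integrable gauss (\<lambda>x. \<bar>g x\<bar> + 4 * h x)" using integrable_g integrable_h by simp
  have "integrable gauss (\<lambda>x. x * \<bar>g x\<bar>)"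
    by (rule Bochner_Integration.integrable_bound[OF integrable_xg]) (auto simp: abs_mult)
  moreover have "integrable gauss (\<lambda>x. 4 * (x * h x))" using integrable_xh by simp
  ultimately have "integrable gauss (\<lambda>x. x * \<bar>g x\<bar> + 4 * (x * h x))" by (rule Bochner_Integration.integrable_add)
  then show "integrable gauss (\<lambda>x. x * (\<bar>g x\<bar> + 4 * h x))" by (simp add: algebra_simps)
qed

lemma integrable_gn: "integrable gauss (gn n)" "integrable gauss (\<lambda>x. x * gn n x)"
proof -
  have b: "\<bar>gn n x\<bar> \<le> \<bar>\<bar>g x\<bar> + 4 * h x\<bar>" for x using gn_bound[of n x] by linarith
  show "integrable gauss (gn n)"
    by (rule Bochner_Integration.integrable_bound[OF integrable_gb(1)]) (use b in auto)
  show "integrable gauss (\<lambda>x. x * gn n x)"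
    by (rule Bochner_Integration.integrable_bound[OF integrable_gb(2)])
      (use b in \<open>auto simp: abs_mult intro!: mult_left_mono\<close>)
qed

text \<open>The radial variable times a partial derivative of the product density: the function
  whose conditional expectation is the i-th component of the gradient before projection.\<close>

abbreviation "A i x \<equiv> rad x * dpr h g i x"

abbreviation "An n i x \<equiv> rad x * dpr (hn n) (gn n) i x"

lemma integrable_A: "i < N \<Longrightarrow> integrable (tensor_power gauss N) (A i)"
  by (intro integrable_rad_dpr integrable_h integrable_xh integrable_g integrable_xg)

lemma integrable_An: "i < N \<Longrightarrow> integrable (tensor_power gauss N) (An n i)"
  by (intro integrable_rad_dpr integrable_hn integrable_gn)

lemma pr_nonneg: "pr h x \<ge> 0"
  unfolding pr_def by (intro prod_nonneg) (simp add: h_nonneg)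

lemma L1_pr: "(\<lambda>n. \<integral>\<^sup>+x. ennreal \<bar>pr (hn n) x - pr h x\<bar> \<partial>tensor_power gauss N) \<longlonglongrightarrow> 0"
proof -
  have "(\<lambda>n. \<integral>\<^sup>+x. ennreal \<bar>pr (hn n) x - pr h x\<bar> \<partial>tensor_power gauss N) \<longlonglongrightarrow> (\<integral>\<^sup>+x. 0 \<partial>tensor_power gauss N)"
  proof (rule nn_integral_dominated_convergence[where w = "\<lambda>x. ennreal (pr h x)"])
    show "AE x in tensor_power gauss N. ennreal \<bar>pr (hn n) x - pr h x\<bar> \<le> ennreal (pr h x)" for n
    proof (intro AE_I2 ennreal_leI)
      fix x
      have "0 \<le> pr (hn n) x" "pr (hn n) x \<le> pr h x"
        unfolding pr_def by (auto intro!: prod_nonneg prod_mono simp: hn_bounds)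
      then show "\<bar>pr (hn n) x - pr h x\<bar> \<le> pr h x" by linarith
    qed
    show "(\<integral>\<^sup>+x. ennreal (pr h x) \<partial>tensor_power gauss N) < \<infinity>"
      using integrable_pr[OF integrable_h] pr_nonneg by (simp add: integrable_iff_bounded)
    show "AE x in tensor_power gauss N. (\<lambda>n. ennreal \<bar>pr (hn n) x - pr h x\<bar>) \<longlonglongrightarrow> 0"
    proof (rule AE_I2)
      fix x
      have "(\<lambda>n. \<bar>pr (hn n) x - pr h x\<bar>) \<longlonglongrightarrow> \<bar>pr h x - pr h x\<bar>"
        unfolding pr_def by (intro tendsto_intros hn_lim)
      from tendsto_ennrealI[OF this] show "(\<lambda>n. ennreal \<bar>pr (hn n) x - pr h x\<bar>) \<longlonglongrightarrow> 0" by simp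
    qed
  qed simp_all
  then show ?thesis by simp
qed

lemma L1_A:
  assumes i: "i < N"
  shows "(\<lambda>n. \<integral>\<^sup>+x. ennreal \<bar>An n i x - A i x\<bar> \<partial>tensor_power gauss N) \<longlonglongrightarrow> 0"
proof -
  \<comment> \<open>The dominating function has the shape of \<open>A\<close> with |g| + 4 h in
    place of g, so its integrability is another instance of
    \<open>integrable_rad_dpr\<close>.\<close>
  let ?D = "\<lambda>x. rad x * dpr h (\<lambda>x. \<bar>g x\<bar> + 4 * h x) i x"
  have D0: "?D x \<ge> 0" for x
    using rad_le(2)[of x] h_nonneg by (auto simp: dpr_def intro!: mult_nonneg_nonneg prod_nonneg add_nonneg_nonneg)
  have D: "integrable (tensor_power gauss N) ?D"
    by (intro integrable_rad_dpr integrable_h integrable_xh integrable_gb i)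
  have le: "\<bar>rad x * dpr p p' i x\<bar> \<le> ?D x"
    if "\<And>x. 0 \<le> p x \<and> p x \<le> h x" "\<And>x. \<bar>p' x\<bar> \<le> \<bar>g x\<bar> + 4 * h x" for p p' x
    unfolding abs_mult dpr_def abs_prod using that rad_le(2)[of x] h_nonneg
    by (intro mult_mono prod_mono) (auto intro!: prod_nonneg add_nonneg_nonneg mult_nonneg_nonneg)
  have meas: "(\<lambda>x. An n i x) \<in> borel_measurable (Rn N)" "(\<lambda>x. A i x) \<in> borel_measurable (Rn N)" for n
    using dpr_measurable[of "hn n" "gn n" i] dpr_measurable[of h g i] i by simp_all
  have "(\<lambda>n. \<integral>\<^sup>+x. ennreal \<bar>An n i x - A i x\<bar> \<partial>tensor_power gauss N) \<longlonglongrightarrow> (\<integral>\<^sup>+x. 0 \<partial>tensor_power gauss N)"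
  proof (rule nn_integral_dominated_convergence[where w = "\<lambda>x. ennreal (2 * ?D x)"])
    show "AE x in tensor_power gauss N. ennreal \<bar>An n i x - A i x\<bar> \<le> ennreal (2 * ?D x)" for n
    proof (intro AE_I2 ennreal_leI)
      fix x
      have "\<bar>An n i x\<bar> \<le> ?D x" by (rule le) (auto simp: hn_bounds gn_bound)
      moreover have "\<bar>A i x\<bar> \<le> ?D x" by (rule le) (auto simp: h_nonneg)
      ultimately show "\<bar>An n i x - A i x\<bar> \<le> 2 * ?D x" by linarith
    qed
    have "integrable (tensor_power gauss N) (\<lambda>x. 2 * ?D x)" using D by simp
    then show "(\<integral>\<^sup>+x. ennreal (2 * ?D x) \<partial>tensor_power gauss N) < \<infinity>"
      using D0 by (subst nn_integral_eq_integral) auto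
    show "(\<lambda>x. ennreal \<bar>An n i x - A i x\<bar>) \<in> borel_measurable (tensor_power gauss N)" for n
      using meas by simp
    show "(\<lambda>x. ennreal (2 * ?D x)) \<in> borel_measurable (tensor_power gauss N)"
      using borel_measurable_integrable[OF D] by simp
    show "AE x in tensor_power gauss N. (\<lambda>n. ennreal \<bar>An n i x - A i x\<bar>) \<longlonglongrightarrow> 0"
    proof (rule AE_I2)
      fix x
      have "(\<lambda>n. \<bar>An n i x - A i x\<bar>) \<longlonglongrightarrow> \<bar>A i x - A i x\<bar>"
        unfolding dpr_def by (intro tendsto_intros hn_lim)
      from tendsto_ennrealI[OF this] show "(\<lambda>n. ennreal \<bar>An n i x - A i x\<bar>) \<longlonglongrightarrow> 0" by simp
    qed
  qed simp
  then show ?thesis by simp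
qed

definition grad :: "(nat \<Rightarrow> real) \<Rightarrow> nat \<Rightarrow> real" where
  "grad y = tang N y (\<lambda>i. cond (A i) y)"

lemma measurable_cond_A: "i < N \<Longrightarrow> cond (A i) \<in> borel_measurable (Rn N)"
  using borel_measurable_integrable[OF integrable_A] by (intro measurable_cond) simp

text \<open>The cut off factors give C^1 functions on the sphere. Both required limits are inherited
  from R^N, because \<open>cond\<close> contracts L^1 distances and the tangential projection
  contracts lengths.\<close>

lemma weak_sphere_grad: "has_weak_sphere_grad N (cond (pr h)) grad"
  unfolding has_weak_sphere_grad_def
proof (intro conjI allI impI)
  fix i assume i: "i < N"
  have "(\<lambda>y. \<Sum>j<N. cond (A j) y * y j) \<in> borel_measurable (Rn N)"
    using measurable_cond_A by (intro borel_measurable_sum borel_measurable_times) auto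
  moreover have "(\<lambda>y. y i) \<in> borel_measurable (Rn N)" using i by simp
  ultimately have "(\<lambda>y. cond (A i) y - (1 / real N) * (\<Sum>j<N. cond (A j) y * y j) * y i) \<in> borel_measurable (Rn N)"
    using measurable_cond_A[OF i] by simp
  then show "(\<lambda>y. grad y i) \<in> borel_measurable (Rn N)"
    using i by (simp add: grad_def tang_def)
next
  have grad_n: "has_sphere_grad N (cond (pr (hn n))) y (tang N y (\<lambda>i. cond (An n i) y))" if "y \<in> kac_sphere N" for n y
  proof -
    obtain B where "\<And>x. \<bar>hn n x\<bar> \<le> B" "\<And>x. \<bar>gn n x\<bar> \<le> B" using hn_gn_bounded by blast
    then show ?thesis using hn_deriv gn_cont that by (intro has_sphere_grad_cond_pr)
  qed
  have c1: "sphere_C1 N (cond (pr (hn n)))" for n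
    using grad_n by (auto simp: sphere_C1_def)
  have l1: "(\<lambda>n. \<integral>\<^sup>+y. ennreal \<bar>cond (pr (hn n)) y - cond (pr h) y\<bar> \<partial>uniform_sphere N) \<longlonglongrightarrow> 0"
    by (rule ennreal_tendsto_0_le[OF L1_pr]) (intro nn_integral_cond_diff_le integrable_pr integrable_h integrable_hn)
  have le2: "(\<integral>\<^sup>+y. ennreal (L2_set (\<lambda>i. sphere_grad N (cond (pr (hn n))) y i - grad y i) {..<N}) \<partial>uniform_sphere N) \<le>
     (\<Sum>i<N. \<integral>\<^sup>+x. ennreal \<bar>An n i x - A i x\<bar> \<partial>tensor_power gauss N)" for n
  proof -
    have "(\<integral>\<^sup>+y. ennreal (L2_set (\<lambda>i. sphere_grad N (cond (pr (hn n))) y i - grad y i) {..<N}) \<partial>uniform_sphere N) \<le>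
      (\<integral>\<^sup>+y. (\<Sum>i<N. ennreal \<bar>cond (An n i) y - cond (A i) y\<bar>) \<partial>uniform_sphere N)"
      using AE_uniform_sphere_kac_sphere[OF N]
    proof (intro nn_integral_mono_AE, eventually_elim)
      fix y assume y: "y \<in> kac_sphere N"
      have "sphere_grad N (cond (pr (hn n))) y = tang N y (\<lambda>i. cond (An n i) y)"
        by (rule sphere_grad_eqI[OF grad_n[OF y] y])
      then have "L2_set (\<lambda>i. sphere_grad N (cond (pr (hn n))) y i - grad y i) {..<N} =
        L2_set (tang N y (\<lambda>i. cond (An n i) y - cond (A i) y)) {..<N}"
        by (intro L2_set_cong) (auto simp: grad_def tang_diff)
      also have "\<dots> \<le> L2_set (\<lambda>i. cond (An n i) y - cond (A i) y) {..<N}"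
        by (rule L2_set_tang_le[OF y N])
      also have "\<dots> \<le> (\<Sum>i<N. \<bar>cond (An n i) y - cond (A i) y\<bar>)" by (rule L2_set_le_sum_abs)
      finally show "ennreal (L2_set (\<lambda>i. sphere_grad N (cond (pr (hn n))) y i - grad y i) {..<N}) \<le>
        (\<Sum>i<N. ennreal \<bar>cond (An n i) y - cond (A i) y\<bar>)"
        by (simp add: sum_ennreal ennreal_leI)
    qed
    also have "\<dots> = (\<Sum>i<N. \<integral>\<^sup>+y. ennreal \<bar>cond (An n i) y - cond (A i) y\<bar> \<partial>uniform_sphere N)"
      using measurable_cond[OF borel_measurable_integrable[OF integrable_An, simplified]] measurable_cond_A
      by (intro nn_integral_sum) auto
    also have "\<dots> \<le> (\<Sum>i<N. \<integral>\<^sup>+x. ennreal \<bar>An n i x - A i x\<bar> \<partial>tensor_power gauss N)"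
      by (intro sum_mono nn_integral_cond_diff_le integrable_An integrable_A) auto
    finally show ?thesis .
  qed
  have "(\<lambda>n. \<Sum>i<N. \<integral>\<^sup>+x. ennreal \<bar>An n i x - A i x\<bar> \<partial>tensor_power gauss N) \<longlonglongrightarrow> (\<Sum>i<N. 0)"
    by (intro tendsto_sum L1_A) simp
  then have l2: "(\<lambda>n. \<integral>\<^sup>+y. ennreal (L2_set (\<lambda>i. sphere_grad N (cond (pr (hn n))) y i - grad y i) {..<N}) \<partial>uniform_sphere N) \<longlonglongrightarrow> 0"
    by (intro ennreal_tendsto_0_le[OF _ le2]) simp
  show "\<exists>H. (\<forall>n. sphere_C1 N (H n)) \<and>
        (\<lambda>n. \<integral>\<^sup>+y. ennreal \<bar>H n y - cond (pr h) y\<bar> \<partial>uniform_sphere N) \<longlonglongrightarrow> 0 \<and>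
        (\<lambda>n. \<integral>\<^sup>+y. ennreal (L2_set (\<lambda>i. sphere_grad N (H n) y i - grad y i) {..<N}) \<partial>uniform_sphere N) \<longlonglongrightarrow> 0"
    by (intro exI[of _ "\<lambda>n. cond (pr (hn n))"] conjI allI c1 l1 l2)
qed

section \<open>Information of the conditioned density: the upper bound\<close>

definition wd :: "nat \<Rightarrow> nat \<Rightarrow> (nat \<Rightarrow> real) \<Rightarrow> real" where
  "wd i j x = x i * dpr h g j x - x j * dpr h g i x"

lemma integrable_coord_dpr:
  assumes i: "i < N" and j: "j < N"
  shows "integrable (tensor_power gauss N) (\<lambda>x. x i * dpr h g j x)"
proof (rule Bochner_Integration.integrable_bound)
  show "integrable (tensor_power gauss N) (\<lambda>x. sqrt (real N) * A j x)"
    using integrable_A[OF j] by simp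
  show "(\<lambda>x. x i * dpr h g j x) \<in> borel_measurable (tensor_power gauss N)"
    using dpr_measurable[of h g j] i j by simp
  show "AE x in tensor_power gauss N. norm (x i * dpr h g j x) \<le> norm (sqrt (real N) * A j x)"
  proof (rule AE_I2)
    fix x :: "nat \<Rightarrow> real"
    have "(x i)\<^sup>2 \<le> (\<Sum>i<N. (x i)\<^sup>2)" using i by (intro member_le_sum) auto
    then have "\<bar>x i\<bar> \<le> L2_set x {..<N}"
      unfolding L2_set_def by (rule real_le_rsqrt[OF _, of "\<bar>x i\<bar>", simplified])
    then have "\<bar>x i\<bar> * \<bar>dpr h g j x\<bar> \<le> L2_set x {..<N} * \<bar>dpr h g j x\<bar>"
      by (intro mult_right_mono) auto
    then show "norm (x i * dpr h g j x) \<le> norm (sqrt (real N) * A j x)"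
      using N by (simp add: rad_def abs_mult L2_set_nonneg)
  qed
qed

lemma integrable_wd: "i < N \<Longrightarrow> j < N \<Longrightarrow> integrable (tensor_power gauss N) (wd i j)"
  unfolding wd_def[abs_def] by (intro Bochner_Integration.integrable_diff integrable_coord_dpr)

text \<open>\<open>wd i j\<close> is L_ij applied to the product density. Rotations commute with
  dilations: on the ray x = s y the factor s carried by \<open>A\<close> turns \<open>y i\<close>
  into the coordinate \<open>x i\<close>.\<close>

lemma cond_wd:
  assumes i: "i < N" and j: "j < N"
  shows "AE y in uniform_sphere N. y i * cond (A j) y - y j * cond (A i) y = cond (wd i j) y"
  using AE_integrable_cond[OF integrable_A[OF i]] AE_integrable_cond[OF integrable_A[OF j]]
    AE_integrable_cond[OF integrable_wd[OF i j]] AE_uniform_sphere_kac_sphere[OF N]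
proof eventually_elim
  fix y assume a: "integrable K (\<lambda>s. A i (scl N s y))" "integrable K (\<lambda>s. A j (scl N s y))"
    "integrable K (\<lambda>s. wd i j (scl N s y))" and y: "y \<in> kac_sphere N"
  have "y i * cond (A j) y - y j * cond (A i) y = (\<integral>s. y i * A j (scl N s y) - y j * A i (scl N s y) \<partial>K)"
    unfolding cond_def using a by simp
  also have "\<dots> = (\<integral>s. wd i j (scl N s y) \<partial>K)"
  proof (rule integral_cong_AE)
    have "integrable K (\<lambda>s. y i * A j (scl N s y) - y j * A i (scl N s y))"
      using a by simp
    then show "(\<lambda>s. y i * A j (scl N s y) - y j * A i (scl N s y)) \<in> borel_measurable K"
      by (rule borel_measurable_integrable)
    show "(\<lambda>s. wd i j (scl N s y)) \<in> borel_measurable K" using a(3) by (rule borel_measurable_integrable)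
    show "AE s in K. y i * A j (scl N s y) - y j * A i (scl N s y) = wd i j (scl N s y)"
      using K_pos by eventually_elim (simp add: i j rad_scl[OF y] wd_def algebra_simps)
  qed
  finally show "y i * cond (A j) y - y j * cond (A i) y = cond (wd i j) y" by (simp add: cond_def)
qed

lemma wd_factor:
  assumes ij: "i < N" "j < N" "i \<noteq> j"
  shows "wd i j x = (\<Prod>k\<in>{..<N}-{i}-{j}. h (x k)) * (x i * h (x i) * g (x j) - x j * h (x j) * g (x i))"
proof -
  have 1: "dpr h g j x = g (x j) * (h (x i) * (\<Prod>k\<in>{..<N}-{i}-{j}. h (x k)))"
    using ij by (subst dpr_eq_prod, simp, subst prod_split_two[OF ij]) (auto intro!: prod.cong)
  have 2: "dpr h g i x = g (x i) * (h (x j) * (\<Prod>k\<in>{..<N}-{i}-{j}. h (x k)))"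
    using ij by (subst dpr_eq_prod, simp, subst prod_split_two[OF ij]) (auto intro!: prod.cong)
  show ?thesis unfolding wd_def 1 2 by (simp add: algebra_simps)
qed

text \<open>The cross terms do not involve \<open>x\<^sup>2 g\<^sup>2 / h\<close>, which need not be integrable.\<close>
lemma wd_sq_eq:
  assumes ij: "i < N" "j < N" "i \<noteq> j"
  shows "(wd i j x)\<^sup>2 / pr h x = (\<Prod>k\<in>{..<N}-{i}-{j}. h (x k)) *
    ((x i)\<^sup>2 * h (x i) * q (x j) + (x j)\<^sup>2 * h (x j) * q (x i) - 2 * ((x i * g (x i)) * (x j * g (x j))))"
proof -
  define R where "R = (\<Prod>k\<in>{..<N}-{i}-{j}. h (x k))"
  have pr: "pr h x = h (x i) * (h (x j) * R)"
    unfolding pr_def R_def by (rule prod_split_two[OF ij])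
  have wd: "wd i j x = R * (x i * h (x i) * g (x j) - x j * h (x j) * g (x i))"
    unfolding R_def by (rule wd_factor[OF ij])
  show ?thesis
  proof (cases "h (x i) = 0 \<or> h (x j) = 0 \<or> R = 0")
    case True
    then show ?thesis
      using g_zero[of "x i"] g_zero[of "x j"] unfolding R_def[symmetric] pr wd q_def by auto
  next
    case False
    then show ?thesis
      unfolding R_def[symmetric] pr wd q_def by (simp add: power2_eq_square field_simps)
  qed
qed

lemma nn_integral_wd_sq:
  assumes ij: "i < N" "j < N" "i \<noteq> j"
  shows "(\<integral>\<^sup>+x. ennreal ((wd i j x)\<^sup>2 / pr h x) \<partial>tensor_power gauss N) \<le> ennreal (2 * I)"
proof -
  let ?G = "tensor_power gauss N"
  \<comment> \<open>\<open>T a b\<close> puts a at coordinate i, b at coordinate j and h, whose mean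
    is 1, at all others; its integral is the product of the means of a and b.\<close>
  define T where "T a b x = (\<Prod>k<N. (if k = i then a else if k = j then b else h) (x k))" for a b :: "real \<Rightarrow> real" and x
  have T_eq: "T a b x = a (x i) * (b (x j) * (\<Prod>k\<in>{..<N}-{i}-{j}. h (x k)))" for a b x
    unfolding T_def using ij by (subst prod_split_two[OF ij]) (auto intro!: prod.cong)
  have T: "integrable ?G (T a b)" "(\<integral>x. T a b x \<partial>?G) = (\<integral>x. a x \<partial>gauss) * (\<integral>x. b x \<partial>gauss)"
    if ab: "integrable gauss a" "integrable gauss b" for a b
  proof -
    have int: "integrable gauss (if k = i then a else if k = j then b else h)" for k
      using ab integrable_h by auto
    show "integrable ?G (T a b)"
      unfolding T_def[abs_def] by (rule integrable_tensor_power_prod(1)[OF int])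
    have "(\<integral>x. T a b x \<partial>?G) = (\<Prod>k<N. \<integral>x. (if k = i then a else if k = j then b else h) x \<partial>gauss)"
      unfolding T_def by (rule integrable_tensor_power_prod(2)[OF int])
    also have "\<dots> = (\<integral>x. a x \<partial>gauss) * (\<integral>x. b x \<partial>gauss)"
      using ij by (subst prod_split_two[OF ij]) (auto simp: integral_h intro!: prod.neutral)
    finally show "(\<integral>x. T a b x \<partial>?G) = (\<integral>x. a x \<partial>gauss) * (\<integral>x. b x \<partial>gauss)" .
  qed
  define T1 where "T1 = T (\<lambda>t. t\<^sup>2 * h t) q"
  define T2 where "T2 = T q (\<lambda>t. t\<^sup>2 * h t)"
  define T3 where "T3 = T (\<lambda>t. t * g t) (\<lambda>t. t * g t)"
  have int: "integrable ?G T1" "integrable ?G T2" "integrable ?G T3"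
    unfolding T1_def T2_def T3_def by (intro T(1) integrable_x2h integrable_q integrable_xg)+
  have val: "(\<integral>x. T1 x \<partial>?G) = I" "(\<integral>x. T2 x \<partial>?G) = I" "(\<integral>x. T3 x \<partial>?G) = (\<integral>x. x * g x \<partial>gauss)\<^sup>2"
    unfolding T1_def T2_def T3_def I_def
    by (simp_all add: T(2) integrable_x2h integrable_q integrable_xg integral_x2h
        power2_eq_square[of "\<integral>x. x * g x \<partial>gauss"])
  have eq: "(wd i j x)\<^sup>2 / pr h x = T1 x + T2 x - 2 * T3 x" for x
    unfolding wd_sq_eq[OF ij] T1_def T2_def T3_def T_eq by (simp add: algebra_simps)
  have "(\<integral>\<^sup>+x. ennreal ((wd i j x)\<^sup>2 / pr h x) \<partial>?G) = ennreal (\<integral>x. T1 x + T2 x - 2 * T3 x \<partial>?G)"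
    unfolding eq
  proof (rule nn_integral_eq_integral)
    show "integrable ?G (\<lambda>x. T1 x + T2 x - 2 * T3 x)" using int by simp
    show "AE x in ?G. 0 \<le> T1 x + T2 x - 2 * T3 x"
      unfolding eq[symmetric] by (rule AE_I2) (simp add: pr_nonneg)
  qed
  also have "(\<integral>x. T1 x + T2 x - 2 * T3 x \<partial>?G) = I + I - 2 * (\<integral>x. x * g x \<partial>gauss)\<^sup>2"
    using int by (simp add: val)
  \<comment> \<open>The cross term has become minus twice a square and is dropped.\<close>
  also have "ennreal \<dots> \<le> ennreal (2 * I)" by (intro ennreal_leI) simp
  finally show ?thesis .
qed

lemma tensor_power_density:
  "tensor_power (density gauss (\<lambda>x. ennreal (h x))) N = density (tensor_power gauss N) (\<lambda>x. ennreal (pr h x))"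
proof -
  interpret G: prob_space gauss by (rule prob_space_gauss)
  interpret D: prob_space "density gauss (\<lambda>x. ennreal (h x))" by (rule prob_space_density)
  have "tensor_power (density gauss (\<lambda>x. ennreal (h x))) N = density (tensor_power gauss N) (\<lambda>x. \<Prod>i<N. ennreal (h (x i)))"
    unfolding tensor_power_def
    using G.sigma_finite_measure_axioms D.sigma_finite_measure_axioms by (intro PiM_density_const) auto
  then show ?thesis by (simp add: prod_ennreal h_nonneg pr_def)
qed

text \<open>One admissible pair bounds the infimum. The diagonal fields vanish, and each of the N (N
  - 1) others contributes at most 2 I / (2 N).\<close>

lemma sphere_fisher_upper:
  "sphere_fisher N (rescaled_tensor (density gauss (\<lambda>x. ennreal (h x))) N) \<le> ennreal (real (N - 1) * I)"
proof -
  let ?U = "uniform_sphere N"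
  have "sphere_fisher N (rescaled_tensor (density gauss (\<lambda>x. ennreal (h x))) N) \<le>
     (\<integral>\<^sup>+y. ennreal ((L2_set (grad y) {..<N})\<^sup>2 / cond (pr h) y) \<partial>?U)"
    unfolding sphere_fisher_def
  proof (rule Inf_lower, intro CollectI exI conjI)
    show "cond (pr h) \<in> borel_measurable (Rn N)" by (intro measurable_cond) simp
    show "\<forall>y. 0 \<le> cond (pr h) y" unfolding cond_def by (simp add: pr_nonneg)
    show "has_weak_sphere_grad N (cond (pr h)) grad" by (rule weak_sphere_grad)
    show "rescaled_tensor (density gauss (\<lambda>x. ennreal (h x))) N = density ?U (\<lambda>y. ennreal (cond (pr h) y))"
      by (rule rescaled_tensor_eq_density[OF integrable_pr[OF integrable_h] pr_nonneg tensor_power_density])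
  qed simp
  also have "\<dots> = (\<integral>\<^sup>+y. (\<Sum>i<N. \<Sum>j<N. ennreal (1 / (2 * real N)) * ennreal ((cond (wd i j) y)\<^sup>2 / cond (pr h) y)) \<partial>?U)"
  proof (rule nn_integral_cong_AE)
    have "AE y in ?U. \<forall>i\<in>{..<N}. \<forall>j\<in>{..<N}. y i * cond (A j) y - y j * cond (A i) y = cond (wd i j) y"
      using cond_wd by (intro AE_finite_allI) auto
    then show "AE y in ?U. ennreal ((L2_set (grad y) {..<N})\<^sup>2 / cond (pr h) y) =
       (\<Sum>i<N. \<Sum>j<N. ennreal (1 / (2 * real N)) * ennreal ((cond (wd i j) y)\<^sup>2 / cond (pr h) y))"
      using AE_uniform_sphere_kac_sphere[OF N]
    proof eventually_elim
      fix y assume w: "\<forall>i\<in>{..<N}. \<forall>j\<in>{..<N}. y i * cond (A j) y - y j * cond (A i) y = cond (wd i j) y"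
        and y: "y \<in> kac_sphere N"
      have c0: "cond (pr h) y \<ge> 0" unfolding cond_def by (simp add: pr_nonneg)
      have "(L2_set (grad y) {..<N})\<^sup>2 = (\<Sum>i<N. \<Sum>j<N. (y i * cond (A j) y - y j * cond (A i) y)\<^sup>2) / (2 * real N)"
        unfolding L2_set_sq grad_def by (rule sum_tang_sq[OF y N])
      also have "\<dots> = (\<Sum>i<N. \<Sum>j<N. (cond (wd i j) y)\<^sup>2) / (2 * real N)"
        using w by (intro arg_cong2[of _ _ _ _ "(/)"] sum.cong refl) auto
      finally have "(L2_set (grad y) {..<N})\<^sup>2 / cond (pr h) y =
         (\<Sum>i<N. \<Sum>j<N. 1 / (2 * real N) * ((cond (wd i j) y)\<^sup>2 / cond (pr h) y))"
        by (simp add: sum_distrib_left[symmetric] sum_divide_distrib[symmetric])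
      then show "ennreal ((L2_set (grad y) {..<N})\<^sup>2 / cond (pr h) y) =
       (\<Sum>i<N. \<Sum>j<N. ennreal (1 / (2 * real N)) * ennreal ((cond (wd i j) y)\<^sup>2 / cond (pr h) y))"
        using c0 by (simp add: ennreal_mult[symmetric] sum_ennreal sum_nonneg)
    qed
  qed
  also have "\<dots> = (\<Sum>i<N. \<Sum>j<N. ennreal (1 / (2 * real N)) * (\<integral>\<^sup>+y. ennreal ((cond (wd i j) y)\<^sup>2 / cond (pr h) y) \<partial>?U))"
  proof -
    have m: "(\<lambda>y. ennreal ((cond (wd i j) y)\<^sup>2 / cond (pr h) y)) \<in> borel_measurable (Rn N)" if "i < N" "j < N" for i j
    proof -
      have [measurable]: "cond (wd i j) \<in> borel_measurable (Rn N)" "cond (pr h) \<in> borel_measurable (Rn N)"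
        using borel_measurable_integrable[OF integrable_wd[OF that]] by (auto intro!: measurable_cond)
      show ?thesis by measurable
    qed
    have "(\<integral>\<^sup>+y. (\<Sum>i<N. \<Sum>j<N. ennreal (1 / (2 * real N)) * ennreal ((cond (wd i j) y)\<^sup>2 / cond (pr h) y)) \<partial>?U) =
      (\<Sum>i<N. \<integral>\<^sup>+y. (\<Sum>j<N. ennreal (1 / (2 * real N)) * ennreal ((cond (wd i j) y)\<^sup>2 / cond (pr h) y)) \<partial>?U)"
      by (rule nn_integral_sum) (auto intro!: borel_measurable_sum borel_measurable_times_ennreal m)
    also have "\<dots> = (\<Sum>i<N. \<Sum>j<N. \<integral>\<^sup>+y. ennreal (1 / (2 * real N)) * ennreal ((cond (wd i j) y)\<^sup>2 / cond (pr h) y) \<partial>?U)"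
      by (intro sum.cong refl nn_integral_sum) (auto intro!: borel_measurable_times_ennreal m)
    also have "\<dots> = (\<Sum>i<N. \<Sum>j<N. ennreal (1 / (2 * real N)) * (\<integral>\<^sup>+y. ennreal ((cond (wd i j) y)\<^sup>2 / cond (pr h) y) \<partial>?U))"
      by (intro sum.cong refl nn_integral_cmult) (auto intro!: m)
    finally show ?thesis .
  qed
  also have "\<dots> \<le> (\<Sum>i<N. \<Sum>j<N. ennreal (1 / (2 * real N)) * (if i = j then 0 else ennreal (2 * I)))"
  proof (intro sum_mono mult_left_mono)
    fix i j assume "i \<in> {..<N}" "j \<in> {..<N}"
    then have i: "i < N" and j: "j < N" by auto
    show "(\<integral>\<^sup>+y. ennreal ((cond (wd i j) y)\<^sup>2 / cond (pr h) y) \<partial>?U) \<le> (if i = j then 0 else ennreal (2 * I))"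
    proof (cases "i = j")
      case False
      have "(\<integral>\<^sup>+y. ennreal ((cond (wd i j) y)\<^sup>2 / cond (pr h) y) \<partial>?U) \<le> (\<integral>\<^sup>+x. ennreal ((wd i j x)\<^sup>2 / pr h x) \<partial>tensor_power gauss N)"
      proof (rule jensen_cond[OF integrable_pr[OF integrable_h] pr_nonneg integrable_wd[OF i j]])
        \<comment> \<open>The side condition of Jensen's inequality: whichever factor vanishes, g
          vanishes together with h, so every term of \<open>wd\<close> is 0.\<close>
        fix x assume "pr h x = 0"
        then have "h (x i) * (h (x j) * (\<Prod>k\<in>{..<N}-{i}-{j}. h (x k))) = 0"
          unfolding pr_def using prod_split_two[OF i j False, of "\<lambda>k. h (x k)"] by simp
        then have "h (x i) = 0 \<or> h (x j) = 0 \<or> (\<Prod>k\<in>{..<N}-{i}-{j}. h (x k)) = 0" by (simp only: mult_eq_0_iff)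
        then show "wd i j x = 0"
          unfolding wd_factor[OF i j False] using g_zero[of "x i"] g_zero[of "x j"] by auto
      qed
      also have "\<dots> \<le> ennreal (2 * I)" by (rule nn_integral_wd_sq[OF i j False])
      finally show ?thesis using False by simp
    next
      case True
      then show ?thesis by (simp add: wd_def[abs_def] cond_def)
    qed
  qed simp
  also have "\<dots> = ennreal (\<Sum>i<N. \<Sum>j<N. 1 / (2 * real N) * (if i = j then 0 else 2 * I))"
  proof -
    define t where "t i j = 1 / (2 * real N) * (if i = j then 0 else 2 * I)" for i j :: nat
    have t0: "t i j \<ge> 0" for i j using I_nonneg by (simp add: t_def)
    have "ennreal (1 / (2 * real N)) * (if i = j then 0 else ennreal (2 * I)) = ennreal (t i j)" for i j
      using I_nonneg unfolding t_def by (cases "i = j") (simp_all add: ennreal_mult'[symmetric])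
    moreover have "(\<Sum>i<N. \<Sum>j<N. ennreal (t i j)) = (\<Sum>i<N. ennreal (\<Sum>j<N. t i j))"
      by (intro sum.cong refl sum_ennreal t0)
    moreover have "\<dots> = ennreal (\<Sum>i<N. \<Sum>j<N. t i j)"
      by (intro sum_ennreal sum_nonneg t0)
    ultimately show ?thesis unfolding t_def by (simp only:)
  qed
  also have "(\<Sum>i<N. \<Sum>j<N. 1 / (2 * real N) * (if i = j then 0 else 2 * I)) = real (N - 1) * I"
  proof -
    have "(\<Sum>j<N. 1 / (2 * real N) * (if i = j then 0 else 2 * I)) = real (N - 1) * (I / real N)" if "i < N" for i
    proof -
      have "(\<Sum>j<N. 1 / (2 * real N) * (if i = j then 0 else 2 * I)) = (\<Sum>j\<in>{..<N}-{i}. 1 / (2 * real N) * (if i = j then 0 else 2 * I))"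
        using that by (subst sum.remove[of _ i]) auto
      also have "\<dots> = (\<Sum>j\<in>{..<N}-{i}. I / real N)" using N by (intro sum.cong) auto
      also have "\<dots> = real (N - 1) * (I / real N)" using that by simp
      finally show ?thesis .
    qed
    then show ?thesis using N by simp
  qed
  finally show ?thesis .
qed

end

subsection \<open>Kac chaos of the rescaled tensor product\<close>

lemma tendsto_coordinatewise:
  fixes u :: "'a \<Rightarrow> nat \<Rightarrow> real"
  assumes "\<And>i. ((\<lambda>n. u n i) \<longlongrightarrow> a i) F"
  shows "(u \<longlongrightarrow> a) F"
proof -
  have "limitin (product_topology (\<lambda>_. euclidean) UNIV) u a F"
    unfolding limitin_componentwise using assms by (simp add: extensional_UNIV)
  then show ?thesis by (simp add: euclidean_product_topology)
qed

text \<open>The extensional functions form a closed set in the function topology, so extension by 0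
  makes the function Borel.\<close>

lemma measurable_continuous_extensional:
  fixes \<phi> :: "(nat \<Rightarrow> real) \<Rightarrow> real"
  assumes "continuous_on (extensional {..<k}) \<phi>"
  shows "\<phi> \<in> borel_measurable (Rn k)"
proof -
  have "closed (\<Inter>i\<in>{k..}. {x :: nat \<Rightarrow> real. x i = undefined})"
    by (intro closed_INT ballI closed_Collect_eq continuous_intros)
  moreover have "(\<Inter>i\<in>{k..}. {x :: nat \<Rightarrow> real. x i = undefined}) = extensional {..<k}"
    by (auto simp: extensional_def not_less)
  ultimately have "closed (extensional {..<k} :: (nat \<Rightarrow> real) set)" by simp
  then have "(\<lambda>x. indicator (extensional {..<k}) x *\<^sub>R \<phi> x) \<in> borel_measurable borel"
    using assms by (intro borel_measurable_continuous_on_indicator) auto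
  then have "(\<lambda>x. indicator (extensional {..<k}) x *\<^sub>R \<phi> x) \<in> borel_measurable (Rn k)"
    using measurable_compose[OF borel_measurable_id_Rn] by simp
  then show ?thesis
    by (rule measurable_cong[THEN iffD1, rotated]) simp
qed

text \<open>Squeezed by \<open>1 - t \<le> exp (- t)\<close> and its companion
  \<open>exp (- (t / (1 - t))) \<le> 1 - t\<close>, taken at t = a n / n and raised to the power
  n.\<close>

lemma tendsto_power_one_minus_div:
  fixes a :: "nat \<Rightarrow> real"
  assumes a: "a \<longlonglongrightarrow> l" and a0: "\<And>n. 0 \<le> a n"
  shows "(\<lambda>n. (1 - a n / real n) ^ n) \<longlonglongrightarrow> exp (- l)"
proof (rule tendsto_sandwich)
  have an: "(\<lambda>n. a n / real n) \<longlonglongrightarrow> 0"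
    using tendsto_mult[OF a lim_inverse_n] by (simp add: divide_inverse)
  have ev: "eventually (\<lambda>n. a n / real n < 1) sequentially"
    by (rule order_tendstoD[OF an]) simp
  show "eventually (\<lambda>n. (1 - a n / real n) ^ n \<le> exp (- a n)) sequentially"
    using ev eventually_gt_at_top[of 0]
  proof eventually_elim
    case (elim n)
    have "1 - a n / real n \<le> exp (- (a n / real n))" using exp_ge_add_one_self[of "- (a n / real n)"] by simp
    then have "(1 - a n / real n) ^ n \<le> exp (- (a n / real n)) ^ n" using elim by (intro power_mono) auto
    also have "\<dots> = exp (- a n)" using elim by (simp add: exp_of_nat_mult[symmetric])
    finally show ?case .
  qed
  show "eventually (\<lambda>n. exp (- (a n / (1 - a n / real n))) \<le> (1 - a n / real n) ^ n) sequentially"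
    using ev eventually_gt_at_top[of 0]
  proof eventually_elim
    case (elim n)
    define t where "t = a n / real n"
    have t: "t < 1" using elim by (simp add: t_def)
    have "1 / (1 - t) = 1 + t / (1 - t)" using t by (simp add: field_simps)
    also have "\<dots> \<le> exp (t / (1 - t))" by (rule exp_ge_add_one_self)
    finally have "inverse (exp (t / (1 - t))) \<le> inverse (1 / (1 - t))" using t by (intro le_imp_inverse_le) auto
    then have "exp (- (t / (1 - t))) \<le> 1 - t" by (simp add: exp_minus)
    then have "exp (- (t / (1 - t))) ^ n \<le> (1 - t) ^ n" by (intro power_mono) auto
    moreover have "exp (- (t / (1 - t))) ^ n = exp (- (a n / (1 - a n / real n)))"
      using elim by (simp add: exp_of_nat_mult[symmetric] t_def)
    ultimately show ?case by (simp add: t_def)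
  qed
  show "(\<lambda>n. exp (- a n)) \<longlonglongrightarrow> exp (- l)" by (intro tendsto_intros a)
  have "(\<lambda>n. exp (- (a n / (1 - a n / real n)))) \<longlonglongrightarrow> exp (- (l / (1 - 0)))"
    by (intro tendsto_intros a an) simp
  then show "(\<lambda>n. exp (- (a n / (1 - a n / real n)))) \<longlonglongrightarrow> exp (- l)" by simp
qed

text \<open>Convergence in L^2 yields almost everywhere convergence only along subsequences; this
  criterion makes that enough.\<close>

lemma LIMSEQ_if_subsubseq:
  fixes X :: "nat \<Rightarrow> real"
  assumes "\<And>r :: nat \<Rightarrow> nat. strict_mono r \<Longrightarrow> \<exists>s :: nat \<Rightarrow> nat. strict_mono s \<and> (\<lambda>n. X (r (s n))) \<longlonglongrightarrow> L"
  shows "X \<longlonglongrightarrow> L"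
proof (rule ccontr)
  assume "\<not> X \<longlonglongrightarrow> L"
  then obtain e where e: "e > 0" "\<not> eventually (\<lambda>n. dist (X n) L < e) sequentially"
    unfolding tendsto_iff by blast
  then have inf: "infinite {n. dist (X n) L \<ge> e}"
    unfolding infinite_nat_iff_unbounded_le eventually_sequentially by (auto simp: not_less)
  then obtain r :: "nat \<Rightarrow> nat" where r: "strict_mono r" "\<And>n. dist (X (r n)) L \<ge> e"
    using infinite_enumerate[OF inf] by auto
  obtain s :: "nat \<Rightarrow> nat" where s: "(\<lambda>n. X (r (s n))) \<longlonglongrightarrow> L" using assms[OF r(1)] by blast
  then have "eventually (\<lambda>n. dist (X (r (s n))) L < e) sequentially"
    using e(1) by (rule tendstoD)
  then show False using r(2) by (auto simp: eventually_sequentially not_less[symmetric])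
qed

section \<open>Laws with unit second moment and no atom at the origin\<close>

locale unit_variance =
  fixes \<mu> :: "real measure"
  assumes prob_mu: "prob_space \<mu>" and sets_mu: "sets \<mu> = sets borel"
    and second_moment: "has_bochner_integral \<mu> (\<lambda>x. x\<^sup>2) 1"
    and no_atom: "emeasure \<mu> {0} = 0"
begin

sublocale M: prob_space \<mu> by (rule prob_mu)

lemma measurable_mu [simp]: "measurable \<mu> X = measurable borel X"
  by (rule measurable_cong_sets[OF sets_mu refl])

lemma measurable_tp [simp]: "measurable (tensor_power \<mu> N) X = measurable (Rn N) X"
  by (rule measurable_cong_sets[OF sets_tensor_power[OF sets_mu] refl])

lemma measurable_into_tp [simp]: "measurable X (tensor_power \<mu> N) = measurable X (Rn N)"
  by (rule measurable_cong_sets[OF refl sets_tensor_power[OF sets_mu]])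

lemma space_mu [simp]: "space \<mu> = UNIV"
  using sets_eq_imp_space_eq[OF sets_mu] by simp

lemma prob_UNIV [simp]: "M.prob UNIV = 1"
  using M.prob_space by simp

lemma prob_rescaled: "prob_space (rescaled_tensor \<mu> N)"
proof -
  interpret T: prob_space "tensor_power \<mu> N" by (rule prob_space_tensor_power[OF prob_mu])
  show ?thesis unfolding rescaled_tensor_def by (rule T.prob_space_distr) simp
qed

lemma prob_on_rescaled: "prob_on_Rn N (rescaled_tensor \<mu> N)"
  using prob_rescaled by (simp add: prob_on_Rn_def rescaled_tensor_def)

lemma distr_tensor_power_perm:
  assumes p: "p permutes {..<N}"
  shows "distr (tensor_power \<mu> N) (Rn N) (\<lambda>x. \<lambda>i\<in>{..<N}. x (p i)) = tensor_power \<mu> N"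
proof -
  have "distr (PiM {..<N} (\<lambda>_. \<mu>)) (PiM {..<N} (\<lambda>_. \<mu>)) (\<lambda>x. \<lambda>i\<in>{..<N}. x (p i)) = PiM {..<N} (\<lambda>_. \<mu>)"
    using p prob_mu permutes_inj_on[OF p] permutes_in_image[OF p]
    by (intro distr_PiM_reindex[where M = "\<lambda>_. \<mu>"]) auto
  moreover have "distr (PiM {..<N} (\<lambda>_. \<mu>)) (PiM {..<N} (\<lambda>_. \<mu>)) (\<lambda>x. \<lambda>i\<in>{..<N}. x (p i)) =
     distr (PiM {..<N} (\<lambda>_. \<mu>)) (Rn N) (\<lambda>x. \<lambda>i\<in>{..<N}. x (p i))"
    using sets_tensor_power[OF sets_mu, of N] by (intro distr_cong) (auto simp: tensor_power_def)
  ultimately show ?thesis by (simp add: tensor_power_def)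
qed

lemma measurable_perm:
  assumes p: "p permutes {..<N}"
  shows "(\<lambda>x. \<lambda>i\<in>{..<N}. x (p i)) \<in> measurable (Rn N) (Rn N)"
proof (rule measurable_restrict_Rn)
  fix i assume "i < N"
  then have "p i < N" using permutes_in_image[OF p, of i] by simp
  then show "(\<lambda>x. x (p i)) \<in> borel_measurable (Rn N)" by simp
qed

text \<open>The norm is symmetric, so permuting coordinates commutes with the projection, and the
  product law is invariant.\<close>

lemma perm_invariant_rescaled: "perm_invariant N (rescaled_tensor \<mu> N)"
  unfolding perm_invariant_def
proof (intro allI impI)
  fix p assume p: "p permutes {..<N}"
  let ?P = "\<lambda>x :: nat \<Rightarrow> real. \<lambda>i\<in>{..<N}. x (p i)"
  note mP = measurable_perm[OF p]
  have L: "L2_set (?P x) {..<N} = L2_set x {..<N}" for x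
  proof -
    have "(\<Sum>i<N. (?P x i)\<^sup>2) = (\<Sum>i<N. ((\<lambda>i. (x i)\<^sup>2) \<circ> p) i)" by (intro sum.cong) auto
    also have "\<dots> = (\<Sum>i<N. (x i)\<^sup>2)" by (rule sum.permute[OF p, symmetric])
    finally show ?thesis by (simp add: L2_set_def)
  qed
  have comm: "?P (to_sphere N x) = to_sphere N (?P x)" for x
    using permutes_in_image[OF p] unfolding to_sphere_def L by (auto simp: fun_eq_iff)
  have "distr (rescaled_tensor \<mu> N) (Rn N) ?P = distr (tensor_power \<mu> N) (Rn N) (?P \<circ> to_sphere N)"
    unfolding rescaled_tensor_def using mP by (intro distr_distr) auto
  also have "?P \<circ> to_sphere N = to_sphere N \<circ> ?P" by (rule ext) (simp only: o_apply comm)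
  also have "distr (tensor_power \<mu> N) (Rn N) (to_sphere N \<circ> ?P) = distr (distr (tensor_power \<mu> N) (Rn N) ?P) (Rn N) (to_sphere N)"
    using mP by (intro distr_distr[symmetric]) auto
  also have "\<dots> = rescaled_tensor \<mu> N"
    unfolding distr_tensor_power_perm[OF p] rescaled_tensor_def ..
  finally show "distr (rescaled_tensor \<mu> N) (Rn N) ?P = rescaled_tensor \<mu> N" .
qed

text \<open>A single coordinate already avoids 0 almost surely, so the point has a
  direction.\<close>

lemma AE_tensor_L2_set:
  assumes N: "N \<ge> 1"
  shows "AE x in tensor_power \<mu> N. L2_set x {..<N} \<noteq> 0"
proof -
  have "AE t in \<mu>. t \<noteq> 0"
    using no_atom by (intro AE_I[of _ _ "{0}"]) (auto simp: sets_mu)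
  moreover have "distr (tensor_power \<mu> N) \<mu> (\<lambda>x. x 0) = \<mu>"
    using N by (intro distr_tensor_power_component[OF prob_mu]) simp
  ultimately have "AE t in distr (tensor_power \<mu> N) \<mu> (\<lambda>x. x 0). t \<noteq> 0"
    by (simp only:)
  moreover have "(\<lambda>x. x 0) \<in> measurable (tensor_power \<mu> N) \<mu>"
    unfolding tensor_power_def using N by (intro measurable_component_singleton) auto
  ultimately have "AE x in tensor_power \<mu> N. x 0 \<noteq> 0"
    by (subst (asm) AE_distr_iff) (auto simp: sets_mu)
  then show ?thesis
  proof eventually_elim
    case (elim x)
    then show ?case using L2_set_eq_0_iff[of "{..<N}" x] N by auto
  qed
qed

lemma AE_rescaled_kac_sphere:
  assumes N: "N \<ge> 1"
  shows "AE y in rescaled_tensor \<mu> N. y \<in> kac_sphere N"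
  unfolding rescaled_tensor_def
proof (subst AE_distr_iff)
  show "{x \<in> space (Rn N). x \<in> kac_sphere N} \<in> sets (Rn N)"
    using sets_kac_sphere[of N] by (simp add: kac_sphere_def conj_commute cong: conj_cong)
  show "AE x in tensor_power \<mu> N. to_sphere N x \<in> kac_sphere N"
    using AE_tensor_L2_set[OF N] by eventually_elim (rule to_sphere_in_kac_sphere)
qed simp

text \<open>The infinite product realizes all N on one probability space, so that the norms for
  different N converge pointwise along subsequences.\<close>

abbreviation P :: "(nat \<Rightarrow> real) measure" where "P \<equiv> PiM UNIV (\<lambda>_. \<mu>)"

lemma prob_P: "prob_space P"
  by (rule prob_space_PiM) (rule prob_mu)

lemma measurable_P_comp [measurable]: "(\<lambda>x. x i) \<in> borel_measurable P"
  using measurable_component_singleton[of i UNIV "\<lambda>_. \<mu>"] measurable_cong_sets[OF refl sets_mu, of P] by simp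

lemma measurable_P_restrict: "(\<lambda>x. \<lambda>i\<in>{..<N}. x i) \<in> measurable P (Rn N)"
  by (rule measurable_restrict_Rn) measurable

lemma tensor_power_distr: "tensor_power \<mu> N = distr P (Rn N) (\<lambda>x. \<lambda>i\<in>{..<N}. x i)"
proof -
  have "distr P (PiM {..<N} (\<lambda>_. \<mu>)) (\<lambda>x. \<lambda>i\<in>{..<N}. x (id i)) = PiM {..<N} (\<lambda>_. \<mu>)"
    using prob_mu by (intro distr_PiM_reindex[where M = "\<lambda>_. \<mu>"]) auto
  moreover have "distr P (PiM {..<N} (\<lambda>_. \<mu>)) (\<lambda>x. \<lambda>i\<in>{..<N}. x i) = distr P (Rn N) (\<lambda>x. \<lambda>i\<in>{..<N}. x i)"
    using sets_tensor_power[OF sets_mu, of N] by (intro distr_cong) (auto simp: tensor_power_def)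
  ultimately show ?thesis by (simp add: tensor_power_def)
qed

text \<open>A bounded substitute for the mean of the squares, which may have infinite variance
  because no fourth moment is assumed. The logarithm recovers the mean.\<close>

definition Z :: "nat \<Rightarrow> (nat \<Rightarrow> real) \<Rightarrow> real" where
  "Z N x = exp (- (\<Sum>i<N. (x i)\<^sup>2) / real N)"

lemma Z_measurable [measurable]: "Z N \<in> borel_measurable P"
  unfolding Z_def[abs_def] by measurable

lemma Z_bound: "0 \<le> Z N x" "Z N x \<le> 1"
  by (auto simp: Z_def sum_nonneg divide_nonneg_nonneg)

text \<open>Independence makes the m-th moment \<open>c N ^ N\<close>, where \<open>c N\<close> is
  the Laplace transform of t^2 at m / N. As 1 - exp (- u) is at most u and of first order equal to
  u, N (1 - c N) tends to m times the second moment.\<close>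

lemma laplace_Z: "(\<lambda>N. \<integral>x. Z N x ^ m \<partial>P) \<longlonglongrightarrow> exp (- real m)"
proof -
  define c where "c N = (\<integral>t. exp (- (real m * t\<^sup>2 / real N)) \<partial>\<mu>)" for N :: nat
  have ci: "integrable \<mu> (\<lambda>t. exp (- (real m * t\<^sup>2 / real N)))" for N
    by (rule M.integrable_const_bound[of _ 1]) (auto intro!: AE_I2 simp: divide_nonneg_nonneg)
  have eqc: "(\<integral>x. Z N x ^ m \<partial>P) = c N ^ N" for N
  proof -
    interpret product_sigma_finite "\<lambda>_::nat. \<mu>" by standard
    have meas: "(\<lambda>x. \<Prod>i<N. exp (- (real m * (x i)\<^sup>2 / real N))) \<in> borel_measurable (Rn N)"
      by (intro borel_measurable_prod) auto
    have "Z N x ^ m = (\<Prod>i<N. exp (- (real m * ((\<lambda>i\<in>{..<N}. x i) i)\<^sup>2 / real N)))" for x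
      by (simp add: Z_def exp_of_nat_mult[symmetric] exp_sum[symmetric] sum_negf sum_divide_distrib sum_distrib_left)
    then have "(\<integral>x. Z N x ^ m \<partial>P) = (\<integral>x. (\<Prod>i<N. exp (- (real m * (x i)\<^sup>2 / real N))) \<partial>tensor_power \<mu> N)"
      unfolding tensor_power_distr using meas measurable_P_restrict by (subst integral_distr) auto
    also have "\<dots> = (\<Prod>i<N. c N)"
      unfolding tensor_power_def c_def using ci by (intro product_integral_prod) auto
    finally show ?thesis by simp
  qed
  have limc: "(\<lambda>N. (1 - (real N * (1 - c N)) / real N) ^ N) \<longlonglongrightarrow> exp (- real m)"
  proof (rule tendsto_power_one_minus_div)
    have c1: "c N \<le> 1" for N
    proof -
      have "c N \<le> (\<integral>t. 1 \<partial>\<mu>)"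
        unfolding c_def using ci by (intro integral_mono) (auto simp: divide_nonneg_nonneg)
      then show ?thesis using M.prob_space by simp
    qed
    then show "0 \<le> real N * (1 - c N)" for N by simp
    have "(\<lambda>N. \<integral>t. real N * (1 - exp (- (real m * t\<^sup>2 / real N))) \<partial>\<mu>) \<longlonglongrightarrow> (\<integral>t. real m * t\<^sup>2 \<partial>\<mu>)"
    proof (rule integral_dominated_convergence[where w = "\<lambda>t. real m * t\<^sup>2"])
      show "integrable \<mu> (\<lambda>t. real m * t\<^sup>2)"
        using second_moment by (auto simp: has_bochner_integral_iff)
      show "AE t in \<mu>. norm (real N * (1 - exp (- (real m * t\<^sup>2 / real N)))) \<le> real m * t\<^sup>2" for N
      proof (rule AE_I2)
        fix t :: real
        show "norm (real N * (1 - exp (- (real m * t\<^sup>2 / real N)))) \<le> real m * t\<^sup>2"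
        proof (cases "N = 0")
          case False
          have "1 - exp (- (real m * t\<^sup>2 / real N)) \<le> real m * t\<^sup>2 / real N"
            using exp_ge_add_one_self[of "- (real m * t\<^sup>2 / real N)"] by simp
          moreover have "exp (- (real m * t\<^sup>2 / real N)) \<le> 1" by (simp add: divide_nonneg_nonneg)
          ultimately show ?thesis using False by (simp add: field_simps)
        qed simp
      qed
      show "AE t in \<mu>. (\<lambda>N. real N * (1 - exp (- (real m * t\<^sup>2 / real N)))) \<longlonglongrightarrow> real m * t\<^sup>2"
      proof (rule AE_I2)
        fix t :: real
        define a where "a = real m * t\<^sup>2"
        \<comment> \<open>The limit is the derivative of exp (- a x) at 0, read along x = 1 / (n +
          1); the index is shifted back at the end.\<close>
        have "((\<lambda>x::real. exp (- a * x)) has_real_derivative (- a)) (at 0)"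
          by (auto intro!: derivative_eq_intros)
        then have "((\<lambda>h. (exp (- a * (0 + h)) - exp (- a * 0)) / h) \<longlongrightarrow> - a) (at 0)" unfolding DERIV_def .
        moreover have "filterlim (\<lambda>n. inverse (real (Suc n))) (at 0) sequentially"
          unfolding filterlim_at using LIMSEQ_inverse_real_of_nat by auto
        ultimately have "(\<lambda>n. (exp (- a * (0 + inverse (real (Suc n)))) - exp (- a * 0)) / inverse (real (Suc n))) \<longlonglongrightarrow> - a"
          by (rule filterlim_compose)
        then have "(\<lambda>n. - ((exp (- a * (0 + inverse (real (Suc n)))) - exp (- a * 0)) / inverse (real (Suc n)))) \<longlonglongrightarrow> - (- a)"
          by (rule tendsto_minus)
        then have "(\<lambda>n. real (Suc n) * (1 - exp (- (a / real (Suc n))))) \<longlonglongrightarrow> a"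
          by (simp add: divide_inverse algebra_simps del: of_nat_Suc)
        from LIMSEQ_imp_Suc[OF this] show "(\<lambda>N. real N * (1 - exp (- (real m * t\<^sup>2 / real N)))) \<longlonglongrightarrow> real m * t\<^sup>2"
          by (simp add: a_def)
      qed
    qed simp_all
    moreover have "(\<integral>t. real N * (1 - exp (- (real m * t\<^sup>2 / real N))) \<partial>\<mu>) = real N * (1 - c N)" for N
    proof -
      have "(\<integral>t. 1 - exp (- (real m * t\<^sup>2 / real N)) \<partial>\<mu>) = 1 - c N"
        unfolding c_def by (subst Bochner_Integration.integral_diff[OF _ ci]) (auto simp: M.prob_space)
      then show ?thesis by (simp only: integral_mult_right_zero)
    qed
    moreover have "(\<integral>t. real m * t\<^sup>2 \<partial>\<mu>) = real m"
      using second_moment by (simp add: has_bochner_integral_iff)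
    ultimately show "(\<lambda>N. real N * (1 - c N)) \<longlonglongrightarrow> real m" by (simp only:)
  qed
  have "eventually (\<lambda>N. (1 - (real N * (1 - c N)) / real N) ^ N = c N ^ N) sequentially"
    using eventually_gt_at_top[of 0] by eventually_elim simp
  from Lim_transform_eventually[OF limc this] show ?thesis unfolding eqc .
qed

text \<open>Law of large numbers: \<open>Z N\<close> tends to \<open>exp (- 1)\<close> in \<open>L\<^sup>2\<close> because its first two moments converge.\<close>
lemma Z_L2: "(\<lambda>N. \<integral>x. norm ((Z N x - exp (- 1))\<^sup>2) \<partial>P) \<longlonglongrightarrow> 0"
proof -
  interpret P: prob_space P by (rule prob_P)
  have int: "integrable P (\<lambda>x. Z N x ^ m)" for N m
    by (rule P.integrable_const_bound[of _ 1]) (auto intro!: AE_I2 power_le_one simp: Z_bound abs_le_iff)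
  have "(\<integral>x. norm ((Z N x - exp (- 1))\<^sup>2) \<partial>P) =
     (\<integral>x. Z N x ^ 2 \<partial>P) - 2 * exp (- 1) * (\<integral>x. Z N x ^ 1 \<partial>P) + exp (- 1) ^ 2" for N
  proof -
    have "(\<integral>x. norm ((Z N x - exp (- 1))\<^sup>2) \<partial>P) = (\<integral>x. Z N x ^ 2 - 2 * exp (- 1) * Z N x ^ 1 + exp (- 1) ^ 2 \<partial>P)"
    proof (intro Bochner_Integration.integral_cong refl)
      fix x
      have "norm ((Z N x - exp (- 1))\<^sup>2) = (Z N x - exp (- 1))\<^sup>2" by simp
      then show "norm ((Z N x - exp (- 1))\<^sup>2) = Z N x ^ 2 - 2 * exp (- 1) * Z N x ^ 1 + exp (- 1) ^ 2"
        by (simp add: power2_diff)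
    qed
    then show ?thesis using int[of N 2] int[of N 1] by (simp add: P.prob_space)
  qed
  moreover have "(\<lambda>N. (\<integral>x. Z N x ^ 2 \<partial>P) - 2 * exp (- 1) * (\<integral>x. Z N x ^ 1 \<partial>P) + exp (- 1) ^ 2) \<longlonglongrightarrow>
     exp (- real 2) - 2 * exp (- 1) * exp (- real 1) + exp (- 1) ^ 2"
    by (intro tendsto_intros laplace_Z)
  moreover have "exp (- real 2) - 2 * exp (- 1) * exp (- real 1) + exp (- 1) ^ 2 = (0::real)"
    by (simp add: power2_eq_square exp_add[symmetric])
  ultimately show ?thesis by simp
qed

text \<open>Along subsequences |x|^2 / N tends to 1 almost everywhere. The rescaling factor then
  tends to 1, the first k coordinates of the projected point converge to those of x, and dominated
  convergence handles bounded continuous test functions.\<close>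

lemma weakly_converges_rescaled: "weakly_converges k (\<lambda>N. marginal k (rescaled_tensor \<mu> N)) (tensor_power \<mu> k)"
  unfolding weakly_converges_def
proof (intro allI impI)
  fix \<phi> :: "(nat \<Rightarrow> real) \<Rightarrow> real"
  assume c: "continuous_on (extensional {..<k}) \<phi>" and b: "bounded (\<phi> ` extensional {..<k})"
  interpret P: prob_space P by (rule prob_P)
  note \<phi>m = measurable_continuous_extensional[OF c]
  obtain B where B: "\<And>x. x \<in> extensional {..<k} \<Longrightarrow> \<bar>\<phi> x\<bar> \<le> B"
    using b unfolding bounded_iff by auto
  define T where "T N x = (\<lambda>i\<in>{..<k}. sqrt (real N) / L2_set x {..<N} * x i)" for N and x :: "nat \<Rightarrow> real"
  have Tm: "T N \<in> measurable P (Rn k)" for N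
    unfolding T_def L2_set_def by (rule measurable_restrict_Rn) measurable
  have Text: "T N x \<in> extensional {..<k}" for N x by (simp add: T_def)
  \<comment> \<open>Once N \<ge> k the restriction is meaningful, and the marginal is the law of
    \<open>T N\<close> under \<open>P\<close>.\<close>
  have marg: "(\<integral>x. \<phi> x \<partial>marginal k (rescaled_tensor \<mu> N)) = (\<integral>x. \<phi> (T N x) \<partial>P)" if N: "N \<ge> k" for N
  proof -
    have r: "(\<lambda>x. restrict x {..<k}) \<in> measurable (Rn N) (Rn k)"
      using N by (intro measurable_restrict_Rn) auto
    have "marginal k (rescaled_tensor \<mu> N) = distr (distr (distr P (Rn N) (\<lambda>x. \<lambda>i\<in>{..<N}. x i)) (Rn N) (to_sphere N)) (Rn k) (\<lambda>x. restrict x {..<k})"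
      unfolding marginal_def rescaled_tensor_def tensor_power_distr ..
    also have "\<dots> = distr P (Rn k) ((\<lambda>x. restrict x {..<k}) \<circ> to_sphere N \<circ> (\<lambda>x. \<lambda>i\<in>{..<N}. x i))"
      using r measurable_P_restrict[of N]
      by (subst distr_distr; (subst distr_distr)?) (auto simp: o_assoc intro!: measurable_comp)
    also have "((\<lambda>x. restrict x {..<k}) \<circ> to_sphere N \<circ> (\<lambda>x. \<lambda>i\<in>{..<N}. x i)) = T N"
    proof -
      have "L2_set (\<lambda>i\<in>{..<N}. x i) {..<N} = L2_set x {..<N}" for x by (rule L2_set_cong) auto
      then show ?thesis using N by (auto simp: fun_eq_iff T_def to_sphere_def)
    qed
    finally show ?thesis using Tm \<phi>m by (simp add: integral_distr)
  qed
  have lim0: "(\<integral>x. \<phi> x \<partial>tensor_power \<mu> k) = (\<integral>x. \<phi> (\<lambda>i\<in>{..<k}. x i) \<partial>P)"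
    unfolding tensor_power_distr using \<phi>m measurable_P_restrict by (intro integral_distr) auto
  have "(\<lambda>N. \<integral>x. \<phi> (T N x) \<partial>P) \<longlonglongrightarrow> (\<integral>x. \<phi> (\<lambda>i\<in>{..<k}. x i) \<partial>P)"
  proof (rule LIMSEQ_if_subsubseq)
    fix r :: "nat \<Rightarrow> nat" assume r: "strict_mono r"
    have "\<exists>s. strict_mono s \<and> (AE x in P. (\<lambda>n. (Z (r (s n)) x - exp (- 1))\<^sup>2) \<longlonglongrightarrow> 0)"
    proof (rule tendsto_L1_AE_subseq)
      show "integrable P (\<lambda>x. (Z (r n) x - exp (- 1))\<^sup>2)" for n
      proof (rule P.integrable_const_bound[of _ 1])
        show "AE x in P. norm ((Z (r n) x - exp (- 1))\<^sup>2) \<le> 1"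
        proof (rule AE_I2)
          fix x
          have "exp (- 1) \<le> (1::real)" "0 \<le> exp (- 1 :: real)" by auto
          then have "\<bar>Z (r n) x - exp (- 1)\<bar> \<le> 1" using Z_bound[of "r n" x] by linarith
          then show "norm ((Z (r n) x - exp (- 1))\<^sup>2) \<le> 1" by (simp add: abs_square_le_1)
        qed
      qed measurable
      show "(\<lambda>n. \<integral>x. norm ((Z (r n) x - exp (- 1))\<^sup>2) \<partial>P) \<longlonglongrightarrow> 0"
        using LIMSEQ_subseq_LIMSEQ[OF Z_L2 r] by (simp add: o_def)
    qed
    then obtain s :: "nat \<Rightarrow> nat" where s: "strict_mono s"
      and sZ: "AE x in P. (\<lambda>n. (Z (r (s n)) x - exp (- 1))\<^sup>2) \<longlonglongrightarrow> 0" by blast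
    have rs: "filterlim (\<lambda>n. r (s n)) at_top sequentially"
      using filterlim_compose[OF filterlim_subseq[OF r] filterlim_subseq[OF s]] .
    have "(\<lambda>n. \<integral>x. \<phi> (T (r (s n)) x) \<partial>P) \<longlonglongrightarrow> (\<integral>x. \<phi> (\<lambda>i\<in>{..<k}. x i) \<partial>P)"
    proof (rule integral_dominated_convergence[where w = "\<lambda>_. B"])
      show "AE x in P. (\<lambda>n. \<phi> (T (r (s n)) x)) \<longlonglongrightarrow> \<phi> (\<lambda>i\<in>{..<k}. x i)"
        using sZ
      proof eventually_elim
        case (elim x)
        have "(\<lambda>n. sqrt ((Z (r (s n)) x - exp (- 1))\<^sup>2)) \<longlonglongrightarrow> sqrt 0" by (intro tendsto_intros elim)
        then have "(\<lambda>n. \<bar>Z (r (s n)) x - exp (- 1)\<bar>) \<longlonglongrightarrow> 0" by simp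
        then have "(\<lambda>n. Z (r (s n)) x) \<longlonglongrightarrow> exp (- 1)"
          by (simp add: tendsto_rabs_zero_iff LIM_zero_iff)
        \<comment> \<open>\<open>Z\<close> is the exponential of minus the mean of the squares, so
          its limit exp (- 1) says that this mean tends to 1.\<close>
        then have "(\<lambda>n. ln (Z (r (s n)) x)) \<longlonglongrightarrow> ln (exp (- 1))" by (intro tendsto_ln) auto
        then have "(\<lambda>n. - ((\<Sum>i<r (s n). (x i)\<^sup>2) / real (r (s n)))) \<longlonglongrightarrow> - 1" by (simp add: Z_def)
        then have "(\<lambda>n. (\<Sum>i<r (s n). (x i)\<^sup>2) / real (r (s n))) \<longlonglongrightarrow> 1" by (simp add: tendsto_minus_cancel_left)
        then have "(\<lambda>n. 1 / sqrt ((\<Sum>i<r (s n). (x i)\<^sup>2) / real (r (s n)))) \<longlonglongrightarrow> 1 / sqrt 1" by (intro tendsto_intros) auto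
        then have q: "(\<lambda>n. sqrt (real (r (s n))) / L2_set x {..<r (s n)}) \<longlonglongrightarrow> 1"
          by (simp add: L2_set_def real_sqrt_divide)
        have "(\<lambda>n. T (r (s n)) x) \<longlonglongrightarrow> (\<lambda>i\<in>{..<k}. x i)"
        proof (rule tendsto_coordinatewise)
          fix i
          show "(\<lambda>n. T (r (s n)) x i) \<longlonglongrightarrow> (\<lambda>i\<in>{..<k}. x i) i"
            using tendsto_mult[OF q tendsto_const[of "x i"]] by (cases "i < k") (auto simp: T_def)
        qed
        then show ?case using Text by (intro continuous_on_tendsto_compose[OF c]) auto
      qed
      show "AE x in P. norm (\<phi> (T (r (s n)) x)) \<le> B" for n
        using B[OF Text] by (intro AE_I2) simp
      show "(\<lambda>x. \<phi> (T (r (s n)) x)) \<in> borel_measurable P" for n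
        by (rule measurable_compose[OF Tm \<phi>m])
      show "(\<lambda>x. \<phi> (\<lambda>i\<in>{..<k}. x i)) \<in> borel_measurable P"
        by (rule measurable_compose[OF measurable_P_restrict \<phi>m])
    qed simp
    then show "\<exists>s :: nat \<Rightarrow> nat. strict_mono s \<and> (\<lambda>n. \<integral>x. \<phi> (T (r (s n)) x) \<partial>P) \<longlonglongrightarrow> (\<integral>x. \<phi> (\<lambda>i\<in>{..<k}. x i) \<partial>P)"
      using s by blast
  qed
  moreover have "eventually (\<lambda>N. (\<integral>x. \<phi> x \<partial>marginal k (rescaled_tensor \<mu> N)) = (\<integral>x. \<phi> (T N x) \<partial>P)) sequentially"
    using eventually_ge_at_top[of k] by eventually_elim (rule marg)
  ultimately show "(\<lambda>N. \<integral>x. \<phi> x \<partial>marginal k (rescaled_tensor \<mu> N)) \<longlonglongrightarrow> (\<integral>x. \<phi> x \<partial>tensor_power \<mu> k)"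
    unfolding lim0 by (simp add: tendsto_cong)
qed

lemma kac_chaotic_rescaled: "kac_chaotic (rescaled_tensor \<mu>) \<mu>"
  unfolding kac_chaotic_def using prob_on_rescaled perm_invariant_rescaled weakly_converges_rescaled by blast

end

subsection \<open>The variational formula on the line and the theorem\<close>

lemma integral_lborel_deriv_compact_support:
  fixes F f :: "real \<Rightarrow> real"
  assumes F: "\<And>x. (F has_real_derivative f x) (at x)" and f: "continuous_on UNIV f"
    and supp: "\<And>x. \<bar>x\<bar> \<ge> R \<Longrightarrow> F x = 0" "\<And>x. \<bar>x\<bar> \<ge> R \<Longrightarrow> f x = 0" and R: "R \<ge> 0"
  shows "(\<integral>x. f x \<partial>lborel) = 0"
proof -
  have "has_bochner_integral lborel (\<lambda>x. f x * indicator {- R .. R} x) (F R - F (- R))"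
    using R F f by (intro has_bochner_integral_FTC_Icc_real) (auto simp: continuous_on_eq_continuous_at)
  moreover have "(\<lambda>x. f x * indicator {- R .. R} x) = f"
  proof
    fix x
    show "f x * indicator {- R .. R} x = f x"
      using supp(2)[of x] by (cases "\<bar>x\<bar> \<ge> R") (auto simp: indicator_def)
  qed
  ultimately show ?thesis using supp(1)[of R] supp(1)[of "- R"] R
    by (simp add: has_bochner_integral_iff)
qed

lemma integral_gauss:
  assumes "f \<in> borel_measurable borel"
  shows "(\<integral>x. f x \<partial>gauss) = (\<integral>x. std_normal_density x * f x \<partial>lborel)"
  unfolding gauss_def using assms by (subst integral_density) auto

lemma bounded_compact_support:
  fixes f :: "real \<Rightarrow> real"
  assumes f: "continuous_on UNIV f" and supp: "\<And>x. \<bar>x\<bar> \<ge> R \<Longrightarrow> f x = 0"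
  obtains B where "\<And>x. \<bar>f x\<bar> \<le> B"
proof -
  have "bounded (f ` {- R .. R})"
    using continuous_on_subset[OF f] by (intro compact_imp_bounded compact_continuous_image) auto
  then obtain B where B: "\<forall>y\<in>f ` {- R .. R}. norm y \<le> B" unfolding bounded_iff by blast
  have "\<bar>f x\<bar> \<le> max 0 B" for x
  proof (cases "\<bar>x\<bar> \<ge> R")
    case False
    then have "x \<in> {- R .. R}" by (simp add: not_le abs_less_iff)
    then have "norm (f x) \<le> B" using B by blast
    then show ?thesis by auto
  qed (simp add: supp)
  then show ?thesis using that by blast
qed

lemma integrable_gauss_compact_support:
  fixes f :: "real \<Rightarrow> real"
  assumes f: "continuous_on UNIV f" and supp: "\<And>x. \<bar>x\<bar> \<ge> R \<Longrightarrow> f x = 0"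
  shows "integrable gauss f"
proof -
  interpret G: prob_space gauss by (rule prob_space_gauss)
  obtain B where "\<And>x. \<bar>f x\<bar> \<le> B" using bounded_compact_support[OF f supp] by blast
  then show ?thesis
    using f by (intro G.integrable_const_bound[of _ B]) (auto intro: borel_measurable_continuous_onI)
qed

lemma std_normal_density_deriv:
  "(std_normal_density has_real_derivative - x * std_normal_density x) (at x)"
proof -
  have "((\<lambda>x. c * exp (- x\<^sup>2 / 2)) has_real_derivative - x * (c * exp (- x\<^sup>2 / 2))) (at x)" for c :: real
    by (auto intro!: derivative_eq_intros)
  then show ?thesis unfolding std_normal_density_def[abs_def] .
qed

lemma continuous_on_std_normal_density: "continuous_on S std_normal_density"
  using std_normal_density_deriv by (intro DERIV_continuous_on) (auto intro: has_field_derivative_at_within)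

section \<open>Test functions on the line and the lower limit\<close>

context fisher_density
begin

text \<open>The derivative of \<phi> h times the Gaussian density has integral 0 by compact support;
  the term - x \<phi> comes from differentiating the Gaussian density.\<close>

lemma gauss_parts:
  assumes \<phi>: "\<And>x. (\<phi> has_real_derivative \<phi>' x) (at x)" and \<phi>'c: "continuous_on UNIV \<phi>'"
    and supp: "\<And>x. \<bar>x\<bar> \<ge> R \<Longrightarrow> \<phi> x = 0" "\<And>x. \<bar>x\<bar> \<ge> R \<Longrightarrow> \<phi>' x = 0" and R: "R \<ge> 0"
  shows "(\<integral>x. (\<phi>' x - x * \<phi> x) * h x \<partial>gauss) = - (\<integral>x. \<phi> x * g x \<partial>gauss)"
proof -
  have \<phi>c: "continuous_on UNIV \<phi>"
    using \<phi> by (intro DERIV_continuous_on) (auto intro: has_field_derivative_at_within)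
  have int: "integrable gauss (\<lambda>x. (\<phi>' x - x * \<phi> x) * h x)" "integrable gauss (\<lambda>x. \<phi> x * g x)"
    by (rule integrable_gauss_compact_support[of _ R]; auto intro!: continuous_intros \<phi>c \<phi>'c h_cont g_cont simp: supp)+
  have "(\<integral>x. std_normal_density x * ((\<phi>' x - x * \<phi> x) * h x + \<phi> x * g x) \<partial>lborel) = 0"
  proof (rule integral_lborel_deriv_compact_support[where F = "\<lambda>x. \<phi> x * h x * std_normal_density x"])
    fix x
    show "((\<lambda>x. \<phi> x * h x * std_normal_density x) has_real_derivative
        std_normal_density x * ((\<phi>' x - x * \<phi> x) * h x + \<phi> x * g x)) (at x)"
      by (rule DERIV_cong[OF DERIV_mult[OF DERIV_mult[OF \<phi> h_deriv] std_normal_density_deriv]])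
         (simp add: algebra_simps)
  qed (use R supp in \<open>auto intro!: continuous_intros \<phi>c \<phi>'c h_cont g_cont continuous_on_std_normal_density\<close>)
  then have "(\<integral>x. (\<phi>' x - x * \<phi> x) * h x + \<phi> x * g x \<partial>gauss) = 0"
    using borel_measurable_continuous_onI[OF \<phi>c] borel_measurable_continuous_onI[OF \<phi>'c]
    by (subst integral_gauss) auto
  then show ?thesis using int by simp
qed

text \<open>The part of I that a concrete test function reaches: the denominator is regularized by
  1/(n+1), the integrand is cut off, and the error of a polynomial approximation is subtracted. That
  error is 1/(n+1) times the mean of 4 |g| + h, and h has mean 1.\<close>

definition lb :: "nat \<Rightarrow> real" where
  "lb n = (\<integral>x. cutoff n x * ((g x)\<^sup>2 / (h x + 1 / real (Suc n))) \<partial>gauss) - (1 / real (Suc n)) * (4 * (\<integral>x. \<bar>g x\<bar> \<partial>gauss) + 1)"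

text \<open>The integrand is dominated by \<open>q\<close>, as enlarging the denominator decreases
  it. At zeros of h it is 0 for every n, because g vanishes there.\<close>

lemma lb_lim: "lb \<longlonglongrightarrow> I"
proof -
  have d0: "(\<lambda>n. 1 / real (Suc n)) \<longlonglongrightarrow> 0"
    using LIMSEQ_inverse_real_of_nat by (simp add: inverse_eq_divide)
  have pos: "h x + 1 / real (Suc n) > 0" for x n
    using h_nonneg[of x] by (simp add: add_nonneg_pos)
  have "(\<lambda>n. \<integral>x. cutoff n x * ((g x)\<^sup>2 / (h x + 1 / real (Suc n))) \<partial>gauss) \<longlonglongrightarrow> (\<integral>x. q x \<partial>gauss)"
  proof (rule integral_dominated_convergence[where w = q, OF _ _ integrable_q])
    show "AE x in gauss. norm (cutoff n x * ((g x)\<^sup>2 / (h x + 1 / real (Suc n)))) \<le> q x" for n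
    proof (rule AE_I2)
      fix x
      have "(g x)\<^sup>2 / (h x + 1 / real (Suc n)) \<le> q x"
      proof (cases "h x = 0")
        case False
        then have "h x > 0" using h_nonneg[of x] by simp
        then show ?thesis unfolding q_def using pos[of x n] by (intro divide_left_mono mult_pos_pos) auto
      qed (simp add: g_zero q_def)
      moreover have "0 \<le> (g x)\<^sup>2 / (h x + 1 / real (Suc n))" using pos[of x n] by simp
      ultimately have "cutoff n x * ((g x)\<^sup>2 / (h x + 1 / real (Suc n))) \<le> 1 * q x"
        using cutoff_01[of n x] by (intro mult_mono) auto
      moreover have "0 \<le> cutoff n x * ((g x)\<^sup>2 / (h x + 1 / real (Suc n)))"
        using cutoff_01[of n x] pos[of x n] by simp
      ultimately show "norm (cutoff n x * ((g x)\<^sup>2 / (h x + 1 / real (Suc n)))) \<le> q x"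
        by (simp only: real_norm_def abs_of_nonneg mult_1)
    qed
    show "AE x in gauss. (\<lambda>n. cutoff n x * ((g x)\<^sup>2 / (h x + 1 / real (Suc n)))) \<longlonglongrightarrow> q x"
    proof (rule AE_I2)
      fix x
      show "(\<lambda>n. cutoff n x * ((g x)\<^sup>2 / (h x + 1 / real (Suc n)))) \<longlonglongrightarrow> q x"
      proof (cases "h x = 0")
        case False
        have "(\<lambda>n. cutoff n x * ((g x)\<^sup>2 / (h x + 1 / real (Suc n)))) \<longlonglongrightarrow> 1 * ((g x)\<^sup>2 / (h x + 0))"
          using False by (intro tendsto_intros cutoff_lim d0) auto
        then show ?thesis by (simp add: q_def)
      qed (simp add: g_zero q_def)
    qed
    have [measurable]: "cutoff n \<in> borel_measurable borel" for n
      by (rule borel_measurable_continuous_onI[OF continuous_on_cutoff(1)])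
    show "(\<lambda>x. cutoff n x * ((g x)\<^sup>2 / (h x + 1 / real (Suc n)))) \<in> borel_measurable gauss" for n
      by (simp del: of_nat_Suc)
  qed simp
  from tendsto_diff[OF this tendsto_mult_right[OF d0, of "4 * (\<integral>x. \<bar>g x\<bar> \<partial>gauss) + 1"]]
  show ?thesis by (simp add: lb_def[abs_def] I_def del: of_nat_Suc)
qed

text \<open>Near-optimal test functions: \<open>g / (h + 1/(n+1))\<close>, cut off and replaced by a polynomial.\<close>
lemma test_function:
  obtains \<phi> \<phi>' R where "\<forall>x. (\<phi> has_real_derivative \<phi>' x) (at x)" "continuous_on UNIV \<phi>'"
    "\<forall>x. R \<le> \<bar>x\<bar> \<longrightarrow> \<phi> x = 0 \<and> \<phi>' x = 0"
    "lb n \<le> (\<integral>x. (- 2 * (\<phi>' x - x * \<phi> x) - (\<phi> x)\<^sup>2) * h x \<partial>gauss)"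
proof -
  define d where "d = 1 / real (Suc n)"
  have d: "0 < d" "d \<le> 1" by (auto simp: d_def)
  define R where "R = real (Suc n)"
  have pos: "h x + d > 0" for x using h_nonneg[of x] d by simp
  \<comment> \<open>For h > 0 the maximizer of 2 \<phi> g - \<phi>^2 h is g / h; adding d keeps the
    quotient continuous at zeros of h.\<close>
  define v where "v x = g x / (h x + d)" for x
  have "continuous_on UNIV v" unfolding v_def
    using pos by (intro continuous_intros g_cont h_cont) (auto simp: less_imp_neq[symmetric])
  then have "continuous_on {- R .. R} v" by (rule continuous_on_subset) simp
  \<comment> \<open>As g is merely continuous, v may fail to be differentiable; a polynomial within
    d of it restores C^1.\<close>
  then obtain p where p: "real_polynomial_function p" "\<And>x. x \<in> {- R .. R} \<Longrightarrow> \<bar>v x - p x\<bar> < d"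
    using Stone_Weierstrass_real_polynomial_function[of "{- R .. R}" v d] d by auto
  obtain p' where p': "real_polynomial_function p'" "\<And>x. (p has_real_derivative p' x) (at x)"
    using has_real_derivative_polynomial_function[OF p(1)] by auto
  have cp: "continuous_on S p" "continuous_on S p'" for S
    using p(1) p'(1) continuous_on_polymonial_function[of p S] continuous_on_polymonial_function[of p' S]
    by (simp_all add: real_polynomial_function_eq)
  define \<phi> where "\<phi> x = cutoff n x * p x" for x
  define \<phi>' where "\<phi>' x = cutoff' n x * p x + p' x * cutoff n x" for x
  have \<phi>: "(\<phi> has_real_derivative \<phi>' x) (at x)" for x
    unfolding \<phi>_def[abs_def] \<phi>'_def by (rule DERIV_mult[OF cutoff_deriv p'(2)])
  have \<phi>'c: "continuous_on UNIV \<phi>'"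
    unfolding \<phi>'_def[abs_def] by (intro continuous_intros continuous_on_cutoff cp)
  have \<phi>c: "continuous_on UNIV \<phi>"
    unfolding \<phi>_def[abs_def] by (intro continuous_intros continuous_on_cutoff cp)
  have supp: "\<phi> x = 0" "\<phi>' x = 0" if "\<bar>x\<bar> \<ge> R" for x
    using cutoff_support[of n x] that by (simp_all add: R_def \<phi>_def \<phi>'_def)
  have R: "R \<ge> 0" by (simp add: R_def)
  have int1: "integrable gauss (\<lambda>x. (\<phi>' x - x * \<phi> x) * h x)" "integrable gauss (\<lambda>x. (\<phi> x)\<^sup>2 * h x)"
    "integrable gauss (\<lambda>x. \<phi> x * g x)" "integrable gauss (\<lambda>x. cutoff n x * ((g x)\<^sup>2 / (h x + d)))"
    by (rule integrable_gauss_compact_support[of _ R];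
        auto intro!: continuous_intros \<phi>c \<phi>'c h_cont g_cont continuous_on_cutoff
        simp: supp cutoff_support R_def less_imp_neq[OF pos, symmetric] simp del: of_nat_Suc)+
  have "(\<integral>x. (- 2 * (\<phi>' x - x * \<phi> x) - (\<phi> x)\<^sup>2) * h x \<partial>gauss) =
      (\<integral>x. - 2 * ((\<phi>' x - x * \<phi> x) * h x) - (\<phi> x)\<^sup>2 * h x \<partial>gauss)"
    by (intro Bochner_Integration.integral_cong refl) (simp add: left_diff_distrib)
  also have "\<dots> = - 2 * (\<integral>x. (\<phi>' x - x * \<phi> x) * h x \<partial>gauss) - (\<integral>x. (\<phi> x)\<^sup>2 * h x \<partial>gauss)"
    using int1 by simp
  also have "\<dots> = 2 * (\<integral>x. \<phi> x * g x \<partial>gauss) - (\<integral>x. (\<phi> x)\<^sup>2 * h x \<partial>gauss)"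
  proof -
    have "(\<integral>x. (\<phi>' x - x * \<phi> x) * h x \<partial>gauss) = - (\<integral>x. \<phi> x * g x \<partial>gauss)"
      by (rule gauss_parts[OF \<phi> \<phi>'c _ _ R]) (simp_all add: supp)
    then show ?thesis by simp
  qed
  also have "\<dots> = (\<integral>x. 2 * (\<phi> x * g x) - (\<phi> x)\<^sup>2 * h x \<partial>gauss)"
    using int1 by simp
  finally have J: "(\<integral>x. (- 2 * (\<phi>' x - x * \<phi> x) - (\<phi> x)\<^sup>2) * h x \<partial>gauss) = (\<integral>x. 2 * (\<phi> x * g x) - (\<phi> x)\<^sup>2 * h x \<partial>gauss)" .
  \<comment> \<open>With \<phi> = c (v + e) and |e| \<le> d, the terms free of e amount to at least
    c v g, by c^2 \<le> c and v^2 h \<le> v g. The errors are 2 d |g| from e g, 2 d |g| from e h v,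
    and d h from e^2 h.\<close>
  have pw: "cutoff n x * ((g x)\<^sup>2 / (h x + d)) - d * (4 * \<bar>g x\<bar> + h x) \<le> 2 * (\<phi> x * g x) - (\<phi> x)\<^sup>2 * h x" for x
  proof (cases "\<bar>x\<bar> \<ge> R")
    case True
    then have "cutoff n x = 0" by (simp add: R_def cutoff_support)
    then show ?thesis using h_nonneg[of x] d by (simp add: \<phi>_def)
  next
    case False
    define c where "c = cutoff n x"
    define e where "e = p x - v x"
    have "x \<in> {- R .. R}" using False by (simp add: not_le abs_less_iff)
    then have e: "\<bar>e\<bar> \<le> d" using p(2)[of x] by (simp add: e_def abs_minus_commute)
    have c: "0 \<le> c" "c \<le> 1" using cutoff_01[of n x] by (auto simp: c_def)
    have c2: "c\<^sup>2 \<le> c" using c by (simp add: power2_eq_square mult_left_le)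
    have vg: "v x * g x = (g x)\<^sup>2 / (h x + d)" by (simp add: v_def power2_eq_square)
    have vg0: "v x * g x \<ge> 0" unfolding vg using pos[of x] by simp
    have vh: "\<bar>h x * v x\<bar> \<le> \<bar>g x\<bar>"
    proof -
      have "\<bar>h x * v x\<bar> = h x / (h x + d) * \<bar>g x\<bar>" using h_nonneg[of x] pos[of x] by (simp add: v_def abs_mult)
      also have "\<dots> \<le> 1 * \<bar>g x\<bar>" using h_nonneg[of x] pos[of x] d by (intro mult_right_mono) auto
      finally show ?thesis by simp
    qed
    have v2h: "(v x)\<^sup>2 * h x \<le> v x * g x"
    proof -
      have "(v x)\<^sup>2 * h x \<le> (v x)\<^sup>2 * (h x + d)" using d by (intro mult_left_mono) auto
      also have "\<dots> = v x * g x" using pos[of x] by (simp add: v_def power2_eq_square)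
      finally show ?thesis .
    qed
    have "2 * (\<phi> x * g x) - (\<phi> x)\<^sup>2 * h x =
       2 * c * (v x * g x) - c\<^sup>2 * ((v x)\<^sup>2 * h x) + (2 * (c * (e * g x)) - 2 * (c\<^sup>2 * (e * (h x * v x))) - c\<^sup>2 * (e\<^sup>2 * h x))"
      by (simp add: \<phi>_def c_def[symmetric] e_def power2_eq_square algebra_simps)
    moreover have "c * (v x * g x) \<le> 2 * c * (v x * g x) - c\<^sup>2 * ((v x)\<^sup>2 * h x)"
    proof -
      have "c\<^sup>2 * ((v x)\<^sup>2 * h x) \<le> c * (v x * g x)"
        by (rule mult_mono[OF c2 v2h]) (use c h_nonneg[of x] in auto)
      then show ?thesis by (simp only: mult.assoc)
    qed
    moreover have "\<bar>c * (e * g x)\<bar> \<le> d * \<bar>g x\<bar>"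
    proof -
      have "\<bar>c * (e * g x)\<bar> \<le> 1 * (d * \<bar>g x\<bar>)" unfolding abs_mult using c e by (intro mult_mono) auto
      then show ?thesis by simp
    qed
    moreover have "\<bar>c\<^sup>2 * (e * (h x * v x))\<bar> \<le> d * \<bar>g x\<bar>"
    proof -
      have "\<bar>c\<^sup>2 * (e * (h x * v x))\<bar> \<le> 1 * (d * \<bar>g x\<bar>)"
        unfolding abs_mult[of "c\<^sup>2"] abs_mult[of e] using c c2 e vh by (intro mult_mono) auto
      then show ?thesis by simp
    qed
    moreover have "c\<^sup>2 * (e\<^sup>2 * h x) \<le> d * h x"
    proof -
      have "e\<^sup>2 \<le> d\<^sup>2" using e d by (metis abs_le_square_iff abs_of_pos)
      also have "\<dots> \<le> d" using d by (simp add: power2_eq_square mult_left_le)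
      finally have "c\<^sup>2 * (e\<^sup>2 * h x) \<le> 1 * (d * h x)"
        using c c2 h_nonneg[of x] d by (intro mult_mono) auto
      then show ?thesis by simp
    qed
    ultimately have "c * (v x * g x) - d * \<bar>g x\<bar> * 4 - d * h x \<le> 2 * (\<phi> x * g x) - (\<phi> x)\<^sup>2 * h x"
      by (simp only: abs_le_iff) linarith
    then show ?thesis unfolding vg c_def by (simp add: algebra_simps)
  qed
  have int2: "integrable gauss (\<lambda>x. d * (4 * \<bar>g x\<bar> + h x))" using integrable_g integrable_h by simp
  have "lb n = (\<integral>x. cutoff n x * ((g x)\<^sup>2 / (h x + d)) - d * (4 * \<bar>g x\<bar> + h x) \<partial>gauss)"
    unfolding lb_def d_def[symmetric] using int1(4) int2 integrable_g integrable_h by (simp add: integral_h)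
  also have "\<dots> \<le> (\<integral>x. 2 * (\<phi> x * g x) - (\<phi> x)\<^sup>2 * h x \<partial>gauss)"
  proof (rule integral_mono[OF _ _ pw])
    show "integrable gauss (\<lambda>x. cutoff n x * ((g x)\<^sup>2 / (h x + d)) - d * (4 * \<bar>g x\<bar> + h x))"
      by (rule Bochner_Integration.integrable_diff[OF int1(4) int2])
    show "integrable gauss (\<lambda>x. 2 * (\<phi> x * g x) - (\<phi> x)\<^sup>2 * h x)"
      by (rule Bochner_Integration.integrable_diff[OF integrable_mult_right[OF int1(3)] int1(2)])
  qed
  finally have "lb n \<le> (\<integral>x. (- 2 * (\<phi>' x - x * \<phi> x) - (\<phi> x)\<^sup>2) * h x \<partial>gauss)"
    unfolding J .
  then show ?thesis
    by (intro that[of \<phi> \<phi>' R] allI impI conjI \<phi> \<phi>'c supp)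
qed

text \<open>A value c below I lies below some \<open>lb n\<close>. The test function found for this
  n is used for all N, and \<open>fisher_test\<close> differs from its limit by a bounded function
  divided by N.\<close>

lemma sphere_fisher_liminf:
  fixes F :: "nat \<Rightarrow> (nat \<Rightarrow> real) measure"
  defines "\<mu> \<equiv> density gauss (\<lambda>x. ennreal (h x))"
  assumes kac: "kac_chaotic F \<mu>" and sph: "\<And>N. N \<ge> 1 \<Longrightarrow> AE y in F N. y \<in> kac_sphere N"
    and c: "c < ennreal I"
  shows "eventually (\<lambda>N. c < sphere_fisher N (F N) / of_nat N) sequentially"
proof -
  have "(\<lambda>n. ennreal (lb n)) \<longlonglongrightarrow> ennreal I" by (rule tendsto_ennrealI[OF lb_lim])
  then have "eventually (\<lambda>n. c < ennreal (lb n)) sequentially" using c by (rule order_tendstoD)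
  then obtain n where n: "c < ennreal (lb n)" by (auto simp: eventually_sequentially)
  obtain \<phi> \<phi>' R where \<phi>0: "\<forall>x. (\<phi> has_real_derivative \<phi>' x) (at x)" and \<phi>'c: "continuous_on UNIV \<phi>'"
    and supp: "\<forall>x. R \<le> \<bar>x\<bar> \<longrightarrow> \<phi> x = 0 \<and> \<phi>' x = 0"
    and lbn: "lb n \<le> (\<integral>x. (- 2 * (\<phi>' x - x * \<phi> x) - (\<phi> x)\<^sup>2) * h x \<partial>gauss)"
    by (rule test_function[of n], rule that)
  have \<phi>: "(\<phi> has_real_derivative \<phi>' x) (at x)" for x using \<phi>0 by blast
  have \<phi>c: "continuous_on UNIV \<phi>"
    using \<phi> by (intro DERIV_continuous_on) (auto intro: has_field_derivative_at_within)
  \<comment> \<open>\<open>fisher_test\<close> splits as \<psi> + \<xi> / N into the Gaussian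
    integrand and the correction caused by the sphere. Compact support of \<phi> and \<phi>' bounds
    both.\<close>
  define \<psi> where "\<psi> x = - 2 * (\<phi>' x - x * \<phi> x) - (\<phi> x)\<^sup>2" for x
  define \<xi> where "\<xi> x = 2 * (x\<^sup>2 * \<phi>' x - x * \<phi> x)" for x
  have \<psi>\<xi>c: "continuous_on UNIV \<psi>" "continuous_on UNIV \<xi>"
    unfolding \<psi>_def[abs_def] \<xi>_def[abs_def] by (intro continuous_intros \<phi>c \<phi>'c)+
  have \<psi>\<xi>0: "\<psi> x = 0" "\<xi> x = 0" if "\<bar>x\<bar> \<ge> R" for x using supp that by (auto simp: \<psi>_def \<xi>_def)
  obtain B1 where B1: "\<And>x. \<bar>\<psi> x\<bar> \<le> B1" using bounded_compact_support[OF \<psi>\<xi>c(1) \<psi>\<xi>0(1)] by blast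
  obtain B2 where B2: "\<And>x. \<bar>\<xi> x\<bar> \<le> B2" using bounded_compact_support[OF \<psi>\<xi>c(2) \<psi>\<xi>0(2)] by blast
  have [measurable]: "\<psi> \<in> borel_measurable borel" "\<xi> \<in> borel_measurable borel"
    using \<psi>\<xi>c by (auto intro: borel_measurable_continuous_onI)
  have test: "fisher_test N \<phi> \<phi>' x = \<psi> x + \<xi> x / real N" for N x
    by (cases "N = 0") (simp_all add: fisher_test_def \<psi>_def \<xi>_def field_simps)
  interpret D: prob_space \<mu> unfolding \<mu>_def by (rule prob_space_density)
  have setsmu: "sets \<mu> = sets borel" by (simp add: \<mu>_def)
  have F: "prob_space (F N)" "sets (F N) = sets (Rn N)" "perm_invariant N (F N)" if "N \<ge> 1" for N
    using kac that by (auto simp: kac_chaotic_def prob_on_Rn_def)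
  have E1: "(\<lambda>N. \<integral>x. \<psi> (x 0) \<partial>marginal 1 (F N)) \<longlonglongrightarrow> (\<integral>x. \<psi> (x 0) \<partial>tensor_power \<mu> 1)"
  proof -
    have "weakly_converges 1 (\<lambda>N. marginal 1 (F N)) (tensor_power \<mu> 1)"
      using kac by (simp add: kac_chaotic_def)
    moreover have "continuous_on (extensional {..<1}) (\<lambda>x :: nat \<Rightarrow> real. \<psi> (x 0))"
      by (rule continuous_on_compose2[OF \<psi>\<xi>c(1) continuous_on_coord]) auto
    moreover have "bounded ((\<lambda>x :: nat \<Rightarrow> real. \<psi> (x 0)) ` extensional {..<1})"
      unfolding bounded_iff using B1 by auto
    ultimately show ?thesis unfolding weakly_converges_def by blast
  qed
  have lim: "(\<integral>x. \<psi> (x 0) \<partial>tensor_power \<mu> 1) = (\<integral>x. \<psi> x * h x \<partial>gauss)"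
  proof -
    have mc: "(\<lambda>x. x 0) \<in> measurable (tensor_power \<mu> 1) \<mu>"
      unfolding tensor_power_def by (intro measurable_component_singleton) auto
    have "(\<integral>x. \<psi> (x 0) \<partial>tensor_power \<mu> 1) = (\<integral>x. \<psi> x \<partial>distr (tensor_power \<mu> 1) \<mu> (\<lambda>x. x 0))"
      using mc by (intro integral_distr[symmetric]) (auto simp: \<mu>_def)
    also have "distr (tensor_power \<mu> 1) \<mu> (\<lambda>x. x 0) = \<mu>"
      by (rule distr_tensor_power_component[OF D.prob_space_axioms]) simp
    also have "(\<integral>x. \<psi> x \<partial>\<mu>) = (\<integral>x. h x * \<psi> x \<partial>gauss)"
      unfolding \<mu>_def by (subst integral_density) (auto simp: h_nonneg)
    finally show ?thesis by (simp add: mult.commute)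
  qed
  have marg: "(\<integral>x. f (x 0) \<partial>marginal 1 (F N)) = (\<integral>y. f (y i) \<partial>F N)"
    if N: "N \<ge> 1" and i: "i < N" and fm [measurable]: "f \<in> borel_measurable borel" for N i and f :: "real \<Rightarrow> real"
  proof -
    note [measurable_cong] = F(2)[OF N]
    have "(\<lambda>x. restrict x {..<1}) \<in> measurable (Rn N) (Rn 1)"
      using N by (intro measurable_restrict_Rn) auto
    then have m1: "(\<lambda>x. restrict x {..<1}) \<in> measurable (F N) (Rn 1)"
      by (simp add: measurable_cong_sets[OF F(2)[OF N] refl])
    have "(\<integral>x. f (x 0) \<partial>marginal 1 (F N)) = (\<integral>y. f (y 0) \<partial>F N)"
      unfolding marginal_def using m1 by (subst integral_distr) auto
    also have "\<dots> = (\<integral>y. f (y i) \<partial>F N)"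
    proof -
      \<comment> \<open>Exchangeability: the transposition of 0 and i identifies the law of
        coordinate i with the first marginal, so all summands have the same mean.\<close>
      define p where "p = Transposition.transpose 0 i"
      have p: "p permutes {..<N}" unfolding p_def using i N by (intro permutes_swap_id) auto
      have inv: "distr (F N) (Rn N) (\<lambda>x. \<lambda>i\<in>{..<N}. x (p i)) = F N"
        using F(3)[OF N] p by (simp add: perm_invariant_def)
      have "(\<lambda>x. \<lambda>i\<in>{..<N}. x (p i)) \<in> measurable (Rn N) (Rn N)"
      proof (rule measurable_restrict_Rn)
        fix k assume "k < N"
        then have "p k < N" using permutes_in_image[OF p, of k] by simp
        then show "(\<lambda>x. x (p k)) \<in> borel_measurable (Rn N)" by simp
      qed
      then have mp: "(\<lambda>x. \<lambda>i\<in>{..<N}. x (p i)) \<in> measurable (F N) (Rn N)"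
        by (simp add: measurable_cong_sets[OF F(2)[OF N] refl])
      have "(\<lambda>y. f (y 0)) \<in> borel_measurable (Rn N)"
        using measurable_compose[OF measurable_Rn_component fm, of 0 N] N by simp
      then have "(\<integral>y. f (y 0) \<partial>distr (F N) (Rn N) (\<lambda>x. \<lambda>i\<in>{..<N}. x (p i))) = (\<integral>y. f ((\<lambda>i\<in>{..<N}. y (p i)) 0) \<partial>F N)"
        using mp by (intro integral_distr)
      then show ?thesis unfolding inv using N by (simp add: p_def)
    qed
    finally show ?thesis .
  qed
  define b where "b N = (\<integral>y. \<psi> (y 0) \<partial>F N) - B2 / real N" for N
  have B20: "B2 \<ge> 0" using B2[of 0] by linarith
  have low: "ennreal (b N) \<le> sphere_fisher N (F N) / of_nat N" if N: "N \<ge> 1" for N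
  proof -
    interpret FN: prob_space "F N" by (rule F(1)[OF N])
    have m: "(\<lambda>y. f (y j)) \<in> borel_measurable (F N)" if "f \<in> borel_measurable borel" "j < N" for f :: "real \<Rightarrow> real" and j
      using that by (simp add: measurable_cong_sets[OF F(2)[OF N] refl])
    have int: "integrable (F N) (\<lambda>y. \<psi> (y j))" "integrable (F N) (\<lambda>y. \<xi> (y j))" if "j < N" for j
      by (rule FN.integrable_const_bound[of _ B1]; use B1 that in \<open>auto intro!: m\<close>)
         (rule FN.integrable_const_bound[of _ B2]; use B2 that in \<open>auto intro!: m\<close>)
    have val: "(\<integral>y. fisher_test N \<phi> \<phi>' (y j) \<partial>F N) \<ge> b N" if j: "j < N" for j
    proof -
      have "(\<integral>y. fisher_test N \<phi> \<phi>' (y j) \<partial>F N) = (\<integral>y. \<psi> (y j) \<partial>F N) + (\<integral>y. \<xi> (y j) \<partial>F N) / real N"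
        unfolding test using int[OF j] by simp
      moreover have "(\<integral>y. \<psi> (y j) \<partial>F N) = (\<integral>y. \<psi> (y 0) \<partial>F N)"
        using marg[OF N j, of \<psi>] marg[OF N, of 0 \<psi>] N by simp
      moreover have "- B2 \<le> (\<integral>y. \<xi> (y j) \<partial>F N)"
      proof -
        have "(\<integral>y. - B2 \<partial>F N) \<le> (\<integral>y. \<xi> (y j) \<partial>F N)"
          using int[OF j] B2 by (intro integral_mono) (auto simp: abs_le_iff minus_le_iff)
        then show ?thesis by (simp add: FN.prob_space)
      qed
      then have "- (B2 / real N) \<le> (\<integral>y. \<xi> (y j) \<partial>F N) / real N" using N by (simp add: field_simps)
      ultimately show ?thesis unfolding b_def by linarith
    qed
    have intt: "integrable (F N) (\<lambda>y. fisher_test N \<phi> \<phi>' (y j))" if j: "j < N" for j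
      unfolding test using int[OF j] by simp
    have "real N * b N = (\<Sum>j<N. b N)" by simp
    also have "\<dots> \<le> (\<Sum>j<N. \<integral>y. fisher_test N \<phi> \<phi>' (y j) \<partial>F N)" by (intro sum_mono val) simp
    also have "\<dots> = (\<integral>y. (\<Sum>j<N. fisher_test N \<phi> \<phi>' (y j)) \<partial>F N)"
      using intt by (intro Bochner_Integration.integral_sum[symmetric]) simp
    also have "\<dots> = (\<integral>y. indicator (kac_sphere N) y * (\<Sum>j<N. fisher_test N \<phi> \<phi>' (y j)) \<partial>F N)"
    proof (rule integral_cong_AE)
      have i: "integrable (F N) (\<lambda>y. \<Sum>j<N. fisher_test N \<phi> \<phi>' (y j))"
        using intt by (intro Bochner_Integration.integrable_sum) simp
      then show "(\<lambda>y. \<Sum>j<N. fisher_test N \<phi> \<phi>' (y j)) \<in> borel_measurable (F N)"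
        by (rule borel_measurable_integrable)
      have "kac_sphere N \<in> sets (F N)" by (simp add: F(2)[OF N] sets_kac_sphere)
      then show "(\<lambda>y. indicator (kac_sphere N) y * (\<Sum>j<N. fisher_test N \<phi> \<phi>' (y j))) \<in> borel_measurable (F N)"
        using borel_measurable_integrable[OF i] by measurable
      show "AE y in F N. (\<Sum>j<N. fisher_test N \<phi> \<phi>' (y j)) = indicator (kac_sphere N) y * (\<Sum>j<N. fisher_test N \<phi> \<phi>' (y j))"
        using sph[OF N] by eventually_elim simp
    qed
    finally have "ennreal (real N * b N) \<le> sphere_fisher N (F N)"
      using sphere_fisher_lower[OF N F(1)[OF N] \<phi> \<phi>'c] ennreal_leI order_trans by blast
    then have "ennreal (real N * b N) / of_nat N \<le> sphere_fisher N (F N) / of_nat N"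
      by (rule divide_right_mono_ennreal)
    \<comment> \<open>A negative \<open>b N\<close> is harmless because \<open>ennreal\<close> maps
      it to 0.\<close>
    moreover have "ennreal (b N) \<le> ennreal (real N * b N) / of_nat N"
    proof (cases "b N \<ge> 0")
      case True
      then have "ennreal (real N * b N) / of_nat N = ennreal (real N * b N / real N)"
        using N unfolding ennreal_of_nat_eq_real_of_nat by (intro divide_ennreal) auto
      then show ?thesis using N by simp
    qed (simp add: ennreal_neg)
    ultimately show ?thesis by simp
  qed
  have "(\<lambda>N. (\<integral>x. \<psi> (x 0) \<partial>marginal 1 (F N)) - B2 / real N) \<longlonglongrightarrow> (\<integral>x. \<psi> x * h x \<partial>gauss) - 0"
    using E1 unfolding lim by (intro tendsto_diff lim_const_over_n) auto
  moreover have "eventually (\<lambda>N. (\<integral>x. \<psi> (x 0) \<partial>marginal 1 (F N)) - B2 / real N = b N) sequentially"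
    using eventually_ge_at_top[of 1]
  proof eventually_elim
    case (elim N)
    have "(\<integral>x. \<psi> (x 0) \<partial>marginal 1 (F N)) = (\<integral>y. \<psi> (y 0) \<partial>F N)"
      using elim by (intro marg) auto
    then show ?case by (simp add: b_def)
  qed
  ultimately have "b \<longlonglongrightarrow> (\<integral>x. \<psi> x * h x \<partial>gauss) - 0"
    by (rule Lim_transform_eventually)
  then have "(\<lambda>N. ennreal (b N)) \<longlonglongrightarrow> ennreal (\<integral>x. \<psi> x * h x \<partial>gauss)"
    by (intro tendsto_ennrealI) simp
  moreover have "c < ennreal (\<integral>x. \<psi> x * h x \<partial>gauss)"
    using n ennreal_leI[OF lbn] unfolding \<psi>_def by (rule less_le_trans)
  ultimately have "eventually (\<lambda>N. c < ennreal (b N)) sequentially"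
    by (rule order_tendstoD)
  then show ?thesis
    using eventually_ge_at_top[of 1] by eventually_elim (use low less_le_trans in blast)
qed

end

theorem theorem34:
  fixes f :: "real \<Rightarrow> real"
  assumes "f \<in> borel_measurable borel"
    and "\<And>x. 0 \<le> f x"
    and "has_bochner_integral lborel f 1"
    and "has_bochner_integral lborel (\<lambda>x. x\<^sup>2 * f x) 1"
    and "relative_fisher (density lborel (\<lambda>x. ennreal (f x))) gauss < \<infinity>"
  shows "fisher_chaotic (rescaled_tensor (density lborel (\<lambda>x. ennreal (f x))))
           (density lborel (\<lambda>x. ennreal (f x)))"
proof -
  define \<mu> where "\<mu> = density lborel (\<lambda>x. ennreal (f x))"
  note [measurable] = assms(1)
  have nn: "(\<integral>\<^sup>+x. ennreal (f x) \<partial>lborel) = 1" "(\<integral>\<^sup>+x. ennreal (x\<^sup>2 * f x) \<partial>lborel) = 1"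
    using assms(2-4) by (auto simp: has_bochner_integral_iff nn_integral_eq_integral)
  have sets_mu: "sets \<mu> = sets borel" by (simp add: \<mu>_def)
  have prob_mu: "prob_space \<mu>"
    unfolding \<mu>_def using nn by (intro prob_spaceI) (simp add: emeasure_density)
  interpret V: unit_variance \<mu>
  proof (rule unit_variance.intro[OF prob_mu sets_mu])
    show "has_bochner_integral \<mu> (\<lambda>x. x\<^sup>2) 1"
      using assms(2,4) unfolding \<mu>_def
      by (intro has_bochner_integral_density) (auto simp: mult.commute)
    show "emeasure \<mu> {0} = 0"
    proof -
      have "emeasure \<mu> {0} = (\<integral>\<^sup>+x. ennreal (f x) * indicator {0} x \<partial>lborel)"
        unfolding \<mu>_def by (subst emeasure_density) auto
      also have "\<dots> = (\<integral>\<^sup>+x. 0 \<partial>lborel)"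
        by (simp add: nn_integral_null_set null_sets_def)
      finally show ?thesis by simp
    qed
  qed
  \<comment> \<open>Every version of the density with finite value satisfies the assumptions of the
    one-dimensional theory; its mass and second moment are transferred from f.\<close>
  have pair: "fisher_density h g \<and> (\<integral>\<^sup>+x. ennreal ((norm (g x))\<^sup>2 / h x) \<partial>gauss) = ennreal (fisher_density.I h g)"
    if h: "\<forall>x. 0 \<le> h x" "\<forall>x. GDERIV h x :> g x" "continuous_on UNIV g" "\<mu> = density gauss (\<lambda>x. ennreal (h x))"
      and fin: "(\<integral>\<^sup>+x. ennreal ((norm (g x))\<^sup>2 / h x) \<partial>gauss) < \<infinity>" for h g :: "real \<Rightarrow> real"
  proof -
    have "continuous_on UNIV h"
      using h(2) by (intro DERIV_continuous_on) (auto intro: has_field_derivative_at_within)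
    then have [measurable]: "h \<in> borel_measurable borel" by (rule borel_measurable_continuous_onI)
    have "(\<integral>\<^sup>+x. ennreal (h x) \<partial>gauss) = emeasure \<mu> UNIV"
      unfolding h(4) by (subst emeasure_density) auto
    also have "\<dots> = 1" using V.M.emeasure_space_1 by simp
    finally have 1: "(\<integral>\<^sup>+x. ennreal (h x) \<partial>gauss) = 1" .
    have "(\<integral>\<^sup>+x. ennreal (x\<^sup>2 * h x) \<partial>gauss) = (\<integral>\<^sup>+x. ennreal (x\<^sup>2) \<partial>\<mu>)"
      unfolding h(4) using h(1) by (subst nn_integral_density) (auto simp: ennreal_mult mult.commute intro!: nn_integral_cong)
    also have "\<dots> = (\<integral>\<^sup>+x. ennreal (x\<^sup>2 * f x) \<partial>lborel)"
      unfolding \<mu>_def using assms(2) by (subst nn_integral_density) (auto simp: ennreal_mult mult.commute intro!: nn_integral_cong)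
    finally have 2: "(\<integral>\<^sup>+x. ennreal (x\<^sup>2 * h x) \<partial>gauss) = 1" using nn by simp
    have fd: "fisher_density h g"
      using h 1 2 fin by unfold_locales auto
    then show ?thesis using fisher_density.I_eq[OF fd] by simp
  qed
  let ?J = "relative_fisher \<mu> gauss"
  have J: "?J < \<infinity>" using assms(5) by (simp add: \<mu>_def)
  \<comment> \<open>The limit is itself an infimum, so the bound is proved against each version; a
    version of infinite value is a trivial bound.\<close>
  have upper: "sphere_fisher N (rescaled_tensor \<mu> N) / of_nat N \<le> ?J" if N: "N \<ge> 1" for N
    unfolding relative_fisher_def
  proof (rule Inf_greatest)
    fix v assume "v \<in> {(\<integral>\<^sup>+x. ennreal ((norm (g x))\<^sup>2 / h x) \<partial>gauss) | h g.
      (\<forall>x. 0 \<le> h x) \<and> (\<forall>x. GDERIV h x :> g x) \<and> continuous_on UNIV g \<and> \<mu> = density gauss (\<lambda>x. ennreal (h x))}"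
    then obtain h g :: "real \<Rightarrow> real"
      where h: "\<forall>x. 0 \<le> h x" "\<forall>x. GDERIV h x :> g x" "continuous_on UNIV g" "\<mu> = density gauss (\<lambda>x. ennreal (h x))"
        and v: "v = (\<integral>\<^sup>+x. ennreal ((norm (g x))\<^sup>2 / h x) \<partial>gauss)" by blast
    show "sphere_fisher N (rescaled_tensor \<mu> N) / of_nat N \<le> v"
    proof (cases "(\<integral>\<^sup>+x. ennreal ((norm (g x))\<^sup>2 / h x) \<partial>gauss) < \<infinity>")
      case True
      interpret fisher_density h g using pair[OF h True] by simp
      obtain K where K: "prob_space K" "sets K = sets borel" "AE s in K. s > 0" "(\<integral>\<^sup>+s. ennreal (s\<^sup>2) \<partial>K) = 1"
         "\<And>G. G \<in> borel_measurable (Rn N) \<Longrightarrow> (\<integral>\<^sup>+x. G x \<partial>tensor_power gauss N) =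
           (\<integral>\<^sup>+y. \<integral>\<^sup>+s. G (\<lambda>i\<in>{..<N}. s * y i) \<partial>K \<partial>uniform_sphere N)"
        using gauss_polar[OF N] by blast
      interpret fisher_density_polar h g N K
        using N K by (intro fisher_density_polar.intro fisher_density_axioms polar_kernel.intro) auto
      have "sphere_fisher N (rescaled_tensor \<mu> N) / of_nat N \<le> ennreal (real (N - 1) * I) / of_nat N"
        using sphere_fisher_upper unfolding h(4) by (rule divide_right_mono_ennreal)
      also have "\<dots> = ennreal (real (N - 1) * I / real N)"
        using N I_nonneg unfolding ennreal_of_nat_eq_real_of_nat by (intro divide_ennreal) auto
      also have "\<dots> \<le> ennreal I"
      proof (rule ennreal_leI)
        have "real (N - 1) * I \<le> real N * I" using I_nonneg by (intro mult_right_mono) auto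
        then show "real (N - 1) * I / real N \<le> I" using N by (simp add: divide_le_eq mult.commute)
      qed
      also have "\<dots> = (\<integral>\<^sup>+x. ennreal ((norm (g x))\<^sup>2 / h x) \<partial>gauss)" using pair[OF h True] by simp
      finally show ?thesis unfolding v .
    next
      case False
      then have "(\<integral>\<^sup>+x. ennreal ((norm (g x))\<^sup>2 / h x) \<partial>gauss) = \<top>"
        unfolding infinity_ennreal_def by (metis top.not_eq_extremum)
      then show ?thesis unfolding v by simp
    qed
  qed
  have "(\<lambda>N. sphere_fisher N (rescaled_tensor \<mu> N) / of_nat N) \<longlonglongrightarrow> ?J"
  proof (rule order_tendstoI)
    fix c assume c: "c < ?J"
    \<comment> \<open>Any version of finite value serves: its I is at least the infimum, hence above
      c.\<close>
    obtain h g :: "real \<Rightarrow> real" where h: "\<forall>x. 0 \<le> h x" "\<forall>x. GDERIV h x :> g x" "continuous_on UNIV g"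
        "\<mu> = density gauss (\<lambda>x. ennreal (h x))" and fin: "(\<integral>\<^sup>+x. ennreal ((norm (g x))\<^sup>2 / h x) \<partial>gauss) < \<infinity>"
      using J unfolding relative_fisher_def Inf_less_iff by blast
    interpret fisher_density h g using pair[OF h fin] by simp
    have "?J \<le> (\<integral>\<^sup>+x. ennreal ((norm (g x))\<^sup>2 / h x) \<partial>gauss)"
      unfolding relative_fisher_def using h by (intro Inf_lower) blast
    also have "\<dots> = ennreal I" using pair[OF h fin] by simp
    finally have "c < ennreal I" using c by simp
    moreover have "kac_chaotic (rescaled_tensor \<mu>) (density gauss (\<lambda>x. ennreal (h x)))"
      using V.kac_chaotic_rescaled unfolding h(4)[symmetric] .
    ultimately show "eventually (\<lambda>N. c < sphere_fisher N (rescaled_tensor \<mu> N) / of_nat N) sequentially"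
      using V.AE_rescaled_kac_sphere by (intro sphere_fisher_liminf)
  next
    fix c assume c: "?J < c"
    show "eventually (\<lambda>N. sphere_fisher N (rescaled_tensor \<mu> N) / of_nat N < c) sequentially"
      using eventually_ge_at_top[of "1 :: nat"] by eventually_elim (rule le_less_trans[OF upper c])
  qed
  then show ?thesis
    using V.AE_rescaled_kac_sphere V.kac_chaotic_rescaled J
    unfolding fisher_chaotic_def \<mu>_def[symmetric] by blast
qed

end
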